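(* Let $\mathbf{RG}^+$ be the dichromatic category $\mathbf{RG}$ quotiented by the Euler decomposition of the Hadamard gate, let $\mathbf{RGB}$ be the trichromatic category, let $\hat{\mathcal T}:\mathbf{RG}^+\to\mathbf{RGB}$ be the functor induced by the translation $\mathcal T$, and let $\mathcal S:\mathbf{RGB}\to\mathbf{RG}^+$ be the functor given on generators in the context. Then $\mathcal S$ is the inverse functor of $\hat{\mathcal T}$, i.e. $\mathcal S\circ\hat{\mathcal T}=\mathrm{id}_{\mathbf{RG}^+}$ and $\hat{\mathcal T}\circ\mathcal S=\mathrm{id}_{\mathbf{RGB}}$. In other words, $\mathbf{RGB}$ and $\mathbf{RG}^+$ are isomorphic categories.
   Context: **Conventions.** All monoidal categories are strict. Composition is written in diagrammatic order: $f;g$ means first $f$, then $g$. $\mathrm{id}$ is the identity on $*$ and $\sigma:*\otimes *\to *\otimes *$ is the symmetry. Phases lie in $C_4=\mathbb Z/4\mathbb Z=\{0,1,2,3\}$. Both categories below are symmetric monoidal categories presented by generators and relations, with objects $*^n$ ($n\ge 0$, $n$-fold monoidal products of one object $*$; $*^0$ is the unit). Morphisms are open directed graphs built from the generators by composition and monoidal product, considered up to graph topology (only connectivity, and the order of the overall inputs and outputs, matters; in particular the legs of a node may be permuted freely), and modulo the listed relations. Connected components of a graph which are connected to neither an input nor an output are ignored (deleted). **Spiders.** Each colour $x$ has generators: unit $x_{0,1}:*^0\to *$, counit $x_{1,0}:*\to *^0$, multiplication $x_{2,1}:*^2\to *$, comultiplication $x_{1,2}:*\to *^2$, phase gates $x_{1,1}(\theta):*\to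 *$ for $\theta\in C_4$. Write $x_{m,n}(\theta):*^m\to *^n$ for the node obtained by combining $m$ inputs by multiplications (the unit if $m=0$), then applying $x_{1,1}(\theta)$, then producing $n$ outputs by comultiplications (the counit if $n=0$). Write $x_{m,n}=x_{m,n}(0)$. The *spider rules* for $x$ are: a node with phase $0$ equals the node with no phase; $x_{1,1}(0)=\mathrm{id}$; and two nodes of colour $x$ with phases $\alpha,\beta$ joined by $k\ge1$ wires fuse: $(x_{m,n+k}(\alpha)\otimes \mathrm{id}_{*^{m'}});(\mathrm{id}_{*^n}\otimes x_{k+m',n'}(\beta))=x_{m+m',n+n'}(\alpha+\beta)$. **Category $\mathbf{RG}$.** Generators: two colours, green $g$ and red $r$, and a gate $H:*\to *$. Relations: - the spider rules for $g$; - $(g_{1,2}\otimes g_{1,2});(\mathrm{id}\otimes\sigma\otimes\mathrm{id});(r_{2,1}\otimes r_{2,1})=r_{2,1};g_{1,2}$; - $r_{0,1};g_{1,2}=r_{0,1}\otimes r_{0,1}$; - $g_{0,2}=r_{0,2}$; - $r_{1,1}(2);g_{1,2}=g_{1,2};(r_{1,1}(2)\otimes r_{1,1}(2))$; - $g_{1,1}(2);r_{1,1}(\theta)=r_{1,1}(-\theta);g_{1,1}(2)$; - $H;H=\mathrm{id}$; - $g_{m,n}(\theta)=H^{\otimes m};r_{m,n}(\theta);H^{\otimes n}$ for all $m,n,\theta$. All equations also hold after reversing all arrows and negating all phases ($\dagger$, with $H$ unchanged), and under exchanging the colours $g$ and $r$. **Category $\mathbf{RGB}$.** Generators: three colours,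 red $R$, green $G$, blue $B$ (no Hadamard generator). Relations: - the spider rules for $G$; - $B_{0,1};G_{1,2}=B_{0,1}\otimes B_{0,1}$; - $R_{2,1}(3);G_{1,0}=G_{1,0}\otimes G_{1,0}$; - $(G_{1,2}\otimes G_{1,2});(\mathrm{id}\otimes\sigma\otimes\mathrm{id});(R_{2,1}(3)\otimes R_{2,1}(3))=R_{2,1}(3);G_{1,2}$; - $(\mathrm{id}\otimes R_{0,1});G_{2,1}=G_{1,1}(1)$; - $G_{1,1}(1);B_{1,1}(1)=R_{1,1}(1);G_{1,1}(1)=B_{1,1}(1);R_{1,1}(1)$; call this morphism $c$ and put $\bar c:=c;c$; - $\bar c^{\otimes m};B_{m,n}(\theta);c^{\otimes n}=G_{m,n}(\theta)=c^{\otimes m};R_{m,n}(\theta);\bar c^{\otimes n}$ for all $m,n,\theta$; - $(\mathrm{id}\otimes G_{0,2});(R_{2,0}\otimes\mathrm{id})=(\mathrm{id}\otimes R_{0,2});(G_{2,0}\otimes\mathrm{id})=R_{1,1}(2)$; - $(\mathrm{id}\otimes B_{0,2});(G_{2,0}\otimes\mathrm{id})=(\mathrm{id}\otimes G_{0,2});(B_{2,0}\otimes\mathrm{id})=G_{1,1}(2)$; - $(\mathrm{id}\otimes R_{0,2});(B_{2,0}\otimes\mathrm{id})=(\mathrm{id}\otimes B_{0,2});(R_{2,0}\otimes\mathrm{id})=B_{1,1}(2)$. All equations also hold after reversing all arrows and negating all phases ($\dagger$), and under even (cyclic) permutations of the three colours. **Translation $\mathcal T:\mathbf{RG}\to\mathbf{RGB}$.**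 It sends $*$ to $*$, respects composition and monoidal product, and on generators: $g_{1,0}\mapsto G_{1,0}$, $g_{0,1}\mapsto G_{0,1}$, $g_{1,1}(\theta)\mapsto G_{1,1}(\theta)$, $g_{1,2}\mapsto G_{1,2}$, $g_{2,1}\mapsto G_{2,1}$; $r_{1,0}\mapsto R_{1,0}(3)$, $r_{0,1}\mapsto R_{0,1}(1)$, $r_{1,1}(\theta)\mapsto R_{1,1}(\theta)$, $r_{1,2}\mapsto R_{1,2}(1)$, $r_{2,1}\mapsto R_{2,1}(3)$; $H\mapsto G_{1,1}(1);R_{1,1}(1);G_{1,1}(1)$. **Category $\mathbf{RG}^+$ and $\hat{\mathcal T}$.** $\mathbf{RG}^+$ is the quotient (as a monoidal category) of $\mathbf{RG}$ by the additional relation $H=g_{1,1}(1);r_{1,1}(1);g_{1,1}(1)$. $\hat{\mathcal T}:\mathbf{RG}^+\to\mathbf{RGB}$ is the functor with $\hat{\mathcal T}\circ\mathcal Q=\mathcal T$, where $\mathcal Q:\mathbf{RG}\to\mathbf{RG}^+$ is the quotient functor. **Functor $\mathcal S:\mathbf{RGB}\to\mathbf{RG}^+$.** It sends $*$ to $*$, respects composition and monoidal product, and on generators: $G_{1,0}\mapsto g_{1,0}$, $G_{0,1}\mapsto g_{0,1}$, $G_{1,1}(\theta)\mapsto g_{1,1}(\theta)$, $G_{1,2}\mapsto g_{1,2}$, $G_{2,1}\mapsto g_{2,1}$; $R_{1,0}\mapsto r_{1,0}(1)$, $R_{0,1}\mapsto r_{0,1}(3)$, $R_{1,1}(\theta)\mapsto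 r_{1,1}(\theta)$, $R_{1,2}\mapsto r_{1,2}(3)$, $R_{2,1}\mapsto r_{2,1}(1)$; $B_{1,0}\mapsto r_{1,0}$, $B_{0,1}\mapsto r_{0,1}$, $B_{1,1}(\theta)\mapsto g_{1,1}(3);r_{1,1}(\theta);g_{1,1}(1)$, $B_{1,2}\mapsto g_{1,1}(3);r_{1,2};(g_{1,1}(1)\otimes g_{1,1}(1))$, $B_{2,1}\mapsto (g_{1,1}(3)\otimes g_{1,1}(3));r_{2,1};g_{1,1}(1)$. *)

theory Defs
  imports "HOL-Library.Numeral_Type"
begin

section \<open>Strict symmetric monoidal categories with objects \<open>*\<^sup>n\<close>\<close>

text \<open>
  The object \<open>*\<^sup>n\<close> is represented by \<open>n\<close>, so that the monoidal product of objects is addition.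
  Composition \<open>cmp\<close> is in diagrammatic order.
\<close>

record 'a smcat =
  mor :: "nat \<Rightarrow> nat \<Rightarrow> 'a set"
  idt :: "nat \<Rightarrow> 'a"
  sym :: "nat \<Rightarrow> nat \<Rightarrow> 'a"
  cmp :: "'a \<Rightarrow> 'a \<Rightarrow> 'a"
  tns :: "'a \<Rightarrow> 'a \<Rightarrow> 'a"

locale strict_smc =
  fixes C :: "'a smcat"
  assumes idt_mor: "idt C n \<in> mor C n n"
    and sym_mor: "sym C m n \<in> mor C (m + n) (n + m)"
    and cmp_mor: "f \<in> mor C m n \<Longrightarrow> g \<in> mor C n p \<Longrightarrow> cmp C f g \<in> mor C m p"
    and tns_mor: "f \<in> mor C m n \<Longrightarrow> g \<in> mor C p q \<Longrightarrow> tns C f g \<in> mor C (m + p) (n + q)"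
    and mor_disjoint: "f \<in> mor C m n \<Longrightarrow> f \<in> mor C p q \<Longrightarrow> m = p \<and> n = q"
    and cmp_idt_left: "f \<in> mor C m n \<Longrightarrow> cmp C (idt C m) f = f"
    and cmp_idt_right: "f \<in> mor C m n \<Longrightarrow> cmp C f (idt C n) = f"
    and cmp_assoc: "f \<in> mor C m n \<Longrightarrow> g \<in> mor C n p \<Longrightarrow> h \<in> mor C p q \<Longrightarrow>
      cmp C (cmp C f g) h = cmp C f (cmp C g h)"
    and tns_unit_left: "f \<in> mor C m n \<Longrightarrow> tns C (idt C 0) f = f"
    and tns_unit_right: "f \<in> mor C m n \<Longrightarrow> tns C f (idt C 0) = f"
    and tns_assoc: "f \<in> mor C m n \<Longrightarrow> g \<in> mor C m' n' \<Longrightarrow> h \<in> mor C m'' n'' \<Longrightarrow>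
      tns C (tns C f g) h = tns C f (tns C g h)"
    and tns_idt: "tns C (idt C m) (idt C n) = idt C (m + n)"
    and interchange: "f \<in> mor C m n \<Longrightarrow> g \<in> mor C n p \<Longrightarrow> f' \<in> mor C m' n' \<Longrightarrow> g' \<in> mor C n' p' \<Longrightarrow>
      tns C (cmp C f g) (cmp C f' g') = cmp C (tns C f f') (tns C g g')"
    and sym_inverse: "cmp C (sym C m n) (sym C n m) = idt C (m + n)"
    and sym_natural: "f \<in> mor C m n \<Longrightarrow> g \<in> mor C p q \<Longrightarrow>
      cmp C (tns C f g) (sym C n q) = cmp C (sym C m p) (tns C g f)"
    and sym_unit: "sym C m 0 = idt C m"
    and sym_hexagon: "sym C m (n + p) =
      cmp C (tns C (sym C m n) (idt C p)) (tns C (idt C n) (sym C m p))"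

text \<open>
  A functor sending \<open>*\<close> to \<open>*\<close> and respecting the monoidal product is the identity on objects;
  it is given by its action on morphisms.
\<close>

definition smc_functor :: "'a smcat \<Rightarrow> 'b smcat \<Rightarrow> ('a \<Rightarrow> 'b) \<Rightarrow> bool" where
  "smc_functor C D F \<longleftrightarrow> strict_smc C \<and> strict_smc D \<and>
     (\<forall>m n. \<forall>f\<in>mor C m n. F f \<in> mor D m n) \<and>
     (\<forall>n. F (idt C n) = idt D n) \<and>
     (\<forall>m n. F (sym C m n) = sym D m n) \<and>
     (\<forall>m n p. \<forall>f\<in>mor C m n. \<forall>g\<in>mor C n p. F (cmp C f g) = cmp D (F f) (F g)) \<and>
     (\<forall>m n p q. \<forall>f\<in>mor C m n. \<forall>g\<in>mor C p q. F (tns C f g) = tns D (F f) (F g))"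

definition inverse_functors :: "'a smcat \<Rightarrow> 'b smcat \<Rightarrow> ('a \<Rightarrow> 'b) \<Rightarrow> ('b \<Rightarrow> 'a) \<Rightarrow> bool" where
  "inverse_functors C D F G \<longleftrightarrow> smc_functor C D F \<and> smc_functor D C G \<and>
     (\<forall>m n. \<forall>f\<in>mor C m n. G (F f) = f) \<and>
     (\<forall>m n. \<forall>f\<in>mor D m n. F (G f) = f)"

definition isomorphic_smc :: "'a smcat \<Rightarrow> 'b smcat \<Rightarrow> bool" where
  "isomorphic_smc C D \<longleftrightarrow> (\<exists>F G. inverse_functors C D F G)"


section \<open>Presentations by generators and relations\<close>

datatype 'g diag =
    Box 'g
  | Ids nat
  | Braid nat nat
  | Seq "'g diag" "'g diag"  (infixl "\<Zsemi>" 60)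
  | Par "'g diag" "'g diag"  (infixl "\<otimes>" 70)

abbreviation wire :: "'g diag" where "wire \<equiv> Ids 1"
abbreviation crossing :: "'g diag" where "crossing \<equiv> Braid 1 1"

text \<open>The function \<open>ar\<close> gives the numbers of inputs and outputs of each generator.\<close>

primrec src :: "('g \<Rightarrow> nat \<times> nat) \<Rightarrow> 'g diag \<Rightarrow> nat" where
  "src ar (Box g) = fst (ar g)"
| "src ar (Ids n) = n"
| "src ar (Braid m n) = m + n"
| "src ar (a \<Zsemi> b) = src ar a"
| "src ar (a \<otimes> b) = src ar a + src ar b"

primrec tgt :: "('g \<Rightarrow> nat \<times> nat) \<Rightarrow> 'g diag \<Rightarrow> nat" where
  "tgt ar (Box g) = snd (ar g)"
| "tgt ar (Ids n) = n"
| "tgt ar (Braid m n) = n + m"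
| "tgt ar (a \<Zsemi> b) = tgt ar b"
| "tgt ar (a \<otimes> b) = tgt ar a + tgt ar b"

primrec well_formed :: "('g \<Rightarrow> nat \<times> nat) \<Rightarrow> 'g diag \<Rightarrow> bool" where
  "well_formed ar (Box g) \<longleftrightarrow> True"
| "well_formed ar (Ids n) \<longleftrightarrow> True"
| "well_formed ar (Braid m n) \<longleftrightarrow> True"
| "well_formed ar (a \<Zsemi> b) \<longleftrightarrow> well_formed ar a \<and> well_formed ar b \<and> tgt ar a = src ar b"
| "well_formed ar (a \<otimes> b) \<longleftrightarrow> well_formed ar a \<and> well_formed ar b"

definition diags :: "('g \<Rightarrow> nat \<times> nat) \<Rightarrow> nat \<Rightarrow> nat \<Rightarrow> 'g diag set" where
  "diags ar m n = {d. well_formed ar d \<and> src ar d = m \<and> tgt ar d = n}"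

text \<open>
  Equality of open directed graphs modulo the relations \<open>rel\<close>: terms denote the same graph iff
  they are identified by the laws of strict symmetric monoidal categories.  A component connected
  to no input and no output is a diagram \<open>*\<^sup>0 \<rightarrow> *\<^sup>0\<close>; rule \<open>scalar\<close> deletes it.
\<close>

inductive eqv :: "('g \<Rightarrow> nat \<times> nat) \<Rightarrow> ('g diag \<Rightarrow> 'g diag \<Rightarrow> bool) \<Rightarrow> 'g diag \<Rightarrow> 'g diag \<Rightarrow> bool"
  for ar rel where
  base: "rel a b \<Longrightarrow> a \<in> diags ar m n \<Longrightarrow> b \<in> diags ar m n \<Longrightarrow> eqv ar rel a b"
| scalar: "a \<in> diags ar 0 0 \<Longrightarrow> eqv ar rel a (Ids 0)"
| refl: "a \<in> diags ar m n \<Longrightarrow> eqv ar rel a a"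
| symm: "eqv ar rel a b \<Longrightarrow> eqv ar rel b a"
| trans: "eqv ar rel a b \<Longrightarrow> eqv ar rel b c \<Longrightarrow> eqv ar rel a c"
| seq_cong: "eqv ar rel a a' \<Longrightarrow> eqv ar rel b b' \<Longrightarrow> a \<in> diags ar m n \<Longrightarrow> b \<in> diags ar n p \<Longrightarrow>
    eqv ar rel (a \<Zsemi> b) (a' \<Zsemi> b')"
| par_cong: "eqv ar rel a a' \<Longrightarrow> eqv ar rel b b' \<Longrightarrow> eqv ar rel (a \<otimes> b) (a' \<otimes> b')"
| seq_id_left: "a \<in> diags ar m n \<Longrightarrow> eqv ar rel (Ids m \<Zsemi> a) a"
| seq_id_right: "a \<in> diags ar m n \<Longrightarrow> eqv ar rel (a \<Zsemi> Ids n) a"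
| seq_assoc: "a \<in> diags ar m n \<Longrightarrow> b \<in> diags ar n p \<Longrightarrow> c \<in> diags ar p q \<Longrightarrow>
    eqv ar rel ((a \<Zsemi> b) \<Zsemi> c) (a \<Zsemi> (b \<Zsemi> c))"
| par_unit_left: "a \<in> diags ar m n \<Longrightarrow> eqv ar rel (Ids 0 \<otimes> a) a"
| par_unit_right: "a \<in> diags ar m n \<Longrightarrow> eqv ar rel (a \<otimes> Ids 0) a"
| par_assoc: "a \<in> diags ar m n \<Longrightarrow> b \<in> diags ar m' n' \<Longrightarrow> c \<in> diags ar m'' n'' \<Longrightarrow>
    eqv ar rel ((a \<otimes> b) \<otimes> c) (a \<otimes> (b \<otimes> c))"
| par_ids: "eqv ar rel (Ids m \<otimes> Ids n) (Ids (m + n))"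
| interchange: "a \<in> diags ar m n \<Longrightarrow> b \<in> diags ar n p \<Longrightarrow> a' \<in> diags ar m' n' \<Longrightarrow> b' \<in> diags ar n' p' \<Longrightarrow>
    eqv ar rel ((a \<Zsemi> b) \<otimes> (a' \<Zsemi> b')) ((a \<otimes> a') \<Zsemi> (b \<otimes> b'))"
| braid_inverse: "eqv ar rel (Braid m n \<Zsemi> Braid n m) (Ids (m + n))"
| braid_natural: "a \<in> diags ar m n \<Longrightarrow> b \<in> diags ar p q \<Longrightarrow>
    eqv ar rel ((a \<otimes> b) \<Zsemi> Braid n q) (Braid m p \<Zsemi> (b \<otimes> a))"
| braid_unit: "eqv ar rel (Braid m 0) (Ids m)"
| braid_hexagon: "eqv ar rel (Braid m (n + p)) ((Braid m n \<otimes> Ids p) \<Zsemi> (Ids n \<otimes> Braid m p))"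

definition cls :: "('g \<Rightarrow> nat \<times> nat) \<Rightarrow> ('g diag \<Rightarrow> 'g diag \<Rightarrow> bool) \<Rightarrow> 'g diag \<Rightarrow> 'g diag set" where
  "cls ar rel a = {b. eqv ar rel a b}"

text \<open>
  Operations on classes are given by unions over representatives, as is usual for quotients;
  each such union is a single class (proved below for \<open>presented\<close>).
\<close>

definition presented :: "('g \<Rightarrow> nat \<times> nat) \<Rightarrow> ('g diag \<Rightarrow> 'g diag \<Rightarrow> bool) \<Rightarrow> 'g diag set smcat" where
  "presented ar rel =
    \<lparr> mor = (\<lambda>m n. cls ar rel ` diags ar m n),
      idt = (\<lambda>n. cls ar rel (Ids n)),
      sym = (\<lambda>m n. cls ar rel (Braid m n)),
      cmp = (\<lambda>X Y. \<Union>a\<in>X. \<Union>b\<in>Y. cls ar rel (a \<Zsemi> b)),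
      tns = (\<lambda>X Y. \<Union>a\<in>X. \<Union>b\<in>Y. cls ar rel (a \<otimes> b)) \<rparr>"

primrec extend :: "('g \<Rightarrow> 'h diag) \<Rightarrow> 'g diag \<Rightarrow> 'h diag" where
  "extend \<phi> (Box g) = \<phi> g"
| "extend \<phi> (Ids n) = Ids n"
| "extend \<phi> (Braid m n) = Braid m n"
| "extend \<phi> (a \<Zsemi> b) = extend \<phi> a \<Zsemi> extend \<phi> b"
| "extend \<phi> (a \<otimes> b) = extend \<phi> a \<otimes> extend \<phi> b"

text \<open>
  The functor into the category presented by \<open>ar\<close> and \<open>rel\<close> given on generators by \<open>\<phi>\<close>.  The union
  is one class exactly if the translation respects the relations of the source category; that
  it does is part of being an \<open>smc_functor\<close>.
\<close>

definition induced ::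
    "('h \<Rightarrow> nat \<times> nat) \<Rightarrow> ('h diag \<Rightarrow> 'h diag \<Rightarrow> bool) \<Rightarrow> ('g \<Rightarrow> 'h diag) \<Rightarrow> 'g diag set \<Rightarrow> 'h diag set" where
  "induced ar rel \<phi> X = (\<Union>a\<in>X. cls ar rel (extend \<phi> a))"

lemma eqv_diags: "eqv ar rel a b \<Longrightarrow> \<exists>m n. a \<in> diags ar m n \<and> b \<in> diags ar m n"
  by (induction rule: eqv.induct) (auto simp: diags_def)

lemma eqv_diags_iff: "eqv ar rel a b \<Longrightarrow> a \<in> diags ar m n \<longleftrightarrow> b \<in> diags ar m n"
  by (drule eqv_diags) (auto simp: diags_def)

lemma cls_eqI: "eqv ar rel a b \<Longrightarrow> cls ar rel a = cls ar rel b"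
  unfolding cls_def by (blast intro: eqv.symm eqv.trans)

lemma UN2_const:
  "x \<in> A \<Longrightarrow> y \<in> B \<Longrightarrow> (\<And>a b. a \<in> A \<Longrightarrow> b \<in> B \<Longrightarrow> F a b = Z) \<Longrightarrow> (\<Union>a\<in>A. \<Union>b\<in>B. F a b) = Z"
  by blast

lemma cmp_cls:
  assumes a: "a \<in> diags ar m n" and b: "b \<in> diags ar n p"
  shows "cmp (presented ar rel) (cls ar rel a) (cls ar rel b) = cls ar rel (a \<Zsemi> b)"
proof -
  have "(\<Union>a'\<in>cls ar rel a. \<Union>b'\<in>cls ar rel b. cls ar rel (a' \<Zsemi> b')) = cls ar rel (a \<Zsemi> b)"
  proof (rule UN2_const)
    show "a \<in> cls ar rel a" "b \<in> cls ar rel b"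
      using a b by (auto simp: cls_def intro: eqv.refl)
    fix a' b' assume "a' \<in> cls ar rel a" "b' \<in> cls ar rel b"
    then have "eqv ar rel a a'" "eqv ar rel b b'" by (simp_all add: cls_def)
    from eqv.seq_cong[OF this a b] show "cls ar rel (a' \<Zsemi> b') = cls ar rel (a \<Zsemi> b)"
      by (rule cls_eqI[symmetric])
  qed
  then show ?thesis by (simp add: presented_def)
qed

lemma tns_cls:
  assumes a: "a \<in> diags ar m n" and b: "b \<in> diags ar p q"
  shows "tns (presented ar rel) (cls ar rel a) (cls ar rel b) = cls ar rel (a \<otimes> b)"
proof -
  have "(\<Union>a'\<in>cls ar rel a. \<Union>b'\<in>cls ar rel b. cls ar rel (a' \<otimes> b')) = cls ar rel (a \<otimes> b)"
  proof (rule UN2_const)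
    show "a \<in> cls ar rel a" "b \<in> cls ar rel b"
      using a b by (auto simp: cls_def intro: eqv.refl)
    fix a' b' assume "a' \<in> cls ar rel a" "b' \<in> cls ar rel b"
    then have "eqv ar rel a a'" "eqv ar rel b b'" by (simp_all add: cls_def)
    from eqv.par_cong[OF this] show "cls ar rel (a' \<otimes> b') = cls ar rel (a \<otimes> b)"
      by (rule cls_eqI[symmetric])
  qed
  then show ?thesis by (simp add: presented_def)
qed

lemma diags_intros:
  "Ids n \<in> diags ar n n"
  "Braid m n \<in> diags ar (m + n) (n + m)"
  "a \<in> diags ar m n \<Longrightarrow> b \<in> diags ar n p \<Longrightarrow> a \<Zsemi> b \<in> diags ar m p"
  "a \<in> diags ar m n \<Longrightarrow> b \<in> diags ar p q \<Longrightarrow> a \<otimes> b \<in> diags ar (m + p) (n + q)"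
  by (auto simp: diags_def)

lemma presented_simps:
  "mor (presented ar rel) m n = cls ar rel ` diags ar m n"
  "idt (presented ar rel) n = cls ar rel (Ids n)"
  "sym (presented ar rel) m n = cls ar rel (Braid m n)"
  by (simp_all add: presented_def)

theorem presented_strict_smc: "strict_smc (presented ar rel)"
proof -
  let ?C = "presented ar rel" and ?c = "cls ar rel"
  note D = diags_intros[where ar = ar]
  note cc = cmp_cls[where rel = rel and ar = ar] and tc = tns_cls[where rel = rel and ar = ar]
  show ?thesis
  proof (unfold_locales, unfold presented_simps)
    fix n show "?c (Ids n) \<in> ?c ` diags ar n n" by (intro imageI D)
  next
    fix m n show "?c (Braid m n) \<in> ?c ` diags ar (m + n) (n + m)" by (intro imageI D)
  next
    fix f g m n p assume "f \<in> ?c ` diags ar m n" "g \<in> ?c ` diags ar n p"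
    then obtain a b where ab: "a \<in> diags ar m n" "b \<in> diags ar n p" "f = ?c a" "g = ?c b" by blast
    show "cmp ?C f g \<in> ?c ` diags ar m p"
      unfolding ab(3,4) cc[OF ab(1,2)] by (intro imageI D(3)[OF ab(1,2)])
  next
    fix f g m n p q assume "f \<in> ?c ` diags ar m n" "g \<in> ?c ` diags ar p q"
    then obtain a b where ab: "a \<in> diags ar m n" "b \<in> diags ar p q" "f = ?c a" "g = ?c b" by blast
    show "tns ?C f g \<in> ?c ` diags ar (m + p) (n + q)"
      unfolding ab(3,4) tc[OF ab(1,2)] by (intro imageI D(4)[OF ab(1,2)])
  next
    fix f m n p q assume "f \<in> ?c ` diags ar m n" "f \<in> ?c ` diags ar p q"
    then obtain a b where ab: "a \<in> diags ar m n" "b \<in> diags ar p q" "?c a = ?c b" by auto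
    have "eqv ar rel b b" using ab(2) by (rule eqv.refl)
    then have "eqv ar rel a b" using ab(3) unfolding cls_def by blast
    then have "b \<in> diags ar m n" using ab(1) eqv_diags_iff by blast
    with ab(2) show "m = p \<and> n = q" by (simp add: diags_def)
  next
    fix f m n assume "f \<in> ?c ` diags ar m n"
    then obtain a where a: "a \<in> diags ar m n" "f = ?c a" by blast
    show "cmp ?C (?c (Ids m)) f = f"
      unfolding a(2) cc[OF D(1) a(1)] by (rule cls_eqI[OF eqv.seq_id_left[OF a(1)]])
    show "cmp ?C f (?c (Ids n)) = f"
      unfolding a(2) cc[OF a(1) D(1)] by (rule cls_eqI[OF eqv.seq_id_right[OF a(1)]])
    show "tns ?C (?c (Ids 0)) f = f"
      unfolding a(2) tc[OF D(1) a(1)] by (rule cls_eqI[OF eqv.par_unit_left[OF a(1)]])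
    show "tns ?C f (?c (Ids 0)) = f"
      unfolding a(2) tc[OF a(1) D(1)] by (rule cls_eqI[OF eqv.par_unit_right[OF a(1)]])
  next
    fix f g h m n p q
    assume "f \<in> ?c ` diags ar m n" "g \<in> ?c ` diags ar n p" "h \<in> ?c ` diags ar p q"
    then obtain a b c where h: "a \<in> diags ar m n" "b \<in> diags ar n p" "c \<in> diags ar p q"
      "f = ?c a" "g = ?c b" "h = ?c c" by blast
    show "cmp ?C (cmp ?C f g) h = cmp ?C f (cmp ?C g h)"
      unfolding h(4-6) cc[OF h(1,2)] cc[OF h(2,3)] cc[OF D(3)[OF h(1,2)] h(3)] cc[OF h(1) D(3)[OF h(2,3)]]
      by (rule cls_eqI[OF eqv.seq_assoc[OF h(1-3)]])
  next
    fix f g h m n m' n' m'' n''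
    assume "f \<in> ?c ` diags ar m n" "g \<in> ?c ` diags ar m' n'" "h \<in> ?c ` diags ar m'' n''"
    then obtain a b c where h: "a \<in> diags ar m n" "b \<in> diags ar m' n'" "c \<in> diags ar m'' n''"
      "f = ?c a" "g = ?c b" "h = ?c c" by blast
    show "tns ?C (tns ?C f g) h = tns ?C f (tns ?C g h)"
      unfolding h(4-6) tc[OF h(1,2)] tc[OF h(2,3)] tc[OF D(4)[OF h(1,2)] h(3)] tc[OF h(1) D(4)[OF h(2,3)]]
      by (rule cls_eqI[OF eqv.par_assoc[OF h(1-3)]])
  next
    fix m n show "tns ?C (?c (Ids m)) (?c (Ids n)) = ?c (Ids (m + n))"
      unfolding tc[OF D(1) D(1)] by (rule cls_eqI[OF eqv.par_ids])
  next
    fix f g f' g' m n p m' n' p'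
    assume "f \<in> ?c ` diags ar m n" "g \<in> ?c ` diags ar n p" "f' \<in> ?c ` diags ar m' n'" "g' \<in> ?c ` diags ar n' p'"
    then obtain a b a' b' where h: "a \<in> diags ar m n" "b \<in> diags ar n p" "a' \<in> diags ar m' n'" "b' \<in> diags ar n' p'"
      and e: "f = ?c a" "g = ?c b" "f' = ?c a'" "g' = ?c b'" by blast
    show "tns ?C (cmp ?C f g) (cmp ?C f' g') = cmp ?C (tns ?C f f') (tns ?C g g')"
      unfolding e cc[OF h(1,2)] cc[OF h(3,4)] tc[OF h(1,3)] tc[OF h(2,4)]
        tc[OF D(3)[OF h(1,2)] D(3)[OF h(3,4)]] cc[OF D(4)[OF h(1,3)] D(4)[OF h(2,4)]]
      by (rule cls_eqI[OF eqv.interchange[OF h]])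
  next
    fix m n show "cmp ?C (?c (Braid m n)) (?c (Braid n m)) = ?c (Ids (m + n))"
      unfolding cc[OF D(2) D(2)] by (rule cls_eqI[OF eqv.braid_inverse])
  next
    fix f g m n p q assume "f \<in> ?c ` diags ar m n" "g \<in> ?c ` diags ar p q"
    then obtain a b where h: "a \<in> diags ar m n" "b \<in> diags ar p q" and e: "f = ?c a" "g = ?c b" by blast
    show "cmp ?C (tns ?C f g) (?c (Braid n q)) = cmp ?C (?c (Braid m p)) (tns ?C g f)"
      unfolding e tc[OF h] tc[OF h(2,1)] cc[OF D(4)[OF h] D(2)] cc[OF D(2) D(4)[OF h(2,1)]]
      by (rule cls_eqI[OF eqv.braid_natural[OF h]])
  next
    fix m show "?c (Braid m 0) = ?c (Ids m)" by (rule cls_eqI[OF eqv.braid_unit])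
  next
    fix m n p
    have 1: "Braid m n \<otimes> Ids p \<in> diags ar (m + n + p) (n + (m + p))"
      and 2: "Ids n \<otimes> Braid m p \<in> diags ar (n + (m + p)) (n + (p + m))"
      by (simp_all add: diags_def)
    show "?c (Braid m (n + p)) =
      cmp ?C (tns ?C (?c (Braid m n)) (?c (Ids p))) (tns ?C (?c (Ids n)) (?c (Braid m p)))"
      unfolding tc[OF D(2) D(1)] tc[OF D(1) D(2)] cc[OF 1 2] by (rule cls_eqI[OF eqv.braid_hexagon])
  qed
qed


section \<open>Spiders\<close>

text \<open>Phases form the type \<open>4\<close>, the ring of integers modulo 4.\<close>

type_synonym phase = 4

datatype 'c node = Unit 'c | Counit 'c | Mult 'c | Comult 'c | Phase 'c phase

primrec node_ar :: "'c node \<Rightarrow> nat \<times> nat" where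
  "node_ar (Unit x) = (0, 1)"
| "node_ar (Counit x) = (1, 0)"
| "node_ar (Mult x) = (2, 1)"
| "node_ar (Comult x) = (1, 2)"
| "node_ar (Phase x \<theta>) = (1, 1)"

primrec node_dag :: "'c node \<Rightarrow> 'c node" where
  "node_dag (Unit x) = Counit x"
| "node_dag (Counit x) = Unit x"
| "node_dag (Mult x) = Comult x"
| "node_dag (Comult x) = Mult x"
| "node_dag (Phase x \<theta>) = Phase x (- \<theta>)"

primrec dag :: "('g \<Rightarrow> 'g) \<Rightarrow> 'g diag \<Rightarrow> 'g diag" where
  "dag \<delta> (Box g) = Box (\<delta> g)"
| "dag \<delta> (Ids n) = Ids n"
| "dag \<delta> (Braid m n) = Braid n m"
| "dag \<delta> (a \<Zsemi> b) = dag \<delta> b \<Zsemi> dag \<delta> a"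
| "dag \<delta> (a \<otimes> b) = dag \<delta> a \<otimes> dag \<delta> b"

primrec tensor_power :: "'g diag \<Rightarrow> nat \<Rightarrow> 'g diag" where
  "tensor_power a 0 = Ids 0"
| "tensor_power a (Suc n) = tensor_power a n \<otimes> a"

text \<open>The argument \<open>\<iota>\<close> embeds the nodes into the generators of the category at hand.\<close>

fun merge :: "('c node \<Rightarrow> 'g) \<Rightarrow> 'c \<Rightarrow> nat \<Rightarrow> 'g diag" where
  "merge \<iota> x 0 = Box (\<iota> (Unit x))"
| "merge \<iota> x (Suc 0) = wire"
| "merge \<iota> x (Suc (Suc m)) = (merge \<iota> x (Suc m) \<otimes> wire) \<Zsemi> Box (\<iota> (Mult x))"

fun split :: "('c node \<Rightarrow> 'g) \<Rightarrow> 'c \<Rightarrow> nat \<Rightarrow> 'g diag" where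
  "split \<iota> x 0 = Box (\<iota> (Counit x))"
| "split \<iota> x (Suc 0) = wire"
| "split \<iota> x (Suc (Suc n)) = Box (\<iota> (Comult x)) \<Zsemi> (split \<iota> x (Suc n) \<otimes> wire)"

definition spider :: "('c node \<Rightarrow> 'g) \<Rightarrow> 'c \<Rightarrow> nat \<Rightarrow> nat \<Rightarrow> phase \<Rightarrow> 'g diag" where
  "spider \<iota> x m n \<theta> = merge \<iota> x m \<Zsemi> Box (\<iota> (Phase x \<theta>)) \<Zsemi> split \<iota> x n"

text \<open>
  The rules \<open>mult_legs\<close> and \<open>comult_legs\<close> express that the legs of a node may be permuted freely,
  which does not follow from the laws of symmetric monoidal categories.
\<close>

inductive spider_rule :: "('c node \<Rightarrow> 'g) \<Rightarrow> 'c \<Rightarrow> 'g diag \<Rightarrow> 'g diag \<Rightarrow> bool" for \<iota> x where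
  mult_legs: "spider_rule \<iota> x (crossing \<Zsemi> Box (\<iota> (Mult x))) (Box (\<iota> (Mult x)))"
| comult_legs: "spider_rule \<iota> x (Box (\<iota> (Comult x)) \<Zsemi> crossing) (Box (\<iota> (Comult x)))"
| no_phase: "spider_rule \<iota> x (spider \<iota> x m n 0) (merge \<iota> x m \<Zsemi> split \<iota> x n)"
| identity: "spider_rule \<iota> x (Box (\<iota> (Phase x 0))) wire"
| fusion: "k \<ge> 1 \<Longrightarrow> spider_rule \<iota> x
    ((spider \<iota> x m (n + k) \<alpha> \<otimes> Ids m') \<Zsemi> (Ids n \<otimes> spider \<iota> x (k + m') n' \<beta>))
    (spider \<iota> x (m + m') (n + n') (\<alpha> + \<beta>))"


lemma node_ar_dag: "node_ar (node_dag v) = prod.swap (node_ar v)"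
  by (cases v) simp_all

lemma node_ar_map: "node_ar (map_node f v) = node_ar v"
  by (cases v) simp_all

lemma merge_diags:
  assumes "\<And>v. ar (\<iota> v) = node_ar v"
  shows "merge \<iota> x m \<in> diags ar m 1"
  using assms by (induction \<iota> x m rule: merge.induct) (auto simp: diags_def)

lemma split_diags:
  assumes "\<And>v. ar (\<iota> v) = node_ar v"
  shows "split \<iota> x n \<in> diags ar 1 n"
  using assms by (induction \<iota> x n rule: split.induct) (auto simp: diags_def)

lemma spider_diags:
  assumes "\<And>v. ar (\<iota> v) = node_ar v"
  shows "spider \<iota> x m n \<theta> \<in> diags ar m n"
  using merge_diags[of ar \<iota> x m, OF assms] split_diags[of ar \<iota> x n, OF assms] assms
  by (auto simp: diags_def spider_def)

lemma spider_rule_diags: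
  assumes "\<And>v. ar (\<iota> v) = node_ar v" and "spider_rule \<iota> x a b"
  shows "\<exists>m n. a \<in> diags ar m n \<and> b \<in> diags ar m n"
  using assms(2)
proof cases
  case (no_phase m n)
  show ?thesis unfolding no_phase
    using spider_diags[of ar \<iota> x m n 0, OF assms(1)] merge_diags[of ar \<iota> x m, OF assms(1)]
      split_diags[of ar \<iota> x n, OF assms(1)] by (auto simp: diags_def)
next
  case (fusion k m n \<alpha> m' n' \<beta>)
  show ?thesis unfolding fusion
    using spider_diags[of ar \<iota> x, OF assms(1)] by (auto simp: diags_def)
qed (auto simp: diags_def assms(1))

lemma tensor_power_diags:
  "a \<in> diags ar p q \<Longrightarrow> tensor_power a n \<in> diags ar (n * p) (n * q)"
  by (induction n) (auto simp: diags_def)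

lemma dag_diags:
  assumes "\<And>g. ar (\<delta> g) = prod.swap (ar g)"
  shows "a \<in> diags ar m n \<Longrightarrow> dag \<delta> a \<in> diags ar n m"
  by (induction a arbitrary: m n) (use assms in \<open>auto simp: diags_def\<close>)

lemma map_diags:
  assumes "\<And>g. ar (\<rho> g) = ar g"
  shows "a \<in> diags ar m n \<Longrightarrow> map_diag \<rho> a \<in> diags ar m n"
  by (induction a arbitrary: m n) (use assms in \<open>auto simp: diags_def\<close>)


section \<open>The dichromatic category\<close>

datatype rg_colour = Green | Red

datatype rg_gen = Node "rg_colour node" | Had

primrec rg_ar :: "rg_gen \<Rightarrow> nat \<times> nat" where
  "rg_ar (Node v) = node_ar v"
| "rg_ar Had = (1, 1)"

primrec rg_dag :: "rg_gen \<Rightarrow> rg_gen" where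
  "rg_dag (Node v) = Node (node_dag v)"
| "rg_dag Had = Had"

primrec swap_colour :: "rg_colour \<Rightarrow> rg_colour" where
  "swap_colour Green = Red"
| "swap_colour Red = Green"

primrec rg_swap :: "rg_gen \<Rightarrow> rg_gen" where
  "rg_swap (Node v) = Node (map_node swap_colour v)"
| "rg_swap Had = Had"

abbreviation gr :: "nat \<Rightarrow> nat \<Rightarrow> phase \<Rightarrow> rg_gen diag" where "gr \<equiv> spider Node Green"
abbreviation rd :: "nat \<Rightarrow> nat \<Rightarrow> phase \<Rightarrow> rg_gen diag" where "rd \<equiv> spider Node Red"
abbreviation had :: "rg_gen diag" where "had \<equiv> Box Had"

inductive rg_rel :: "rg_gen diag \<Rightarrow> rg_gen diag \<Rightarrow> bool" where
  spiders: "spider_rule Node Green a b \<Longrightarrow> rg_rel a b"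
| bialgebra: "rg_rel ((gr 1 2 0 \<otimes> gr 1 2 0) \<Zsemi> (wire \<otimes> crossing \<otimes> wire) \<Zsemi> (rd 2 1 0 \<otimes> rd 2 1 0))
    (rd 2 1 0 \<Zsemi> gr 1 2 0)"
| copy: "rg_rel (rd 0 1 0 \<Zsemi> gr 1 2 0) (rd 0 1 0 \<otimes> rd 0 1 0)"
| cup: "rg_rel (gr 0 2 0) (rd 0 2 0)"
| pi_copy: "rg_rel (rd 1 1 2 \<Zsemi> gr 1 2 0) (gr 1 2 0 \<Zsemi> (rd 1 1 2 \<otimes> rd 1 1 2))"
| pi_commute: "rg_rel (gr 1 1 2 \<Zsemi> rd 1 1 \<theta>) (rd 1 1 (- \<theta>) \<Zsemi> gr 1 1 2)"
| had_involution: "rg_rel (had \<Zsemi> had) wire"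
| colour_change: "rg_rel (gr m n \<theta>) (tensor_power had m \<Zsemi> rd m n \<theta> \<Zsemi> tensor_power had n)"
| dagger: "rg_rel a b \<Longrightarrow> rg_rel (dag rg_dag a) (dag rg_dag b)"
| swap: "rg_rel a b \<Longrightarrow> rg_rel (map_diag rg_swap a) (map_diag rg_swap b)"

lemma rg_rel_diags: "rg_rel a b \<Longrightarrow> \<exists>m n. a \<in> diags rg_ar m n \<and> b \<in> diags rg_ar m n"
proof (induction rule: rg_rel.induct)
  case (spiders a b) then show ?case by (rule spider_rule_diags[rotated]) simp
next
  case (colour_change m n \<theta>)
  show ?case
    using spider_diags[of rg_ar Node] tensor_power_diags[of had rg_ar 1 1] by (auto simp: diags_def)
next
  case (dagger a b)
  have "rg_ar (rg_dag g) = prod.swap (rg_ar g)" for g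
    by (cases g) (simp_all add: node_ar_dag)
  with dagger show ?case by (meson dag_diags)
next
  case (swap a b)
  have "rg_ar (rg_swap g) = rg_ar g" for g
    by (cases g) (simp_all add: node_ar_map)
  with swap show ?case by (meson map_diags)
qed (use spider_diags[of rg_ar Node] in \<open>auto simp: diags_def\<close>)

inductive rg_plus_rel :: "rg_gen diag \<Rightarrow> rg_gen diag \<Rightarrow> bool" where
  rg: "rg_rel a b \<Longrightarrow> rg_plus_rel a b"
| euler: "rg_plus_rel had (gr 1 1 1 \<Zsemi> rd 1 1 1 \<Zsemi> gr 1 1 1)"

definition RG :: "rg_gen diag set smcat" where "RG = presented rg_ar rg_rel"
definition RG_plus :: "rg_gen diag set smcat" where "RG_plus = presented rg_ar rg_plus_rel"

definition Quot :: "rg_gen diag set \<Rightarrow> rg_gen diag set" where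
  "Quot = induced rg_ar rg_plus_rel Box"


section \<open>The trichromatic category\<close>

datatype rgb_colour = R | G | B

type_synonym rgb_gen = "rgb_colour node"

primrec rotate_colour :: "rgb_colour \<Rightarrow> rgb_colour" where
  "rotate_colour R = G"
| "rotate_colour G = B"
| "rotate_colour B = R"

abbreviation tri :: "rgb_colour \<Rightarrow> nat \<Rightarrow> nat \<Rightarrow> phase \<Rightarrow> rgb_gen diag" where "tri \<equiv> spider (\<lambda>v. v)"

definition cyc :: "rgb_gen diag" where "cyc = tri G 1 1 1 \<Zsemi> tri B 1 1 1"
definition cyc_bar :: "rgb_gen diag" where "cyc_bar = cyc \<Zsemi> cyc"

inductive rgb_rel :: "rgb_gen diag \<Rightarrow> rgb_gen diag \<Rightarrow> bool" where
  spiders: "spider_rule (\<lambda>v. v) G a b \<Longrightarrow> rgb_rel a b"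
| copy: "rgb_rel (tri B 0 1 0 \<Zsemi> tri G 1 2 0) (tri B 0 1 0 \<otimes> tri B 0 1 0)"
| cocopy: "rgb_rel (tri R 2 1 3 \<Zsemi> tri G 1 0 0) (tri G 1 0 0 \<otimes> tri G 1 0 0)"
| bialgebra: "rgb_rel
    ((tri G 1 2 0 \<otimes> tri G 1 2 0) \<Zsemi> (wire \<otimes> crossing \<otimes> wire) \<Zsemi> (tri R 2 1 3 \<otimes> tri R 2 1 3))
    (tri R 2 1 3 \<Zsemi> tri G 1 2 0)"
| phase_unit: "rgb_rel ((wire \<otimes> tri R 0 1 0) \<Zsemi> tri G 2 1 0) (tri G 1 1 1)"
| cyc_RG: "rgb_rel cyc (tri R 1 1 1 \<Zsemi> tri G 1 1 1)"
| cyc_BR: "rgb_rel cyc (tri B 1 1 1 \<Zsemi> tri R 1 1 1)"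
| change_B: "rgb_rel (tensor_power cyc_bar m \<Zsemi> tri B m n \<theta> \<Zsemi> tensor_power cyc n) (tri G m n \<theta>)"
| change_R: "rgb_rel (tri G m n \<theta>) (tensor_power cyc m \<Zsemi> tri R m n \<theta> \<Zsemi> tensor_power cyc_bar n)"
| bend_GR: "rgb_rel ((wire \<otimes> tri G 0 2 0) \<Zsemi> (tri R 2 0 0 \<otimes> wire)) (tri R 1 1 2)"
| bend_RG: "rgb_rel ((wire \<otimes> tri R 0 2 0) \<Zsemi> (tri G 2 0 0 \<otimes> wire)) (tri R 1 1 2)"
| bend_BG: "rgb_rel ((wire \<otimes> tri B 0 2 0) \<Zsemi> (tri G 2 0 0 \<otimes> wire)) (tri G 1 1 2)"
| bend_GB: "rgb_rel ((wire \<otimes> tri G 0 2 0) \<Zsemi> (tri B 2 0 0 \<otimes> wire)) (tri G 1 1 2)"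
| bend_RB: "rgb_rel ((wire \<otimes> tri R 0 2 0) \<Zsemi> (tri B 2 0 0 \<otimes> wire)) (tri B 1 1 2)"
| bend_BR: "rgb_rel ((wire \<otimes> tri B 0 2 0) \<Zsemi> (tri R 2 0 0 \<otimes> wire)) (tri B 1 1 2)"
| dagger: "rgb_rel a b \<Longrightarrow> rgb_rel (dag node_dag a) (dag node_dag b)"
| rotate: "rgb_rel a b \<Longrightarrow>
    rgb_rel (map_diag (map_node rotate_colour) a) (map_diag (map_node rotate_colour) b)"

lemma tri_diags: "tri x m n \<theta> \<in> diags node_ar m n"
  by (rule spider_diags) simp

lemma cyc_diags: "cyc \<in> diags node_ar 1 1" "cyc_bar \<in> diags node_ar 1 1"
  using tri_diags by (auto simp: diags_def cyc_def cyc_bar_def)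

lemma rgb_rel_diags: "rgb_rel a b \<Longrightarrow> \<exists>m n. a \<in> diags node_ar m n \<and> b \<in> diags node_ar m n"
proof (induction rule: rgb_rel.induct)
  case (spiders a b) then show ?case by (rule spider_rule_diags[rotated]) simp
next
  case (change_B m n \<theta>)
  show ?case
    using tri_diags tensor_power_diags[OF cyc_diags(1), of m]
      tensor_power_diags[OF cyc_diags(1), of n] tensor_power_diags[OF cyc_diags(2), of m]
      tensor_power_diags[OF cyc_diags(2), of n] by (auto simp: diags_def)
next
  case (change_R m n \<theta>)
  show ?case
    using tri_diags tensor_power_diags[OF cyc_diags(1), of m]
      tensor_power_diags[OF cyc_diags(1), of n] tensor_power_diags[OF cyc_diags(2), of m]
      tensor_power_diags[OF cyc_diags(2), of n] by (auto simp: diags_def)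
next
  case (dagger a b)
  from dagger show ?case by (meson dag_diags node_ar_dag)
next
  case (rotate a b)
  from rotate show ?case by (meson map_diags node_ar_map)
qed (use tri_diags in \<open>auto simp: diags_def cyc_def\<close>)

definition RGB :: "rgb_gen diag set smcat" where "RGB = presented node_ar rgb_rel"


section \<open>The translations\<close>

fun T_gen :: "rg_gen \<Rightarrow> rgb_gen diag" where
  "T_gen (Node (Counit Green)) = tri G 1 0 0"
| "T_gen (Node (Unit Green)) = tri G 0 1 0"
| "T_gen (Node (Phase Green \<theta>)) = tri G 1 1 \<theta>"
| "T_gen (Node (Comult Green)) = tri G 1 2 0"
| "T_gen (Node (Mult Green)) = tri G 2 1 0"
| "T_gen (Node (Counit Red)) = tri R 1 0 3"
| "T_gen (Node (Unit Red)) = tri R 0 1 1"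
| "T_gen (Node (Phase Red \<theta>)) = tri R 1 1 \<theta>"
| "T_gen (Node (Comult Red)) = tri R 1 2 1"
| "T_gen (Node (Mult Red)) = tri R 2 1 3"
| "T_gen Had = tri G 1 1 1 \<Zsemi> tri R 1 1 1 \<Zsemi> tri G 1 1 1"

fun S_gen :: "rgb_gen \<Rightarrow> rg_gen diag" where
  "S_gen (Counit G) = gr 1 0 0"
| "S_gen (Unit G) = gr 0 1 0"
| "S_gen (Phase G \<theta>) = gr 1 1 \<theta>"
| "S_gen (Comult G) = gr 1 2 0"
| "S_gen (Mult G) = gr 2 1 0"
| "S_gen (Counit R) = rd 1 0 1"
| "S_gen (Unit R) = rd 0 1 3"
| "S_gen (Phase R \<theta>) = rd 1 1 \<theta>"
| "S_gen (Comult R) = rd 1 2 3"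
| "S_gen (Mult R) = rd 2 1 1"
| "S_gen (Counit B) = rd 1 0 0"
| "S_gen (Unit B) = rd 0 1 0"
| "S_gen (Phase B \<theta>) = gr 1 1 3 \<Zsemi> rd 1 1 \<theta> \<Zsemi> gr 1 1 1"
| "S_gen (Comult B) = gr 1 1 3 \<Zsemi> rd 1 2 0 \<Zsemi> (gr 1 1 1 \<otimes> gr 1 1 1)"
| "S_gen (Mult B) = (gr 1 1 3 \<otimes> gr 1 1 3) \<Zsemi> rd 2 1 0 \<Zsemi> gr 1 1 1"

text \<open>
  \<open>T\<close> acts on the classes of \<open>RG\<close> and \<open>T_hat\<close> on the coarser classes of \<open>RG_plus\<close>; both are
  given on generators by \<open>T_gen\<close>, so the defining formula is the same.
\<close>

definition T :: "rg_gen diag set \<Rightarrow> rgb_gen diag set" where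
  "T = induced node_ar rgb_rel T_gen"

definition T_hat :: "rg_gen diag set \<Rightarrow> rgb_gen diag set" where
  "T_hat = induced node_ar rgb_rel T_gen"

definition S :: "rgb_gen diag set \<Rightarrow> rg_gen diag set" where
  "S = induced rg_ar rg_plus_rel S_gen"

end

theory Submission
  imports Defs
begin

text \<open>
  \<open>RG\<^sup>+\<close> and \<open>RGB\<close> describe one calculus in two coordinate systems.  In both, a single spider colour
  generates everything up to conjugation: if every input leg of a red node receives a fixed
  invertible gate \<open>u\<close> and every output leg a gate \<open>w\<close> inverse to \<open>u\<close>, the result is again a spider
  family, and all the other colours arise this way.  The dichromatic green is red conjugated by
  \<open>H\<close>; the trichromatic colours are conjugates of one another by the gate \<open>c\<close> of order three; and
  the trichromatic red is the dichromatic red conjugated by a red phase, which is the reason for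
  the shifted phases in both translations.  On generators the translations therefore only exchange
  names of conjugates, and the two composites are the identity because the conjugating gates
  cancel (\<open>S_T_gen\<close>, \<open>T_S_gen\<close>).

  The work is in showing that the translations respect the relations (\<open>S_respects\<close>, \<open>T_respects\<close>).
  The relations are closed under \<open>\<dagger>\<close> and under a permutation of colours.  Both translations commute
  with \<open>\<dagger>\<close> on generators, and the permutation of colours becomes conjugation by a gate, by the
  image of \<open>c\<close> for \<open>S\<close> and by \<open>H\<close> for \<open>T\<close> (\<open>S_rotate\<close>, \<open>T_swap\<close>, both instances of
  \<open>extend_conjugate\<close>).  Hence it suffices to check each listed relation once.

  For \<open>S\<close> this needs the two Euler decompositions of \<open>H\<close>, the fact that a red state copied by green
  absorbs green phases because scalars are deleted, and the bending of wires by cups.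

  For \<open>T\<close> the substantial points are the two laws about the phase 2.  The phase gates of \<open>RGB\<close>
  satisfy \<open>grg = rgr\<close>, \<open>r\<^sup>4 = 1\<close> and \<open>(rg)\<^sup>3 = 1\<close>; these present the symmetric group on four letters,
  in which \<open>g\<^sup>2\<close> inverts \<open>r\<close> (\<open>G2_R\<close>).  The copying of the red phase 2 by green is not visible in
  this group.  It comes from the bialgebra law in two steps: the law and the cups give the Hopf law
  (\<open>hopf\<close>), and then a red state of phase 2, written as a red product of two green states of phase 1,
  is pushed through green; this yields two red nodes joined by two green phase gates of value 1.
  By the Euler decomposition such a gate is \<open>H\<close> up to red phases, so the Hopf law disconnects the
  two nodes (\<open>G_phases_disconnect\<close>, \<open>copy_R_unit_3\<close>, \<open>pi_copy_R\<close>).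

  All diagrammatic arguments are carried out on words of layers: a layer is one diagram with
  identity wires to its left and right, composition of classes is associative without side
  conditions, and the laws of symmetric monoidal categories become rewrite rules between words.
\<close>

section \<open>Words of layers in a presented category\<close>

text \<open>
  Positions in a word are numerals, and \<open>1\<close> is kept as a numeral so that results of arithmetic on
  positions match syntactically.
\<close>

declare One_nat_def [simp del] One_nat_def [symmetric, simp]
  add_2_eq_Suc [simp del] add_2_eq_Suc' [simp del]

declare eqv.trans [trans]

lemma UN_const: "x \<in> A \<Longrightarrow> (\<And>a. a \<in> A \<Longrightarrow> F a = Z) \<Longrightarrow> (\<Union>a\<in>A. F a) = Z"
  by blast

locale presentation =
  fixes ar :: "'g \<Rightarrow> nat \<times> nat" and rel :: "'g diag \<Rightarrow> 'g diag \<Rightarrow> bool"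
begin

abbreviation equiv (infix "\<approx>" 50) where "a \<approx> b \<equiv> eqv ar rel a b"

abbreviation class_comp (infixr "\<odot>" 60) where
  "X \<odot> Y \<equiv> cmp (presented ar rel) X Y"

definition layer :: "nat \<Rightarrow> 'g diag \<Rightarrow> nat \<Rightarrow> 'g diag set" where
  "layer k d q = cls ar rel (Ids k \<otimes> d \<otimes> Ids q)"

abbreviation idc :: "nat \<Rightarrow> 'g diag set" where "idc n \<equiv> cls ar rel (Ids n)"

lemma diags_src_tgt: "well_formed ar a \<Longrightarrow> a \<in> diags ar (src ar a) (tgt ar a)"
  by (simp add: diags_def)

lemma equiv_refl: "well_formed ar a \<Longrightarrow> a \<approx> a"
  by (rule eqv.refl[OF diags_src_tgt])

lemma equiv_typed:
  "a \<approx> b \<Longrightarrow> well_formed ar a \<and> well_formed ar b \<and> src ar a = src ar b \<and> tgt ar a = tgt ar b"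
  by (drule eqv_diags) (auto simp: diags_def)

text \<open>
  Equivalent diagrams are well formed, so an ill-formed diagram has the empty class.  This makes
  the laws below hold without typing assumptions wherever both sides are ill-formed together.
\<close>

lemma cls_ill_formed: "\<not> well_formed ar a \<Longrightarrow> cls ar rel a = {}"
  using equiv_typed by (auto simp: cls_def)

lemma cls_eq_iff: "well_formed ar a \<Longrightarrow> cls ar rel a = cls ar rel b \<longleftrightarrow> a \<approx> b"
  by (metis CollectD CollectI cls_def cls_eqI equiv_refl eqv.symm)

lemma cls_Seq_cong1: "d \<approx> d' \<Longrightarrow> cls ar rel (d \<Zsemi> c) = cls ar rel (d' \<Zsemi> c)"
proof (cases "well_formed ar (d \<Zsemi> c)")
  case True
  assume e: "d \<approx> d'"
  show ?thesis
    by (rule cls_eqI[OF eqv.seq_cong[OF e equiv_refl diags_src_tgt]])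
      (use True in \<open>auto simp: diags_def\<close>)
next
  case False
  assume "d \<approx> d'"
  with False show ?thesis by (auto dest!: equiv_typed simp: cls_ill_formed)
qed

lemma cls_comp: "cls ar rel d \<odot> Z = (\<Union>c\<in>Z. cls ar rel (d \<Zsemi> c))"
proof (cases "well_formed ar d")
  case True
  have "d' \<in> cls ar rel d \<Longrightarrow> cls ar rel (d' \<Zsemi> c) = cls ar rel (d \<Zsemi> c)" for d' c
    using cls_Seq_cong1[of d d' c] by (simp add: cls_def)
  moreover have "d \<in> cls ar rel d" using True by (simp add: cls_def equiv_refl)
  ultimately have "(\<Union>d'\<in>cls ar rel d. cls ar rel (d' \<Zsemi> c)) = cls ar rel (d \<Zsemi> c)" for c
    by (rule UN_const[rotated])
  then have "(\<Union>c\<in>Z. \<Union>d'\<in>cls ar rel d. cls ar rel (d' \<Zsemi> c)) = (\<Union>c\<in>Z. cls ar rel (d \<Zsemi> c))"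
    by (simp only:)
  moreover have "cls ar rel d \<odot> Z = (\<Union>c\<in>Z. \<Union>d'\<in>cls ar rel d. cls ar rel (d' \<Zsemi> c))"
    unfolding presented_def smcat.simps by (rule SUP_commute)
  ultimately show ?thesis by (simp only:)
qed (simp add: presented_def cls_ill_formed)

lemma cls_Seq: "cls ar rel (a \<Zsemi> b) = cls ar rel a \<odot> cls ar rel b"
proof (cases "well_formed ar b")
  case True
  have "c \<in> cls ar rel b \<Longrightarrow> cls ar rel (a \<Zsemi> c) = cls ar rel (a \<Zsemi> b)" for c
  proof -
    assume "c \<in> cls ar rel b"
    then have e: "b \<approx> c" by (simp add: cls_def)
    show ?thesis
    proof (cases "well_formed ar (a \<Zsemi> b)")
      case True
      show ?thesis
        by (rule cls_eqI[OF eqv.symm[OF eqv.seq_cong[OF equiv_refl e diags_src_tgt]]])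
          (use True in \<open>auto simp: diags_def\<close>)
    qed (use equiv_typed[OF e] in \<open>auto simp: cls_ill_formed\<close>)
  qed
  moreover have "b \<in> cls ar rel b" using True by (simp add: cls_def equiv_refl)
  ultimately have "(\<Union>c\<in>cls ar rel b. cls ar rel (a \<Zsemi> c)) = cls ar rel (a \<Zsemi> b)"
    by (rule UN_const[rotated])
  then show ?thesis by (simp only: cls_comp)
qed (simp add: cls_comp cls_ill_formed)

lemma comp_UN_right: "X \<odot> (\<Union>i\<in>I. F i) = (\<Union>i\<in>I. X \<odot> F i)"
  unfolding presented_def by (simp, blast)

lemma comp_UN_left: "(\<Union>i\<in>I. F i) \<odot> Z = (\<Union>i\<in>I. F i \<odot> Z)"
  unfolding presented_def by simp

text \<open>
  Mismatched composites are empty on both sides, so words can be rebracketed freely.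
\<close>

lemma comp_assoc: "(X \<odot> Y) \<odot> Z = X \<odot> (Y \<odot> Z)"
proof -
  have expand: "X \<odot> Y = (\<Union>a\<in>X. cls ar rel a \<odot> Y)" for X Y
    unfolding cls_comp by (simp add: presented_def)
  have assoc: "cls ar rel ((a \<Zsemi> b) \<Zsemi> c) = cls ar rel (a \<Zsemi> (b \<Zsemi> c))" for a b c
  proof (cases "well_formed ar ((a \<Zsemi> b) \<Zsemi> c)")
    case True
    then show ?thesis
      by (intro cls_eqI eqv.seq_assoc[where m = "src ar a" and n = "src ar b" and p = "src ar c"
            and q = "tgt ar c"]) (auto simp: diags_def)
  qed (auto simp: cls_ill_formed)
  have "(cls ar rel a \<odot> Y) \<odot> Z = cls ar rel a \<odot> (Y \<odot> Z)" for a Y Z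
  proof -
    have "(cls ar rel a \<odot> Y) \<odot> Z = (\<Union>b\<in>Y. \<Union>c\<in>Z. cls ar rel ((a \<Zsemi> b) \<Zsemi> c))"
      unfolding cls_comp[of a] comp_UN_left cls_comp ..
    also have "\<dots> = (\<Union>b\<in>Y. cls ar rel a \<odot> (\<Union>c\<in>Z. cls ar rel (b \<Zsemi> c)))"
      unfolding assoc comp_UN_right cls_Seq[of a] ..
    also have "\<dots> = cls ar rel a \<odot> (\<Union>b\<in>Y. cls ar rel b \<odot> Z)"
      unfolding comp_UN_right cls_comp ..
    finally show ?thesis unfolding expand[of Y Z] .
  qed
  then show ?thesis
    unfolding expand[of X Y] expand[of X "Y \<odot> Z"] comp_UN_left by simp
qed

lemma comp_empty: "X \<odot> {} = {}" "{} \<odot> X = {}"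
  by (simp_all add: presented_def)

lemma comp_context: "X = Y \<Longrightarrow> X \<odot> Z = Y \<odot> Z" by simp

lemma equiv_in_context:
  assumes "x \<approx> y" and "well_formed ar (a \<Zsemi> x \<Zsemi> b)" shows "a \<Zsemi> x \<Zsemi> b \<approx> a \<Zsemi> y \<Zsemi> b"
  using assms(2) by (rule cls_eq_iff[THEN iffD1]) (simp only: cls_Seq cls_eqI[OF assms(1)])

abbreviation class_tensor (infixr "\<boxtimes>" 70) where
  "X \<boxtimes> Y \<equiv> tns (presented ar rel) X Y"

abbreviation homs :: "nat \<Rightarrow> nat \<Rightarrow> 'g diag set set" where
  "homs \<equiv> mor (presented ar rel)"

interpretation smc: strict_smc "presented ar rel"
  by (rule presented_strict_smc)

lemma cls_hom: "a \<in> diags ar m n \<Longrightarrow> cls ar rel a \<in> homs m n"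
  by (simp add: presented_simps)

lemma cls_hom_src_tgt: "well_formed ar a \<Longrightarrow> cls ar rel a \<in> homs (src ar a) (tgt ar a)"
  by (intro cls_hom diags_src_tgt)

lemma idc_hom: "idc n \<in> homs n n"
  by (intro cls_hom) (simp add: diags_def)

lemma idc_tensor: "idc m \<boxtimes> idc n = idc (m + n)"
  using smc.tns_idt[of m n] by (simp add: presented_simps)

lemma idc_comp_left: "X \<in> homs m n \<Longrightarrow> idc m \<odot> X = X"
  using smc.cmp_idt_left[of X m n] by (simp add: presented_simps)

lemma idc_comp_right: "X \<in> homs m n \<Longrightarrow> X \<odot> idc n = X"
  using smc.cmp_idt_right[of X m n] by (simp add: presented_simps)

lemma idc_tensor_left: "X \<in> homs m n \<Longrightarrow> idc 0 \<boxtimes> X = X"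
  using smc.tns_unit_left[of X m n] by (simp add: presented_simps)

lemma idc_tensor_right: "X \<in> homs m n \<Longrightarrow> X \<boxtimes> idc 0 = X"
  using smc.tns_unit_right[of X m n] by (simp add: presented_simps)

lemma cls_Par: "cls ar rel (a \<otimes> b) = cls ar rel a \<boxtimes> cls ar rel b"
proof (cases "well_formed ar a \<and> well_formed ar b")
  case True
  then show ?thesis using tns_cls[OF diags_src_tgt diags_src_tgt] by metis
next
  case False
  then show ?thesis by (auto simp: cls_ill_formed presented_def)
qed

lemma layer_eq: "layer k d q = (idc k \<boxtimes> cls ar rel d) \<boxtimes> idc q"
  by (simp add: layer_def cls_Par)

lemma layer_cong: "a \<approx> b \<Longrightarrow> layer k a q = layer k b q"
  unfolding layer_eq by (drule cls_eqI) simp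

lemma layer_0: "well_formed ar a \<Longrightarrow> layer 0 a 0 = cls ar rel a"
  unfolding layer_eq
  using idc_tensor_left[OF cls_hom_src_tgt] idc_tensor_right[OF cls_hom_src_tgt] by simp

text \<open>
  The way from words back to diagrams: an equation of words at position 0 without padding is an
  equivalence of diagrams.
\<close>

lemma equivI:
  assumes "well_formed ar a" "well_formed ar b" "layer 0 a 0 = layer 0 b 0"
  shows "a \<approx> b"
  using assms by (simp add: layer_0 cls_eq_iff)

lemma layer_hom:
  "well_formed ar a \<Longrightarrow> layer k a q \<in> homs (k + src ar a + q) (k + tgt ar a + q)"
  unfolding layer_eq by (intro smc.tns_mor idc_hom cls_hom_src_tgt)

lemma layer_ill_formed: "\<not> well_formed ar a \<Longrightarrow> layer k a q = {}"
  unfolding layer_def by (rule cls_ill_formed) simp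

lemma layer_Seq: "layer k (a \<Zsemi> b) q = layer k a q \<odot> layer k b q"
proof (cases "well_formed ar (a \<Zsemi> b)")
  case True
  let ?m = "src ar a" and ?n = "src ar b" and ?p = "tgt ar b"
  have A: "cls ar rel a \<in> homs ?m ?n" and B: "cls ar rel b \<in> homs ?n ?p"
    using True cls_hom_src_tgt[of a] cls_hom_src_tgt[of b] by auto
  have "layer k (a \<Zsemi> b) q =
      ((idc k \<odot> idc k) \<boxtimes> (cls ar rel a \<odot> cls ar rel b)) \<boxtimes> (idc q \<odot> idc q)"
    by (simp add: layer_eq cls_Seq idc_comp_left[OF idc_hom])
  then show ?thesis
    by (simp add: layer_eq smc.interchange[OF idc_hom idc_hom A B]
        smc.interchange[OF smc.tns_mor[OF idc_hom A] smc.tns_mor[OF idc_hom B] idc_hom idc_hom])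
next
  case False
  then have "\<not> well_formed ar ((Ids k \<otimes> a \<otimes> Ids q) \<Zsemi> (Ids k \<otimes> b \<otimes> Ids q))" by auto
  with False show ?thesis unfolding layer_def cls_Seq[symmetric] by (simp add: cls_ill_formed)
qed

lemma layer_Par:
  shows "layer k (a \<otimes> b) q = layer k a (src ar b + q) \<odot> layer (k + tgt ar a) b q"
    and "layer k (a \<otimes> b) q = layer (k + src ar a) b q \<odot> layer k a (tgt ar b + q)"
proof -
  have "layer k (a \<otimes> b) q = layer k a (src ar b + q) \<odot> layer (k + tgt ar a) b q \<and>
    layer k (a \<otimes> b) q = layer (k + src ar a) b q \<odot> layer k a (tgt ar b + q)"
  proof (cases "well_formed ar a \<and> well_formed ar b")
    case True
    let ?A = "cls ar rel a" and ?B = "cls ar rel b"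
    have A: "?A \<in> homs (src ar a) (tgt ar a)" and B: "?B \<in> homs (src ar b) (tgt ar b)"
      using True by (auto intro: cls_hom_src_tgt)
    let ?P = "idc k \<boxtimes> ?A"
    have P: "?P \<in> homs (k + src ar a) (k + tgt ar a)" by (intro smc.tns_mor idc_hom A)
    have l: "layer k (a \<otimes> b) q = (?P \<boxtimes> ?B) \<boxtimes> idc q"
      by (simp add: layer_eq cls_Par smc.tns_assoc[OF idc_hom A B])
    have a: "layer k a (p + q) = (?P \<boxtimes> idc p) \<boxtimes> idc q" for p
      by (simp add: layer_eq idc_tensor[symmetric] smc.tns_assoc[OF P idc_hom idc_hom])
    have b: "layer (k + p) b q = (idc (k + p) \<boxtimes> ?B) \<boxtimes> idc q" for p
      by (simp add: layer_eq)
    note comp = smc.interchange[OF smc.tns_mor smc.tns_mor idc_hom idc_hom, symmetric]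
    have "layer k a (src ar b + q) \<odot> layer (k + tgt ar a) b q = (?P \<boxtimes> ?B) \<boxtimes> idc q"
      unfolding a b comp[OF P idc_hom idc_hom B] smc.interchange[OF P idc_hom idc_hom B, symmetric]
      by (simp add: idc_comp_left[OF B] idc_comp_left[OF idc_hom] idc_comp_right[OF P])
    moreover have "layer (k + src ar a) b q \<odot> layer k a (tgt ar b + q) = (?P \<boxtimes> ?B) \<boxtimes> idc q"
      unfolding a b comp[OF idc_hom B P idc_hom] smc.interchange[OF idc_hom P B idc_hom, symmetric]
      by (simp add: idc_comp_right[OF B] idc_comp_left[OF idc_hom] idc_comp_left[OF P])
    ultimately show ?thesis by (simp add: l)
  next
    case False
    then show ?thesis by (auto simp: layer_ill_formed presented_def)
  qed
  then show "layer k (a \<otimes> b) q = layer k a (src ar b + q) \<odot> layer (k + tgt ar a) b q"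
    and "layer k (a \<otimes> b) q = layer (k + src ar a) b q \<odot> layer k a (tgt ar b + q)"
    by blast+
qed

lemma layer_Ids: "layer k (Ids n) q = idc (k + n + q)"
  by (simp add: layer_eq idc_tensor)

lemma idc_layer: "n = k + src ar a + q \<Longrightarrow> idc n \<odot> layer k a q = layer k a q"
  by (cases "well_formed ar a")
    (simp_all add: layer_ill_formed idc_comp_left[OF layer_hom] comp_empty)

lemma layer_idc: "n = k + tgt ar a + q \<Longrightarrow> layer k a q \<odot> idc n = layer k a q"
  by (cases "well_formed ar a")
    (simp_all add: layer_ill_formed idc_comp_right[OF layer_hom] comp_empty)

lemma idc_layer_comp: "n = k + src ar a + q \<Longrightarrow> idc n \<odot> (layer k a q \<odot> Z) = layer k a q \<odot> Z"
  by (simp add: comp_assoc[symmetric] idc_layer)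

lemma layer_idc_comp: "n = k + tgt ar a + q \<Longrightarrow> layer k a q \<odot> (idc n \<odot> Z) = layer k a q \<odot> Z"
  by (simp add: comp_assoc[symmetric] layer_idc)

lemma idc_idc: "idc n \<odot> idc n = idc n" "idc n \<odot> (idc n \<odot> Z) = idc n \<odot> Z"
  by (simp_all add: comp_assoc[symmetric] idc_comp_left[OF idc_hom])

lemma layer_shift: "layer k (Ids i \<otimes> d) q = layer (k + i) d q"
proof (cases "well_formed ar d")
  case True
  then show ?thesis
    by (simp add: layer_Par(1) layer_Ids idc_layer)
qed (simp add: layer_ill_formed)

lemma layer_pad: "layer k (d \<otimes> Ids j) q = layer k d (j + q)"
  by (simp add: layer_Par(1) layer_Ids layer_idc add.assoc)

text \<open>
  Layers on disjoint wires commute; the positions of the one on the right change by the difference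
  between outputs and inputs of the one on the left.
\<close>

lemma layer_exchange:
  assumes "i + tgt ar a \<le> j" "i + tgt ar a + p = j + src ar b + q"
  shows "layer i a p \<odot> layer j b q =
    layer (j - tgt ar a + src ar a) b q \<odot> layer i a (p - src ar b + tgt ar b)"
proof -
  obtain d where d: "j = i + tgt ar a + d" using assms(1) le_Suc_ex by blast
  have p: "p = d + src ar b + q" using assms(2) d by simp
  show ?thesis
    using layer_Par[of i a "Ids d \<otimes> b" q] by (simp add: layer_shift d p ac_simps)
qed

lemma layer_exchange_comp:
  assumes "i + tgt ar a \<le> j" "i + tgt ar a + p = j + src ar b + q"
  shows "layer i a p \<odot> (layer j b q \<odot> Z) =
    layer (j - tgt ar a + src ar a) b q \<odot> (layer i a (p - src ar b + tgt ar b) \<odot> Z)"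
  by (simp only: comp_assoc[symmetric] layer_exchange[OF assms])

lemmas layer_words = comp_assoc layer_Seq layer_Par(1) layer_Ids idc_layer layer_idc
  idc_layer_comp layer_idc_comp idc_idc

lemma layer_braid_natural:
  assumes "well_formed ar a" "well_formed ar b"
  shows "layer k (a \<otimes> b) q \<odot> layer k (Braid (tgt ar a) (tgt ar b)) q =
    layer k (Braid (src ar a) (src ar b)) q \<odot> layer k (b \<otimes> a) q"
proof -
  have "(a \<otimes> b) \<Zsemi> Braid (tgt ar a) (tgt ar b) \<approx> Braid (src ar a) (src ar b) \<Zsemi> (b \<otimes> a)"
    by (rule eqv.braid_natural; rule diags_src_tgt; fact)
  from layer_cong[OF this] show ?thesis by (simp only: layer_Seq)
qed

lemma layer_braid_inverse: "layer k (Braid m n) q \<odot> layer k (Braid n m) q = idc (k + (m + n) + q)"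
  using layer_cong[OF eqv.braid_inverse[of ar rel m n]] by (simp add: layer_Seq layer_Ids)

lemma layer_braid_hexagon: "layer k (Braid m (n + p)) q =
    layer k (Braid m n) (p + q) \<odot> layer (k + n) (Braid m p) q"
  using layer_cong[OF eqv.braid_hexagon[of ar rel m n p]]
  by (simp add: layer_Seq layer_pad layer_shift)

lemma layer_braid_unit: "layer k (Braid m 0) q = idc (k + m + q)"
  using layer_cong[OF eqv.braid_unit[of ar rel m]] by (simp add: layer_Ids)

lemma layer_scalar: "a \<in> diags ar 0 0 \<Longrightarrow> layer k a q = idc (k + q)"
  using layer_cong[OF eqv.scalar] by (simp add: layer_Ids)

lemma crossing_natural:
  assumes "f \<in> diags ar 1 1"
  shows "layer k f (1 + q) \<odot> layer k crossing q = layer k crossing q \<odot> layer (k + 1) f q"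
  using layer_braid_natural[of f wire k q] assms
  by (simp add: diags_def layer_pad layer_shift)

lemma state_slide:
  assumes "s \<in> diags ar 0 1"
  shows "layer (k + 1) s q \<odot> layer k crossing q = layer k s (1 + q)"
  using layer_braid_natural[of wire s k q] assms
  by (simp add: diags_def layer_pad layer_shift layer_braid_unit idc_layer)

text \<open>
  Pulling a wire over both legs of a cup is trivial by naturality, so crossing one leg from the
  left is the same as crossing the other from the right.
\<close>

lemma cup_slide:
  assumes "u \<in> diags ar 0 2"
  shows "layer (k + 1) u q \<odot> layer k crossing (1 + q) = layer k u (1 + q) \<odot> layer (k + 1) crossing q"
proof -
  have braid: "layer k (Braid 1 2) q = layer k crossing (1 + q) \<odot> layer (k + 1) crossing q"
    using layer_braid_hexagon[of k 1 1 1 q] by simp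
  have "layer k (wire \<otimes> u) q \<odot> layer k (Braid 1 2) q = layer k (Braid 1 0) q \<odot> layer k (u \<otimes> wire) q"
    using layer_braid_natural[of wire u k q] assms by (simp add: diags_def)
  then have "layer (k + 1) u q \<odot> layer k crossing (1 + q) \<odot> layer (k + 1) crossing q = layer k u (1 + q)"
    using assms by (simp add: layer_shift layer_pad layer_braid_unit idc_layer braid diags_def)
  then have "layer k u (1 + q) \<odot> layer (k + 1) crossing q =
      layer (k + 1) u q \<odot> layer k crossing (1 + q) \<odot> layer (k + 1) crossing q \<odot> layer (k + 1) crossing q"
    by (simp only: comp_assoc[symmetric])
  then show ?thesis by (simp add: layer_braid_inverse layer_idc)
qed

section \<open>Gates on all legs of a diagram\<close>

lemma tensor_power_hom:
  assumes "u \<in> diags ar 1 1" shows "cls ar rel (tensor_power u m) \<in> homs m m"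
  using cls_hom[OF tensor_power_diags[OF assms, of m]] by simp

lemma tensor_power_add:
  assumes u: "u \<in> diags ar 1 1"
  shows "cls ar rel (tensor_power u (m + n)) = cls ar rel (tensor_power u m) \<boxtimes> cls ar rel (tensor_power u n)"
proof (induction n)
  case 0 show ?case by (simp add: idc_tensor_right[OF tensor_power_hom[OF u]])
next
  case (Suc n)
  then show ?case
    by (simp add: cls_Par smc.tns_assoc[OF tensor_power_hom[OF u] tensor_power_hom[OF u] cls_hom[OF u]])
qed

lemma tensor_power_Seq:
  assumes u: "u \<in> diags ar 1 1" and w: "w \<in> diags ar 1 1"
  shows "cls ar rel (tensor_power u m) \<odot> cls ar rel (tensor_power w m) = cls ar rel (tensor_power (u \<Zsemi> w) m)"
proof (induction m)
  case 0 show ?case by (simp add: idc_comp_left[OF idc_hom])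
next
  case (Suc m)
  then show ?case
    by (simp add: cls_Par cls_Seq
        smc.interchange[OF tensor_power_hom[OF u] tensor_power_hom[OF w] cls_hom[OF u] cls_hom[OF w], symmetric])
qed

lemma tensor_power_cong: "u \<approx> w \<Longrightarrow> cls ar rel (tensor_power u m) = cls ar rel (tensor_power w m)"
  by (induction m) (simp_all add: cls_Par cls_eqI)

lemma tensor_power_wire: "u \<approx> wire \<Longrightarrow> cls ar rel (tensor_power u m) = idc m"
  by (induction m) (simp_all add: cls_Par cls_eqI idc_tensor, simp add: Suc_eq_plus1)

end

lemma tensor_power_shape [simp]:
  "src ar (tensor_power u m) = m * src ar u" "tgt ar (tensor_power u m) = m * tgt ar u"
  "well_formed ar (tensor_power u m) \<longleftrightarrow> m = 0 \<or> well_formed ar u"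
  by (induction m) auto

lemma tensor_power_numeral [simp]:
  "tensor_power u 1 = Ids 0 \<otimes> u" "tensor_power u 2 = Ids 0 \<otimes> u \<otimes> u"
  by (simp_all add: One_nat_def numeral_2_eq_2 del: One_nat_def[symmetric])

lemma extend_tensor_power: "extend \<phi> (tensor_power a n) = tensor_power (extend \<phi> a) n"
  by (induction n) simp_all

lemma extend_map: "extend \<phi> (map_diag \<rho> d) = extend (\<lambda>g. \<phi> (\<rho> g)) d"
  by (induction d) simp_all

lemma extend_extend: "extend \<phi> (extend \<psi> d) = extend (\<lambda>g. extend \<phi> (\<psi> g)) d"
  by (induction d) simp_all

lemma extend_Box_id: "extend Box d = d"
  by (induction d) simp_all

lemma extend_Box_map: "extend (\<lambda>g. Box (\<rho> g)) d = map_diag \<rho> d"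
  by (induction d) simp_all

lemma extend_diags:
  fixes \<phi> :: "'h \<Rightarrow> 'g diag"
  assumes "\<And>g. \<phi> g \<in> diags ar (fst (ar' g)) (snd (ar' g))" and "d \<in> diags ar' m n"
  shows "extend \<phi> d \<in> diags ar m n"
  using assms(2) by (induction d arbitrary: m n) (use assms(1) in \<open>auto simp: diags_def\<close>)

context presentation begin

interpretation smc: strict_smc "presented ar rel"
  by (rule presented_strict_smc)

lemma conjugate_conjugate:
  assumes "a \<in> diags ar 1 1" "b \<in> diags ar 1 1" "c \<in> diags ar 1 1" "d \<in> diags ar 1 1"
    and x: "x \<in> diags ar m n" and u: "a \<Zsemi> b \<approx> u" and w: "c \<Zsemi> d \<approx> w"
  shows "tensor_power a m \<Zsemi> (tensor_power b m \<Zsemi> x \<Zsemi> tensor_power c n) \<Zsemi> tensor_power d n \<approx>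
    tensor_power u m \<Zsemi> x \<Zsemi> tensor_power w n"
proof (rule cls_eq_iff[THEN iffD1])
  show "cls ar rel (tensor_power a m \<Zsemi> (tensor_power b m \<Zsemi> x \<Zsemi> tensor_power c n) \<Zsemi> tensor_power d n) =
    cls ar rel (tensor_power u m \<Zsemi> x \<Zsemi> tensor_power w n)"
    unfolding cls_Seq tensor_power_cong[OF u, symmetric] tensor_power_cong[OF w, symmetric]
      tensor_power_Seq[OF assms(1,2), symmetric] tensor_power_Seq[OF assms(3,4), symmetric] comp_assoc ..
qed (use assms in \<open>auto simp: diags_def\<close>)

text \<open>
  If a translation \<open>\<phi>\<close> differs from \<open>\<psi>\<close> on every generator by gates \<open>u\<close> on the inputs and inverse
  gates \<open>w\<close> on the outputs, the gates on each internal wire of a diagram cancel, and only those on the outer legs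
  remain.
\<close>

lemma extend_conjugate:
  fixes \<phi> \<psi> :: "'h \<Rightarrow> 'g diag" and ar' :: "'h \<Rightarrow> nat \<times> nat"
  assumes u: "u \<in> diags ar 1 1" and w: "w \<in> diags ar 1 1"
    and uw: "u \<Zsemi> w \<approx> wire" and wu: "w \<Zsemi> u \<approx> wire"
    and typed: "\<And>g. \<psi> g \<in> diags ar (fst (ar' g)) (snd (ar' g))"
    and gens: "\<And>g. g \<in> set_diag d \<Longrightarrow>
      \<phi> g \<approx> tensor_power u (fst (ar' g)) \<Zsemi> \<psi> g \<Zsemi> tensor_power w (snd (ar' g))"
    and d: "d \<in> diags ar' m n"
  shows "extend \<phi> d \<approx> tensor_power u m \<Zsemi> extend \<psi> d \<Zsemi> tensor_power w n"
proof -
  let ?c = "cls ar rel" and ?U = "\<lambda>m. cls ar rel (tensor_power u m)"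
    and ?W = "\<lambda>m. cls ar rel (tensor_power w m)"
  note U = tensor_power_hom[OF u] and W = tensor_power_hom[OF w]
  have UW: "?U m \<odot> ?W m = idc m" and WU: "?W m \<odot> ?U m = idc m" for m
    by (simp_all only: tensor_power_Seq[OF u w] tensor_power_Seq[OF w u]
        tensor_power_wire[OF uw] tensor_power_wire[OF wu])
  note typed' = extend_diags[of \<psi> ar ar', OF typed]
  have "?c (extend \<phi> d) = ?U m \<odot> ?c (extend \<psi> d) \<odot> ?W n" using gens d
  proof (induction d arbitrary: m n)
    case (Box g)
    then show ?case using cls_eqI[OF Box(1)[of g]] by (simp add: cls_Seq diags_def comp_assoc)
  next
    case (Ids k)
    then show ?case by (auto simp: diags_def UW idc_comp_left[OF W])
  next
    case (Braid k l)
    have "?U (k + l) \<odot> ?c (Braid k l) = ?c (Braid k l) \<odot> ?U (l + k)"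
      using smc.sym_natural[OF U U, of k l] by (simp add: presented_simps tensor_power_add[OF u])
    then have "?U (k + l) \<odot> ?c (Braid k l) \<odot> ?W (l + k) = ?c (Braid k l) \<odot> (?U (l + k) \<odot> ?W (l + k))"
      by (simp only: comp_assoc[symmetric])
    moreover have "?c (Braid k l) \<in> homs (k + l) (l + k)" by (intro cls_hom diags_intros)
    ultimately show ?case using Braid(2) by (auto simp: diags_def UW idc_comp_right)
  next
    case (Seq a b)
    then obtain p where a: "a \<in> diags ar' m p" and b: "b \<in> diags ar' p n" by (auto simp: diags_def)
    have "?c (extend \<phi> (a \<Zsemi> b)) =
        ?U m \<odot> ?c (extend \<psi> a) \<odot> (?W p \<odot> ?U p) \<odot> ?c (extend \<psi> b) \<odot> ?W n"
      using Seq.IH(1)[OF _ a] Seq.IH(2)[OF _ b] Seq.prems(1) by (simp add: cls_Seq comp_assoc)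
    also have "\<dots> = ?U m \<odot> ?c (extend \<psi> a) \<odot> (idc p \<odot> ?c (extend \<psi> b)) \<odot> ?W n"
      by (simp only: WU comp_assoc)
    also have "idc p \<odot> ?c (extend \<psi> b) = ?c (extend \<psi> b)"
      by (rule idc_comp_left[OF cls_hom[OF typed'[OF b]]])
    finally show ?case by (simp add: cls_Seq comp_assoc)
  next
    case (Par a b)
    then obtain m1 n1 m2 n2 where a: "a \<in> diags ar' m1 n1" and b: "b \<in> diags ar' m2 n2"
      and mn: "m = m1 + m2" "n = n1 + n2" by (auto simp: diags_def)
    have A: "?c (extend \<psi> a) \<in> homs m1 n1" and B: "?c (extend \<psi> b) \<in> homs m2 n2"
      by (intro cls_hom typed' a b)+
    show ?case
      using Par.IH(1)[OF _ a] Par.IH(2)[OF _ b] Par.prems(1)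
      by (simp add: cls_Par mn tensor_power_add[OF u] tensor_power_add[OF w]
          smc.interchange[OF U smc.cmp_mor[OF A W] U smc.cmp_mor[OF B W]] smc.interchange[OF A W B W])
  qed
  moreover have "extend \<psi> d \<in> diags ar m n" by (rule typed'[OF d])
  moreover have "well_formed ar (tensor_power u m)" "well_formed ar (tensor_power w n)"
    "src ar (tensor_power u m) = m" "tgt ar (tensor_power u m) = m" "src ar (tensor_power w n) = n"
    using tensor_power_diags[OF u, of m] tensor_power_diags[OF w, of n] by (auto simp: diags_def)
  ultimately show ?thesis
    by (intro eqv.symm[OF cls_eq_iff[THEN iffD1]]) (auto simp: cls_Seq comp_assoc diags_def)
qed

lemma extend_cong:
  fixes \<phi> \<psi> :: "'h \<Rightarrow> 'g diag" and ar' :: "'h \<Rightarrow> nat \<times> nat"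
  assumes typed: "\<And>g. \<psi> g \<in> diags ar (fst (ar' g)) (snd (ar' g))"
    and gens: "\<And>g. g \<in> set_diag d \<Longrightarrow> \<phi> g \<approx> \<psi> g" and d: "d \<in> diags ar' m n"
  shows "extend \<phi> d \<approx> extend \<psi> d"
  using gens d
proof (induction d arbitrary: m n)
  case (Seq a b)
  then obtain p where a: "a \<in> diags ar' m p" and b: "b \<in> diags ar' p n" by (auto simp: diags_def)
  note t = extend_diags[of \<psi> ar ar', OF typed]
  show ?case
    using eqv.seq_cong[OF eqv.symm[OF Seq.IH(1)[OF _ a]] eqv.symm[OF Seq.IH(2)[OF _ b]] t[OF a] t[OF b]]
      Seq.prems(1) by (auto intro: eqv.symm)
next
  case (Par a b)
  then show ?case by (auto simp: diags_def intro!: eqv.par_cong)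
qed (auto intro: equiv_refl)

lemma extend_equiv:
  fixes \<phi> :: "'h \<Rightarrow> 'g diag"
  assumes typed: "\<And>g. \<phi> g \<in> diags ar (fst (ar' g)) (snd (ar' g))"
    and rel: "\<And>a b. rel' a b \<Longrightarrow> extend \<phi> a \<approx> extend \<phi> b"
    and eq: "eqv ar' rel' a b"
  shows "extend \<phi> a \<approx> extend \<phi> b"
proof -
  note t = extend_diags[of \<phi> ar ar', OF typed]
  show ?thesis using eq
    by (induction rule: eqv.induct) (use t in \<open>auto intro: rel eqv.intros\<close>)
qed

end

text \<open>
  The extension to diagrams is a homomorphism by construction, so compatibility with the relations
  is all that is needed for the union defining \<open>induced\<close> to be a single class and for functoriality.
\<close>

theorem induced_smc_functor:
  fixes \<phi> :: "'h \<Rightarrow> 'g diag"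
  assumes typed: "\<And>g. \<phi> g \<in> diags ar (fst (ar' g)) (snd (ar' g))"
    and rel: "\<And>a b. rel' a b \<Longrightarrow> eqv ar rel (extend \<phi> a) (extend \<phi> b)"
  shows "smc_functor (presented ar' rel') (presented ar rel) (induced ar rel \<phi>)" (is "smc_functor ?C ?D ?F")
    and "\<And>a. well_formed ar' a \<Longrightarrow> induced ar rel \<phi> (cls ar' rel' a) = cls ar rel (extend \<phi> a)"
proof -
  interpret presentation ar rel .
  interpret source: presentation ar' rel' .
  note t = extend_diags[of \<phi> ar ar', OF typed]
  show F: "?F (cls ar' rel' a) = cls ar rel (extend \<phi> a)" if "well_formed ar' a" for a
    unfolding induced_def
  proof (rule UN_const)
    show "a \<in> cls ar' rel' a" using that by (simp add: cls_def source.equiv_refl)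
    fix b assume "b \<in> cls ar' rel' a"
    then have "source.equiv a b" by (simp add: cls_def)
    from extend_equiv[OF typed rel this] show "cls ar rel (extend \<phi> b) = cls ar rel (extend \<phi> a)"
      by (rule cls_eqI[symmetric])
  qed
  have F': "?F (cls ar' rel' a) = cls ar rel (extend \<phi> a)" if "a \<in> diags ar' m n" for a m n
    using that by (simp add: F diags_def)
  have "?F (cmp ?C f g) = cmp ?D (?F f) (?F g)" if "f \<in> mor ?C m n" "g \<in> mor ?C n p" for m n p f g
  proof -
    from that obtain a b where "a \<in> diags ar' m n" "b \<in> diags ar' n p" "f = cls ar' rel' a" "g = cls ar' rel' b"
      by (auto simp: presented_simps)
    moreover from this have "a \<Zsemi> b \<in> diags ar' m p" by (intro diags_intros)
    ultimately show ?thesis by (simp add: F' source.cls_Seq[symmetric] cls_Seq)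
  qed
  moreover have "?F (tns ?C f g) = tns ?D (?F f) (?F g)" if "f \<in> mor ?C m n" "g \<in> mor ?C p q" for m n p q f g
  proof -
    from that obtain a b where "a \<in> diags ar' m n" "b \<in> diags ar' p q" "f = cls ar' rel' a" "g = cls ar' rel' b"
      by (auto simp: presented_simps)
    moreover from this have "a \<otimes> b \<in> diags ar' (m + p) (n + q)" by (intro diags_intros)
    ultimately show ?thesis by (simp add: F' source.cls_Par[symmetric] cls_Par)
  qed
  moreover have "?F f \<in> mor ?D m n" if "f \<in> mor ?C m n" for f m n
    using that by (auto simp: presented_simps F' t)
  ultimately show "smc_functor ?C ?D ?F"
    unfolding smc_functor_def
    by (auto simp: presented_strict_smc presented_simps F'[OF diags_intros(1)] F'[OF diags_intros(2)])
qed

section \<open>Reversing diagrams\<close>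

context presentation begin

text \<open>
  The axioms treat the unit and composite objects only as second argument of the braiding; their
  mirror images, needed because \<open>\<dagger>\<close> exchanges the arguments, follow by inverting.
\<close>

lemma braid_unit_left: "Braid 0 m \<approx> Ids m"
proof (rule equivI)
  have "layer 0 (Braid 0 m) 0 \<odot> layer 0 (Braid m 0) 0 = idc m"
    using layer_braid_inverse[of 0 0 m 0] by simp
  then show "layer 0 (Braid 0 m) 0 = layer 0 (Ids m) 0"
    by (simp add: layer_braid_unit layer_idc layer_Ids)
qed simp_all

lemma braid_hexagon_left: "Braid (n + p) m \<approx> (Ids n \<otimes> Braid p m) \<Zsemi> (Braid n m \<otimes> Ids p)"
proof (rule equivI)
  let ?x = "layer 0 (Braid m (n + p)) 0" and ?y = "layer 0 (Braid (n + p) m) 0"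
    and ?z = "layer n (Braid p m) 0 \<odot> layer 0 (Braid n m) p"
  have x: "?x = layer 0 (Braid m n) p \<odot> layer n (Braid m p) 0"
    using layer_braid_hexagon[of 0 m n p 0] by simp
  have "?z \<odot> ?x = layer n (Braid p m) 0 \<odot> (layer 0 (Braid n m) p \<odot> layer 0 (Braid m n) p) \<odot> layer n (Braid m p) 0"
    by (simp only: x comp_assoc)
  also have "\<dots> = layer n (Braid p m) 0 \<odot> layer n (Braid m p) 0"
    by (simp add: layer_braid_inverse idc_layer)
  also have "\<dots> = idc (n + p + m)" by (simp add: layer_braid_inverse add.assoc)
  finally have zx: "?z \<odot> ?x = idc (n + p + m)" .
  have "?z = ?z \<odot> (?x \<odot> ?y)"
    by (simp add: layer_braid_inverse comp_assoc layer_idc)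
  also have "\<dots> = ?y" by (simp add: comp_assoc[symmetric] zx) (simp add: idc_layer)
  finally show "?y = layer 0 ((Ids n \<otimes> Braid p m) \<Zsemi> (Braid n m \<otimes> Ids p)) 0"
    by (simp add: layer_Seq layer_shift layer_pad)
qed simp_all

lemma dag_equiv:
  assumes ar: "\<And>g. ar (\<delta> g) = prod.swap (ar g)"
    and rel: "\<And>a b. rel a b \<Longrightarrow> dag \<delta> a \<approx> dag \<delta> b"
    and eq: "a \<approx> b"
  shows "dag \<delta> a \<approx> dag \<delta> b"
  using eq
proof (induction rule: eqv.induct)
  case (par_ids m n) show ?case by (simp add: eqv.par_ids)
next
  case (interchange a m n b p a' m' n' b' p')
  then show ?case using dag_diags[of ar \<delta>, OF ar] by (auto intro: eqv.interchange)
next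
  case (braid_natural a m n b p q)
  then show ?case using dag_diags[of ar \<delta>, OF ar] by (auto intro: eqv.braid_natural[THEN eqv.symm])
next
  case (seq_cong a a' b b' m n p)
  then show ?case using dag_diags[of ar \<delta>, OF ar] by (auto intro: eqv.seq_cong)
next
  case (seq_assoc a m n b p c q)
  then show ?case using dag_diags[of ar \<delta>, OF ar] by (auto intro: eqv.seq_assoc[THEN eqv.symm])
next
  case (braid_hexagon m n p)
  show ?case by (simp add: braid_hexagon_left)
next
  case (scalar a)
  then show ?case using dag_diags[of ar \<delta>, OF ar] by (auto intro: eqv.scalar)
qed (use dag_diags[of ar \<delta>, OF ar] in \<open>auto intro: rel eqv.intros braid_unit_left\<close>)

lemma dag_extend:
  fixes \<phi> :: "'h \<Rightarrow> 'g diag"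
  assumes ar: "\<And>g. ar (\<delta> g) = prod.swap (ar g)"
    and typed: "\<And>g. \<phi> g \<in> diags ar (fst (ar' g)) (snd (ar' g))"
    and gens: "\<And>g. dag \<delta> (\<phi> g) \<approx> \<phi> (\<delta>' g)"
    and d: "d \<in> diags ar' m n"
  shows "dag \<delta> (extend \<phi> d) \<approx> extend \<phi> (dag \<delta>' d)"
proof -
  note t = extend_diags[of \<phi> ar ar', OF typed]
  show ?thesis using d
  proof (induction d arbitrary: m n)
    case (Seq a b)
    then obtain p where a: "a \<in> diags ar' m p" and b: "b \<in> diags ar' p n" by (auto simp: diags_def)
    from eqv.seq_cong[OF Seq.IH(2)[OF b] Seq.IH(1)[OF a] dag_diags[OF ar t[OF b]] dag_diags[OF ar t[OF a]]]
    show ?case by simp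
  next
    case (Par a b)
    then show ?case by (auto simp: diags_def intro!: eqv.par_cong)
  qed (auto intro: gens equiv_refl)
qed

end

section \<open>Spider calculus\<close>

primrec node_phase :: "'c node \<Rightarrow> phase" where
  "node_phase (Unit x) = 0" | "node_phase (Counit x) = 0" | "node_phase (Mult x) = 0"
| "node_phase (Comult x) = 0" | "node_phase (Phase x \<theta>) = \<theta>"

lemma merge_split_numeral [simp]: "merge \<iota> x 1 = wire" "split \<iota> x 1 = wire"
  "merge \<iota> x 2 = (wire \<otimes> wire) \<Zsemi> Box (\<iota> (Mult x))"
  "split \<iota> x 2 = Box (\<iota> (Comult x)) \<Zsemi> (wire \<otimes> wire)"
  by (simp_all add: One_nat_def numeral_2_eq_2 del: One_nat_def[symmetric])

lemma dag_merge_split: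
  assumes "\<And>v. \<delta> (\<iota> v) = \<iota> (node_dag v)"
  shows "dag \<delta> (merge \<iota> x m) = split \<iota> x m" "dag \<delta> (split \<iota> x m) = merge \<iota> x m"
  by (induction m rule: induct_nat_012) (use assms in simp_all)

lemma map_spider:
  assumes "\<And>v. \<rho> (\<iota> v) = \<iota>' (map_node f v)"
  shows "map_diag \<rho> (merge \<iota> x m) = merge \<iota>' (f x) m"
    and "map_diag \<rho> (split \<iota> x m) = split \<iota>' (f x) m"
    and "map_diag \<rho> (spider \<iota> x m n \<theta>) = spider \<iota>' (f x) m n \<theta>"
proof -
  show *: "map_diag \<rho> (merge \<iota> x m) = merge \<iota>' (f x) m" "map_diag \<rho> (split \<iota> x m) = split \<iota>' (f x) m" for m
    by (induction m rule: induct_nat_012) (use assms in simp_all)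
  show "map_diag \<rho> (spider \<iota> x m n \<theta>) = spider \<iota>' (f x) m n \<theta>"
    by (simp add: spider_def * assms)
qed

lemma map_spider_rule:
  assumes "\<And>v. \<rho> (\<iota> v) = \<iota>' (map_node f v)" and "spider_rule \<iota> x a b"
  shows "spider_rule \<iota>' (f x) (map_diag \<rho> a) (map_diag \<rho> b)"
  using assms(2)
  by cases (auto simp: map_spider[of \<rho> \<iota> \<iota>' f, OF assms(1)] assms(1) intro: spider_rule.intros
      spider_rule.mult_legs[of \<iota>' "f x"] spider_rule.comult_legs[of \<iota>' "f x"] spider_rule.identity[of \<iota>' "f x"])

lemma set_diag_spider:
  shows "g \<in> set_diag (merge \<iota> x m) \<Longrightarrow> \<exists>v. g = \<iota> v \<and> set_node v = {x}"
    and "g \<in> set_diag (split \<iota> x m) \<Longrightarrow> \<exists>v. g = \<iota> v \<and> set_node v = {x}"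
    and "g \<in> set_diag (spider \<iota> x m n \<theta>) \<Longrightarrow> \<exists>v. g = \<iota> v \<and> set_node v = {x}"
proof -
  have nodes: "\<exists>v. \<iota> (Unit x) = \<iota> v \<and> set_node v = {x}" "\<exists>v. \<iota> (Counit x) = \<iota> v \<and> set_node v = {x}"
    "\<exists>v. \<iota> (Mult x) = \<iota> v \<and> set_node v = {x}" "\<exists>v. \<iota> (Comult x) = \<iota> v \<and> set_node v = {x}"
    "\<exists>v. \<iota> (Phase x \<theta>) = \<iota> v \<and> set_node v = {x}"
    by (metis node.set)+
  show *: "g \<in> set_diag (merge \<iota> x m) \<Longrightarrow> \<exists>v. g = \<iota> v \<and> set_node v = {x}"
    "g \<in> set_diag (split \<iota> x m) \<Longrightarrow> \<exists>v. g = \<iota> v \<and> set_node v = {x}" for m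
    by (induction m rule: induct_nat_012) (use nodes in auto)
  show "g \<in> set_diag (spider \<iota> x m n \<theta>) \<Longrightarrow> \<exists>v. g = \<iota> v \<and> set_node v = {x}"
    using *[of m] *[of n] nodes by (auto simp: spider_def)
qed

lemma set_diag_spider_rule:
  assumes "spider_rule \<iota> x a b" and "g \<in> set_diag a \<union> set_diag b"
  shows "\<exists>v. g = \<iota> v \<and> set_node v = {x}"
  using assms(1)
proof cases
  case mult_legs
  then have "g = \<iota> (Mult x)" using assms(2) by auto
  then show ?thesis by (metis node.set(3))
next
  case comult_legs
  then have "g = \<iota> (Comult x)" using assms(2) by auto
  then show ?thesis by (metis node.set(4))
next
  case identity
  then have "g = \<iota> (Phase x 0)" using assms(2) by auto
  then show ?thesis by (metis node.set(5))
qed (use assms(2) in \<open>auto dest: set_diag_spider\<close>)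

text \<open>
  The last axiom is the mirror image of the fusion rule, where the passive legs lie on the other
  sides; it holds in both categories because their relations are closed under \<open>\<dagger>\<close>.
\<close>

locale spiders = presentation ar rel
  for ar :: "'g \<Rightarrow> nat \<times> nat" and rel +
  fixes \<iota> :: "'c node \<Rightarrow> 'g" and x :: 'c
  assumes ar_node: "ar (\<iota> v) = node_ar v"
    and rules: "spider_rule \<iota> x a b \<Longrightarrow> a \<approx> b"
    and fusion_dag: "k \<ge> 1 \<Longrightarrow> (Ids n \<otimes> spider \<iota> x n' (k + m') \<beta>) \<Zsemi> (spider \<iota> x (n + k) m \<alpha> \<otimes> Ids m')
      \<approx> spider \<iota> x (n + n') (m + m') (\<alpha> + \<beta>)"
begin

abbreviation "sp \<equiv> spider \<iota> x"

lemma sp_diags: "sp m n \<theta> \<in> diags ar m n"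
  by (rule spider_diags[of ar \<iota> x, OF ar_node])

lemma sp_shape [simp]:
  "well_formed ar (sp m n \<theta>)" "src ar (sp m n \<theta>) = m" "tgt ar (sp m n \<theta>) = n"
  using sp_diags[of m n \<theta>] by (simp_all add: diags_def)

lemma merge_shape [simp]:
  "well_formed ar (merge \<iota> x m)" "src ar (merge \<iota> x m) = m" "tgt ar (merge \<iota> x m) = 1"
  using merge_diags[of ar \<iota> x m, OF ar_node] by (simp_all add: diags_def)

lemma split_shape [simp]:
  "well_formed ar (split \<iota> x m)" "src ar (split \<iota> x m) = 1" "tgt ar (split \<iota> x m) = m"
  using split_diags[of ar \<iota> x m, OF ar_node] by (simp_all add: diags_def)

text \<open>
  Fusion as a rewrite rule on words: all parameters of the result are determined by the positions.
  The second node of the word may extend beyond the first to the right (\<open>fuse\<close>) or to the left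
  (\<open>fuse_op\<close>); or all inputs of the second are outputs of the first (\<open>fuse_inner\<close>), or conversely
  (\<open>fuse_inner_op\<close>).
\<close>

lemma fuse:
  assumes "i \<le> j" "j < i + s" "i + s \<le> j + t" "p + (i + s) = j + t + q"
  shows "layer i (sp m s \<alpha>) p \<odot> layer j (sp t n \<beta>) q =
    layer i (sp (m + (j + t - (i + s))) (j - i + n) (\<alpha> + \<beta>)) q"
proof -
  define k where "k = i + s - j"
  define d where "d = j - i"
  define e where "e = j + t - (i + s)"
  have eq: "s = d + k" "t = k + e" "p = e + q" "j = i + d" "1 \<le> k"
    using assms by (auto simp: k_def d_def e_def)
  have "(sp m (d + k) \<alpha> \<otimes> Ids e) \<Zsemi> (Ids d \<otimes> sp (k + e) n \<beta>) \<approx> sp (m + e) (d + n) (\<alpha> + \<beta>)"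
    by (rule rules[OF spider_rule.fusion[OF eq(5)]])
  from layer_cong[OF this, of i q] show ?thesis
    by (simp add: layer_Seq layer_shift layer_pad eq add.assoc)
qed

lemma fuse_op:
  assumes "i \<le> j" "j < i + t" "i + t \<le> j + s" "j + s + q = i + t + p"
  shows "layer j (sp m s \<beta>) q \<odot> layer i (sp t n \<alpha>) p =
    layer i (sp (j - i + m) (n + (j + s - (i + t))) (\<alpha> + \<beta>)) q"
proof -
  define k where "k = i + t - j"
  define d where "d = j - i"
  define e where "e = j + s - (i + t)"
  have eq: "t = d + k" "s = k + e" "p = e + q" "j = i + d" "1 \<le> k"
    using assms by (auto simp: k_def d_def e_def)
  have "(Ids d \<otimes> sp m (k + e) \<beta>) \<Zsemi> (sp (d + k) n \<alpha> \<otimes> Ids e) \<approx> sp (d + m) (n + e) (\<alpha> + \<beta>)"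
    by (rule fusion_dag[OF eq(5)])
  from layer_cong[OF this, of i q] show ?thesis
    by (simp add: layer_Seq layer_shift layer_pad eq add.assoc)
qed

lemma fuse_inner:
  assumes "i \<le> j" "1 \<le> t" "j + t \<le> i + s" "q + j + t = i + s + p"
  shows "layer i (sp m s \<alpha>) p \<odot> layer j (sp t n \<beta>) q = layer i (sp m (s - t + n) (\<alpha> + \<beta>)) p"
proof -
  define d where "d = j - i"
  define e where "e = i + s - (j + t)"
  have eq: "s = d + (t + e)" "j = i + d" "q = e + p"
    using assms by (auto simp: d_def e_def)
  have "layer i (sp m s \<alpha>) p = layer i (sp m (d + 1) \<alpha>) p \<odot> layer j (sp 1 (t + e) 0) p"
    by (subst fuse) (auto simp: eq)
  then have "layer i (sp m s \<alpha>) p \<odot> layer j (sp t n \<beta>) q =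
      layer i (sp m (d + 1) \<alpha>) p \<odot> (layer j (sp 1 (t + e) 0) p \<odot> layer j (sp t n \<beta>) q)"
    by (simp only: comp_assoc)
  also have "layer j (sp 1 (t + e) 0) p \<odot> layer j (sp t n \<beta>) q = layer j (sp 1 (n + e) \<beta>) p"
    using assms(2) by (subst fuse_op) (auto simp: eq)
  also have "layer i (sp m (d + 1) \<alpha>) p \<odot> layer j (sp 1 (n + e) \<beta>) p = layer i (sp m (s - t + n) (\<alpha> + \<beta>)) p"
    by (subst fuse) (auto simp: eq ac_simps)
  finally show ?thesis .
qed

lemma fuse_inner_op:
  assumes "i \<le> j" "1 \<le> s" "j + s \<le> i + t" "q + j + s = i + t + p"
  shows "layer j (sp m s \<beta>) q \<odot> layer i (sp t n \<alpha>) p = layer i (sp (t - s + m) n (\<alpha> + \<beta>)) p"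
proof -
  define d where "d = j - i"
  define e where "e = i + t - (j + s)"
  have eq: "t = d + (s + e)" "j = i + d" "q = e + p"
    using assms by (auto simp: d_def e_def)
  have "layer i (sp t n \<alpha>) p = layer j (sp (s + e) 1 0) p \<odot> layer i (sp (d + 1) n \<alpha>) p"
    by (subst fuse_op) (auto simp: eq)
  then have "layer j (sp m s \<beta>) q \<odot> layer i (sp t n \<alpha>) p =
      (layer j (sp m s \<beta>) q \<odot> layer j (sp (s + e) 1 0) p) \<odot> layer i (sp (d + 1) n \<alpha>) p"
    by (simp only: comp_assoc)
  also have "layer j (sp m s \<beta>) q \<odot> layer j (sp (s + e) 1 0) p = layer j (sp (m + e) 1 \<beta>) p"
    using assms(2) by (subst fuse) (auto simp: eq)
  also have "layer j (sp (m + e) 1 \<beta>) p \<odot> layer i (sp (d + 1) n \<alpha>) p = layer i (sp (t - s + m) n (\<alpha> + \<beta>)) p"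
    by (subst fuse_op) (auto simp: eq ac_simps)
  finally show ?thesis .
qed

lemmas fuse_rules = fuse fuse_op fuse_inner fuse_inner_op

lemma fuse_comp:
  assumes "X \<odot> Y = W" shows "X \<odot> (Y \<odot> Z) = W \<odot> Z"
  using assms by (simp add: comp_assoc[symmetric])

lemmas fuse_rules_comp = fuse_rules[THEN fuse_comp]

lemma sp_1_1_0: "sp 1 1 0 \<approx> wire"
proof -
  have "sp 1 1 0 \<approx> merge \<iota> x 1 \<Zsemi> split \<iota> x 1" by (rule rules[OF spider_rule.no_phase])
  from layer_cong[OF this, of 0 0] show ?thesis
    by (intro equivI) (simp_all add: layer_words)
qed

lemma sp_no_phase: "layer k (sp m n 0) q = layer k (merge \<iota> x m) q \<odot> layer k (split \<iota> x n) q"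
  using layer_cong[OF rules[OF spider_rule.no_phase], of k m n q] by (simp add: layer_Seq)

lemma node_eq_spider:
  assumes "set_node v = {x}"
  shows "Box (\<iota> v) \<approx> sp (fst (node_ar v)) (snd (node_ar v)) (node_phase v)"
proof (rule equivI)
  show "layer 0 (Box (\<iota> v)) 0 = layer 0 (sp (fst (node_ar v)) (snd (node_ar v)) (node_phase v)) 0"
  proof (cases v)
    case (Phase y \<theta>)
    with assms show ?thesis by (simp add: spider_def layer_words ar_node)
  qed (use assms in \<open>simp_all add: sp_no_phase layer_words ar_node\<close>)
qed (simp_all add: ar_node)

text \<open>
  Phase gates on the legs are absorbed one leg at a time; the extra \<open>j\<close> legs without gates make the
  induction on \<open>m\<close> go through.
\<close>

lemma sp_phase_in:
  "layer k (tensor_power (sp 1 1 \<alpha>) m) (j + q) \<odot> layer k (sp (m + j) n \<theta>) q =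
    layer k (sp (m + j) n (\<theta> + of_nat m * \<alpha>)) q"
proof (induction m arbitrary: j \<theta>)
  case 0 show ?case by (simp add: layer_words)
next
  case (Suc m)
  have "layer k (tensor_power (sp 1 1 \<alpha>) (Suc m)) (j + q) \<odot> layer k (sp (Suc m + j) n \<theta>) q =
     layer k (tensor_power (sp 1 1 \<alpha>) m) (Suc j + q) \<odot>
      (layer (k + m) (sp 1 1 \<alpha>) (j + q) \<odot> layer k (sp (Suc m + j) n \<theta>) q)"
    by (simp add: layer_words plus_1_eq_Suc)
  also have "layer (k + m) (sp 1 1 \<alpha>) (j + q) \<odot> layer k (sp (Suc m + j) n \<theta>) q =
      layer k (sp (m + Suc j) n (\<theta> + \<alpha>)) q"
    by (subst fuse_inner_op) (auto simp: Suc_eq_plus1 add.assoc)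
  finally show ?case by (simp only: Suc) (simp add: algebra_simps)
qed

lemma sp_phase_out:
  "layer k (sp m (n + j) \<theta>) q \<odot> layer k (tensor_power (sp 1 1 \<alpha>) n) (j + q) =
    layer k (sp m (n + j) (\<theta> + of_nat n * \<alpha>)) q"
proof (induction n arbitrary: j \<theta>)
  case 0 show ?case by (simp add: layer_words)
next
  case (Suc n)
  have "layer k (tensor_power (sp 1 1 \<alpha>) (Suc n)) (j + q) =
     layer (k + n) (sp 1 1 \<alpha>) (j + q) \<odot> layer k (tensor_power (sp 1 1 \<alpha>) n) (Suc j + q)"
    by (simp add: layer_Par(2) plus_1_eq_Suc)
  then have "layer k (sp m (Suc n + j) \<theta>) q \<odot> layer k (tensor_power (sp 1 1 \<alpha>) (Suc n)) (j + q) =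
    (layer k (sp m (Suc n + j) \<theta>) q \<odot> layer (k + n) (sp 1 1 \<alpha>) (j + q)) \<odot>
      layer k (tensor_power (sp 1 1 \<alpha>) n) (Suc j + q)"
    by (simp only: comp_assoc)
  also have "layer k (sp m (Suc n + j) \<theta>) q \<odot> layer (k + n) (sp 1 1 \<alpha>) (j + q) =
      layer k (sp m (n + Suc j) (\<theta> + \<alpha>)) q"
    by (subst fuse_inner) (auto simp: Suc_eq_plus1 add.assoc)
  finally show ?case by (simp only: Suc) (simp add: algebra_simps)
qed

lemma sp_leg_phases:
  "tensor_power (sp 1 1 \<alpha>) m \<Zsemi> sp m n \<theta> \<Zsemi> tensor_power (sp 1 1 \<beta>) n \<approx>
    sp m n (of_nat m * \<alpha> + \<theta> + of_nat n * \<beta>)"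
  using sp_phase_in[of 0 \<alpha> m 0 0 n \<theta>] sp_phase_out[of 0 m n 0 "\<theta> + of_nat m * \<alpha>" 0 \<beta>]
  by (intro equivI) (simp_all add: layer_Seq comp_assoc[symmetric] add.commute)

lemma crossing_sp: "layer k crossing q \<odot> layer k (sp 2 n \<theta>) q = layer k (sp 2 n \<theta>) q"
proof -
  have m: "Box (\<iota> (Mult x)) \<approx> sp 2 1 0" using node_eq_spider[of "Mult x"] by simp
  have "crossing \<Zsemi> Box (\<iota> (Mult x)) \<approx> Box (\<iota> (Mult x))" by (rule rules[OF spider_rule.mult_legs])
  from layer_cong[OF this, of k q]
  have c: "layer k crossing q \<odot> layer k (sp 2 1 0) q = layer k (sp 2 1 0) q"
    by (simp add: layer_Seq layer_cong[OF m])
  have "layer k (sp 2 n \<theta>) q = layer k (sp 2 1 0) q \<odot> layer k (sp 1 n \<theta>) q"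
    by (subst fuse) auto
  then show ?thesis by (simp add: comp_assoc[symmetric] c)
qed

lemma sp_crossing: "layer k (sp m 2 \<theta>) q \<odot> layer k crossing q = layer k (sp m 2 \<theta>) q"
proof -
  have m: "Box (\<iota> (Comult x)) \<approx> sp 1 2 0" using node_eq_spider[of "Comult x"] by simp
  have "Box (\<iota> (Comult x)) \<Zsemi> crossing \<approx> Box (\<iota> (Comult x))" by (rule rules[OF spider_rule.comult_legs])
  from layer_cong[OF this, of k q]
  have c: "layer k (sp 1 2 0) q \<odot> layer k crossing q = layer k (sp 1 2 0) q"
    by (simp add: layer_Seq layer_cong[OF m])
  have "layer k (sp m 2 \<theta>) q = layer k (sp m 1 \<theta>) q \<odot> layer k (sp 1 2 0) q"
    by (simp add: fuse)
  then show ?thesis by (simp add: comp_assoc c)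
qed

text \<open>
  Recolouring the generators is the simplest translation into a spider family.  A translation that
  agrees with it up to gates on the legs sends whole spiders to conjugated spiders, and one that
  agrees with it without gates respects all spider rules.  The map \<open>\<rho>\<close> is the recolouring, extended to the
  remaining generators in any well-typed way.
\<close>

lemma recoloured_node:
  assumes "set_node v = {y}"
  shows "Box (\<iota> (map_node (\<lambda>_. x) v)) \<approx> sp (fst (node_ar v)) (snd (node_ar v)) (node_phase v)"
proof -
  have "set_node (map_node (\<lambda>_. x) v) = {x}" using assms by (simp add: node.set_map)
  from node_eq_spider[OF this] show ?thesis by (cases v) simp_all
qed

lemma extend_spider_conjugate:
  fixes \<phi> :: "'h \<Rightarrow> 'g diag" and \<iota>' :: "'d node \<Rightarrow> 'h"
  assumes u: "u \<in> diags ar 1 1" and w: "w \<in> diags ar 1 1"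
    and uw: "u \<Zsemi> w \<approx> wire" and wu: "w \<Zsemi> u \<approx> wire"
    and ar': "\<And>v. ar' (\<iota>' v) = node_ar v"
    and \<rho>: "\<And>v. \<rho> (\<iota>' v) = \<iota> (map_node (\<lambda>_. x) v)" and ar_\<rho>: "\<And>g. ar (\<rho> g) = ar' g"
    and gens: "\<And>v. set_node v = {y} \<Longrightarrow> \<phi> (\<iota>' v) \<approx> tensor_power u (fst (node_ar v)) \<Zsemi>
      sp (fst (node_ar v)) (snd (node_ar v)) (node_phase v) \<Zsemi> tensor_power w (snd (node_ar v))"
  shows "extend \<phi> (spider \<iota>' y m n \<theta>) \<approx> tensor_power u m \<Zsemi> sp m n \<theta> \<Zsemi> tensor_power w n"
proof -
  have "extend \<phi> (spider \<iota>' y m n \<theta>) \<approx>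
    tensor_power u m \<Zsemi> extend (\<lambda>g. Box (\<rho> g)) (spider \<iota>' y m n \<theta>) \<Zsemi> tensor_power w n"
  proof (rule extend_conjugate[OF u w uw wu])
    show "Box (\<rho> g) \<in> diags ar (fst (ar' g)) (snd (ar' g))" for g
      by (simp add: diags_def ar_\<rho>)
    show "spider \<iota>' y m n \<theta> \<in> diags ar' m n" by (rule spider_diags[of ar' \<iota>', OF ar'])
    fix g assume "g \<in> set_diag (spider \<iota>' y m n \<theta>)"
    then obtain v where g: "g = \<iota>' v" and v: "set_node v = {y}"
      using set_diag_spider(3)[of g \<iota>'] by blast
    have "tensor_power u (fst (node_ar v)) \<Zsemi> sp (fst (node_ar v)) (snd (node_ar v)) (node_phase v)
        \<Zsemi> tensor_power w (snd (node_ar v)) \<approx>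
      tensor_power u (fst (node_ar v)) \<Zsemi> Box (\<rho> (\<iota>' v)) \<Zsemi> tensor_power w (snd (node_ar v))"
      unfolding \<rho> by (rule equiv_in_context[OF eqv.symm[OF recoloured_node[OF v]]])
        (use u w in \<open>simp add: diags_def\<close>)
    from eqv.trans[OF gens[OF v] this]
    show "\<phi> g \<approx> tensor_power u (fst (ar' g)) \<Zsemi> Box (\<rho> g) \<Zsemi> tensor_power w (snd (ar' g))"
      by (simp add: g ar')
  qed
  then show ?thesis
    by (simp only: extend_Box_map map_spider(3)[of \<rho> \<iota>' \<iota> "\<lambda>_. x", OF \<rho>])
qed

lemma extend_spider_rule:
  fixes \<phi> :: "'h \<Rightarrow> 'g diag" and \<iota>' :: "'d node \<Rightarrow> 'h"
  assumes ar': "\<And>v. ar' (\<iota>' v) = node_ar v"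
    and \<rho>: "\<And>v. \<rho> (\<iota>' v) = \<iota> (map_node (\<lambda>_. x) v)" and ar_\<rho>: "\<And>g. ar (\<rho> g) = ar' g"
    and gens: "\<And>v. set_node v = {y} \<Longrightarrow>
      \<phi> (\<iota>' v) = sp (fst (node_ar v)) (snd (node_ar v)) (node_phase v)"
    and rule: "spider_rule \<iota>' y a b"
  shows "extend \<phi> a \<approx> extend \<phi> b"
proof -
  have *: "extend \<phi> d \<approx> map_diag \<rho> d"
    if d: "d \<in> diags ar' m n" and sub: "set_diag d \<subseteq> set_diag a \<union> set_diag b" for d m n
    unfolding extend_Box_map[symmetric]
  proof (rule extend_cong[OF _ _ d])
    show "Box (\<rho> g) \<in> diags ar (fst (ar' g)) (snd (ar' g))" for g
      by (simp add: diags_def ar_\<rho>)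
    fix g assume "g \<in> set_diag d"
    then obtain v where g: "g = \<iota>' v" and v: "set_node v = {y}"
      using sub set_diag_spider_rule[OF rule, of g] by auto
    show "\<phi> g \<approx> Box (\<rho> g)"
      unfolding g \<rho> gens[OF v] by (rule eqv.symm[OF recoloured_node[OF v]])
  qed
  obtain m n where ab: "a \<in> diags ar' m n" "b \<in> diags ar' m n"
    using spider_rule_diags[of ar' \<iota>', OF ar' rule] by blast
  have "spider_rule \<iota> x (map_diag \<rho> a) (map_diag \<rho> b)"
    by (rule map_spider_rule[of \<rho> \<iota>' \<iota> "\<lambda>_. x", OF \<rho> rule])
  then have "map_diag \<rho> a \<approx> map_diag \<rho> b" by (rule rules)
  from eqv.trans[OF *[OF ab(1)] eqv.trans[OF this eqv.symm[OF *[OF ab(2)]]]]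
  show ?thesis by simp
qed

end

lemma (in presentation) dag_spider:
  assumes "\<And>v. ar (\<iota> v) = node_ar v" and "\<And>v. \<delta> (\<iota> v) = \<iota> (node_dag v)"
  shows "dag \<delta> (spider \<iota> x m n \<theta>) \<approx> spider \<iota> x n m (- \<theta>)"
proof (rule equivI)
  have "spider \<iota> x n m (- \<theta>) \<in> diags ar n m" by (rule spider_diags[of ar \<iota>, OF assms(1)])
  then show "well_formed ar (spider \<iota> x n m (- \<theta>))" "well_formed ar (dag \<delta> (spider \<iota> x m n \<theta>))"
    by (auto simp: diags_def spider_def dag_merge_split[of \<delta> \<iota>, OF assms(2)] assms)
  show "layer 0 (dag \<delta> (spider \<iota> x m n \<theta>)) 0 = layer 0 (spider \<iota> x n m (- \<theta>)) 0"
    by (simp add: spider_def dag_merge_split[of \<delta> \<iota>, OF assms(2)] assms(2) layer_Seq comp_assoc)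
qed

lemma (in presentation) spidersI:
  assumes ar: "\<And>v. ar (\<iota> v) = node_ar v" and dag: "\<And>v. \<delta> (\<iota> v) = \<iota> (node_dag v)"
    and rel: "\<And>a b. spider_rule \<iota> x a b \<Longrightarrow> a \<approx> b"
    and rel_dag: "\<And>a b. spider_rule \<iota> x a b \<Longrightarrow> dag \<delta> a \<approx> dag \<delta> b"
  shows "spiders ar rel \<iota> x"
proof
  fix k n n' m' m \<alpha> \<beta> assume k: "1 \<le> (k::nat)"
  note ds = dag_spider[of \<iota> \<delta>, OF ar dag]
  have shape: "well_formed ar (spider \<iota> x m n \<theta>)" "src ar (spider \<iota> x m n \<theta>) = m" "tgt ar (spider \<iota> x m n \<theta>) = n" for m n \<theta>
    using spider_diags[of ar \<iota> x, OF ar] by (simp_all add: diags_def)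
  have shape': "src ar (dag \<delta> (spider \<iota> x m n \<theta>)) = n" "tgt ar (dag \<delta> (spider \<iota> x m n \<theta>)) = m" for m n \<theta>
    using equiv_typed[OF ds] by (simp_all add: shape)
  have "layer 0 ((Ids n \<otimes> spider \<iota> x n' (k + m') \<beta>) \<Zsemi> (spider \<iota> x (n + k) m \<alpha> \<otimes> Ids m')) 0 =
    layer 0 (dag \<delta> ((spider \<iota> x m (n + k) (- \<alpha>) \<otimes> Ids m') \<Zsemi> (Ids n \<otimes> spider \<iota> x (k + m') n' (- \<beta>)))) 0"
    by (simp add: layer_words layer_cong[OF ds] shape shape' )
  also have "\<dots> = layer 0 (dag \<delta> (spider \<iota> x (m + m') (n + n') (- \<alpha> + - \<beta>))) 0"
    by (rule layer_cong[OF rel_dag[OF spider_rule.fusion[OF k]]])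
  also have "\<dots> = layer 0 (spider \<iota> x (n + n') (m + m') (\<alpha> + \<beta>)) 0"
    by (subst layer_cong[OF ds]) (simp add: add.commute)
  finally show "(Ids n \<otimes> spider \<iota> x n' (k + m') \<beta>) \<Zsemi> (spider \<iota> x (n + k) m \<alpha> \<otimes> Ids m') \<approx> spider \<iota> x (n + n') (m + m') (\<alpha> + \<beta>)"
    by (rule equivI[rotated 2]) (simp_all add: shape)
qed (fact assms)+

section \<open>The trichromatic phase group\<close>

lemma phase_arith [simp]:
  "(4::phase) = 0" "(5::phase) = 1" "(6::phase) = 2" "(7::phase) = 3"
  "- (1::phase) = 3" "- (2::phase) = 2" "- (3::phase) = 1"
  by simp_all

lemma phase_cases: "(\<theta>::4) = 0 \<or> \<theta> = 1 \<or> \<theta> = 2 \<or> \<theta> = 3"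
proof (cases \<theta>)
  case (of_int z)
  then have "z = 0 \<or> z = 1 \<or> z = 2 \<or> z = 3" by auto
  with of_int show ?thesis by auto
qed

lemma of_nat_times_3: "of_nat n * (3::phase) = - of_nat n"
proof -
  have "of_nat n * (3::phase) = of_nat n * - 1" by simp
  then show ?thesis by (simp only: mult_minus1_right)
qed

lemma cyc_shape [simp]:
  "well_formed node_ar cyc" "src node_ar cyc = 1" "tgt node_ar cyc = 1"
  "well_formed node_ar cyc_bar" "src node_ar cyc_bar = 1" "tgt node_ar cyc_bar = 1"
  using cyc_diags by (simp_all add: diags_def)

abbreviation rgb_eq (infix "\<simeq>" 50) where "a \<simeq> b \<equiv> eqv node_ar rgb_rel a b"

abbreviation "rot \<equiv> map_diag (map_node rotate_colour)"

interpretation RGB: presentation node_ar rgb_rel .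

abbreviation rgb_comp (infixr "\<bullet>" 60) where "X \<bullet> Y \<equiv> RGB.class_comp X Y"

abbreviation layer where "layer \<equiv> RGB.layer"

lemma src_tgt_dag [simp]:
  "src node_ar (dag node_dag d) = tgt node_ar d" "tgt node_ar (dag node_dag d) = src node_ar d"
  by (induction d) (auto simp: node_ar_dag)

lemma well_formed_node_dag [simp]: "well_formed node_ar (dag node_dag d) = well_formed node_ar d"
  by (induction d) auto

lemma rgb_base: "rgb_rel a b \<Longrightarrow> a \<simeq> b"
  using rgb_rel_diags[of a b] by (auto intro: eqv.base)

lemma rgb_dag: "a \<simeq> b \<Longrightarrow> dag node_dag a \<simeq> dag node_dag b"
  by (rule RGB.dag_equiv) (auto simp: node_ar_dag intro: rgb_base rgb_rel.dagger)

lemma rgb_rotate: "a \<simeq> b \<Longrightarrow> rot a \<simeq> rot b"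
  using RGB.extend_equiv[where \<phi> = "\<lambda>v. Box (map_node rotate_colour v)" and ar' = node_ar and rel' = rgb_rel]
  by (simp add: extend_Box_map diags_def node_ar_map rgb_base rgb_rel.rotate)

lemma rot_tri: "rot (tri x m n \<theta>) = tri (rotate_colour x) m n \<theta>"
  by (rule map_spider(3)) simp

lemma rotate_spider_rule: "spider_rule (\<lambda>v. v) x a b \<Longrightarrow> spider_rule (\<lambda>v. v) (rotate_colour x) (rot a) (rot b)"
  by (rule map_spider_rule) simp

lemma rot_cubed: "rot (rot (rot d)) = d"
proof -
  have "map_node (\<lambda>x. rotate_colour (rotate_colour (rotate_colour x))) v = v" for v
  proof -
    have "rotate_colour (rotate_colour (rotate_colour x)) = x" for x by (cases x) simp_all
    then show ?thesis by (simp add: node.map_ident)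
  qed
  then show ?thesis by (simp add: diag.map_comp node.map_comp o_def diag.map_ident)
qed

lemma rgb_spiders: "spider_rule (\<lambda>v. v) x a b \<Longrightarrow> rgb_rel a b"
proof (cases x)
  case R
  assume "spider_rule (\<lambda>v. v) x a b"
  from rotate_spider_rule[OF this] R have "rgb_rel (rot a) (rot b)" by (simp add: rgb_rel.spiders)
  then have "rgb_rel (rot (rot (rot a))) (rot (rot (rot b)))" by (rule rgb_rel.rotate[OF rgb_rel.rotate])
  then show ?thesis by (simp only: rot_cubed)
next
  case B
  assume "spider_rule (\<lambda>v. v) x a b"
  from rotate_spider_rule[OF rotate_spider_rule[OF this]] B have "rgb_rel (rot (rot a)) (rot (rot b))"
    by (simp add: rgb_rel.spiders)
  then have "rgb_rel (rot (rot (rot a))) (rot (rot (rot b)))" by (rule rgb_rel.rotate)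
  then show ?thesis by (simp only: rot_cubed)
qed (simp add: rgb_rel.spiders)

interpretation tri: spiders node_ar rgb_rel "\<lambda>v. v" x for x
  by (rule RGB.spidersI[where \<delta> = node_dag]) (auto intro: rgb_base rgb_spiders rgb_rel.dagger)

lemma dag_tri: "dag node_dag (tri x m n \<theta>) \<simeq> tri x n m (- \<theta>)"
  by (rule RGB.dag_spider) simp_all

lemmas layer_dag_tri = RGB.layer_cong[OF dag_tri]

lemmas layer_wire = RGB.layer_cong[OF tri.sp_1_1_0]

lemmas rgb_words = RGB.layer_words tri.fuse_rules tri.fuse_rules_comp layer_wire

lemmas exchange = RGB.layer_exchange RGB.layer_exchange_comp

abbreviation "P x \<theta> \<equiv> RGB.layer 0 (tri x 1 1 \<theta>) 0"

lemma P_comp: "RGB.class_comp (P x \<alpha>) (P x \<beta>) = P x (\<alpha> + \<beta>)"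
  "RGB.class_comp (P x \<alpha>) (RGB.class_comp (P x \<beta>) Z) = RGB.class_comp (P x (\<alpha> + \<beta>)) Z"
  by (simp_all add: rgb_words)

lemma P_0: "P x 0 = RGB.idc 1" by (simp add: rgb_words)

lemma P_id: "RGB.class_comp (P x \<alpha>) (RGB.idc 1) = P x \<alpha>" "RGB.class_comp (RGB.idc 1) (P x \<alpha>) = P x \<alpha>"
  "RGB.class_comp (P x \<alpha>) (RGB.class_comp (RGB.idc 1) Z) = RGB.class_comp (P x \<alpha>) Z" 
  "RGB.class_comp (RGB.idc 1) (RGB.class_comp (P x \<alpha>) Z) = RGB.class_comp (P x \<alpha>) Z"
  by (simp_all add: rgb_words)

lemmas P_rules = P_comp P_0 P_id RGB.comp_assoc

text \<open>
  The three expressions for \<open>c\<close>.  Eliminating blue gives the braid relation for green and red, and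
  the colour change of an identity wire gives \<open>c\<^sup>3 = 1\<close>.
\<close>

lemma P_colours: "P G 1 \<bullet> P B 1 = P R 1 \<bullet> P G 1" "P G 1 \<bullet> P B 1 = P B 1 \<bullet> P R 1"
  using RGB.layer_cong[OF rgb_base[OF rgb_rel.cyc_RG], of 0 0] RGB.layer_cong[OF rgb_base[OF rgb_rel.cyc_BR], of 0 0]
  by (simp_all add: cyc_def RGB.layer_Seq)

lemma layer_cyc: "RGB.layer 0 cyc 0 = P R 1 \<bullet> P G 1"
  by (simp add: cyc_def RGB.layer_Seq P_colours(1))

lemma P_braid: "P G 1 \<bullet> P R 1 \<bullet> P G 1 = P R 1 \<bullet> P G 1 \<bullet> P R 1"
  by (metis P_colours RGB.comp_assoc)

lemma P_cube: "P R 1 \<bullet> P G 1 \<bullet> P R 1 \<bullet> P G 1 \<bullet> P R 1 \<bullet> P G 1 = RGB.idc 1"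
proof -
  have "tri G 1 1 0 \<simeq> tensor_power cyc 1 \<Zsemi> tri R 1 1 0 \<Zsemi> tensor_power cyc_bar 1"
    by (rule rgb_base[OF rgb_rel.change_R])
  from RGB.layer_cong[OF this, of 0 0] show ?thesis
    by (simp add: P_0 cyc_bar_def layer_cyc RGB.layer_words P_id)
qed

lemma layer_cyc_bar: "layer 0 cyc_bar 0 = P G 3 \<bullet> P R 3"
proof -
  have "(P R 1 \<bullet> P G 1 \<bullet> P R 1 \<bullet> P G 1 \<bullet> P R 1 \<bullet> P G 1) \<bullet> P G 3 \<bullet> P R 3 = P G 3 \<bullet> P R 3"
    by (simp only: P_cube P_id)
  then show ?thesis by (simp add: cyc_bar_def RGB.layer_Seq layer_cyc P_rules)
qed

lemma cyc_inverse: "cyc \<Zsemi> cyc_bar \<simeq> wire" "cyc_bar \<Zsemi> cyc \<simeq> wire"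
  by (rule RGB.equivI; (use cyc_diags in \<open>simp add: diags_def cyc_bar_def RGB.layer_Seq layer_cyc P_cube RGB.comp_assoc RGB.layer_Ids\<close>))+

text \<open>
  The image of \<open>H\<close>.  Its square is \<open>(grg)(rgr) = (gr)\<^sup>3 = 1\<close>, and \<open>H = rgr\<close> gives \<open>c = rg = H r\<^sup>3\<close>.
\<close>

abbreviation euler_had :: "rgb_gen diag" where "euler_had \<equiv> tri G 1 1 1 \<Zsemi> tri R 1 1 1 \<Zsemi> tri G 1 1 1"

lemma layer_euler_had: "RGB.layer 0 euler_had 0 = P R 1 \<bullet> P G 1 \<bullet> P R 1"
  by (simp add: RGB.layer_Seq RGB.comp_assoc P_braid)

lemma euler_had_involution: "euler_had \<Zsemi> euler_had \<simeq> wire"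
proof (rule RGB.equivI)
  have "RGB.layer 0 (euler_had \<Zsemi> euler_had) 0 = (P R 1 \<bullet> P G 1 \<bullet> P R 1) \<bullet> (P G 1 \<bullet> P R 1 \<bullet> P G 1)"
    by (subst RGB.layer_Seq, subst (1) layer_euler_had) (simp add: RGB.layer_Seq RGB.comp_assoc)
  then show "RGB.layer 0 (euler_had \<Zsemi> euler_had) 0 = RGB.layer 0 wire 0"
    by (simp add: RGB.comp_assoc P_cube RGB.layer_Ids)
qed simp_all

lemma layer_had_had: "layer k (euler_had \<Zsemi> euler_had) q = RGB.idc (k + 1 + q)"
  by (simp only: RGB.layer_cong[OF euler_had_involution] RGB.layer_Ids)

lemma euler_had_R3: "euler_had \<Zsemi> tri R 1 1 3 \<simeq> cyc"
  by (rule RGB.equivI) (use cyc_diags in \<open>simp_all add: diags_def RGB.layer_Seq[of _ euler_had] layer_euler_had layer_cyc P_rules\<close>)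

lemma R1_euler_had: "tri R 1 1 1 \<Zsemi> euler_had \<simeq> cyc_bar"
  by (rule RGB.equivI) (use cyc_diags in \<open>simp_all add: diags_def cyc_bar_def RGB.layer_Seq layer_cyc P_rules\<close>)

text \<open>
  In the octahedral group generated by the quarter turns \<open>g\<close> and \<open>r\<close>, the half turn \<open>g\<^sup>2\<close> conjugates
  \<open>r\<close> to its inverse.  With \<open>h = grg\<close> one has \<open>g = r\<^sup>3hr\<^sup>3\<close> and \<open>g = hrh\<close>; squaring both and
  substituting \<open>g\<^sup>2 = hr\<^sup>2h\<close> gives \<open>g\<^sup>2 = r\<^sup>3g\<^sup>2r\<^sup>3\<close>.
\<close>

lemma G2_eq: "P G 2 = P R 3 \<bullet> P G 2 \<bullet> P R 3"
proof -
  have c: "P G 1 = P R 3 \<bullet> P G 1 \<bullet> P R 1 \<bullet> P G 1 \<bullet> P R 3"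
  proof -
    have "P R 3 \<bullet> (P G 1 \<bullet> P R 1 \<bullet> P G 1) \<bullet> P R 3 = P G 1"
      unfolding P_braid by (simp add: P_rules)
    then show ?thesis by (simp add: P_rules)
  qed
  have h: "(P G 1 \<bullet> P R 1 \<bullet> P G 1) \<bullet> P R 1 \<bullet> (P G 1 \<bullet> P R 1 \<bullet> P G 1) = P G 1"
  proof -
    have "(P G 1 \<bullet> P R 1 \<bullet> P G 1) \<bullet> P R 1 \<bullet> (P G 1 \<bullet> P R 1 \<bullet> P G 1) =
      P G 1 \<bullet> (P R 1 \<bullet> P G 1 \<bullet> P R 1 \<bullet> P G 1 \<bullet> P R 1 \<bullet> P G 1)"
      by (simp only: RGB.comp_assoc)
    then show ?thesis by (simp add: P_cube P_id)
  qed
  have hh: "(P G 1 \<bullet> P R 1 \<bullet> P G 1) \<bullet> (P G 1 \<bullet> P R 1 \<bullet> P G 1) = RGB.idc 1"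
    by (subst (1) P_braid) (simp only: RGB.comp_assoc P_cube)
  define h where "h = P G 1 \<bullet> P R 1 \<bullet> P G 1"
  have h': "h \<bullet> P R 1 \<bullet> h = P G 1" "h \<bullet> h = RGB.idc 1" "h \<bullet> h \<bullet> Z = RGB.idc 1 \<bullet> Z" for Z
    using h hh by (simp_all add: h_def RGB.comp_assoc[symmetric])
  have "P G 2 = P G 1 \<bullet> P G 1" by (simp add: P_rules)
  also have "\<dots> = (h \<bullet> P R 1 \<bullet> h) \<bullet> (h \<bullet> P R 1 \<bullet> h)" by (simp only: h')
  also have "\<dots> = h \<bullet> P R 2 \<bullet> h" by (simp only: RGB.comp_assoc h'(3) P_id P_comp one_add_one)
  finally have g2: "h \<bullet> P R 2 \<bullet> h = P G 2" by (rule sym)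
  have c': "P G 1 = P R 3 \<bullet> h \<bullet> P R 3" using c by (simp add: h_def RGB.comp_assoc)
  have "P G 2 = P G 1 \<bullet> P G 1" by (simp add: P_rules)
  also have "\<dots> = (P R 3 \<bullet> h \<bullet> P R 3) \<bullet> (P R 3 \<bullet> h \<bullet> P R 3)" by (simp only: c')
  also have "\<dots> = P R 3 \<bullet> (h \<bullet> P R 2 \<bullet> h) \<bullet> P R 3" by (simp add: P_rules)
  finally show ?thesis by (simp only: g2)
qed

lemma G2_R: "P G 2 \<bullet> P R \<theta> = P R (- \<theta>) \<bullet> P G 2"
proof -
  have 1: "P G 2 \<bullet> P R 1 = P R 3 \<bullet> P G 2"
    by (subst G2_eq) (simp add: P_rules)
  have 2: "P G 2 \<bullet> P R 2 = P R 2 \<bullet> P G 2"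
  proof -
    have "P G 2 \<bullet> P R 2 = (P G 2 \<bullet> P R 1) \<bullet> P R 1" by (simp add: P_rules)
    also have "\<dots> = P R 3 \<bullet> (P G 2 \<bullet> P R 1)" by (simp add: 1 RGB.comp_assoc)
    finally show ?thesis by (simp add: 1 P_rules)
  qed
  have 3: "P G 2 \<bullet> P R 3 = P R 1 \<bullet> P G 2"
  proof -
    have "P G 2 \<bullet> P R 3 = (P G 2 \<bullet> P R 2) \<bullet> P R 1" by (simp add: P_rules)
    also have "\<dots> = P R 2 \<bullet> (P G 2 \<bullet> P R 1)" by (simp add: 2 RGB.comp_assoc)
    finally show ?thesis by (simp add: 1 P_rules)
  qed
  show ?thesis using phase_cases[of \<theta>] 1 2 3 by (auto simp: P_rules)
qed

section \<open>Complementarity of green and red in \<open>RGB\<close>\<close>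

text \<open>
  Plugging the green unit into the other leg isolates the red state.
\<close>

lemma R_unit_eq_G: "tri R 0 1 0 \<simeq> tri G 0 1 1"
proof (rule RGB.equivI)
  have "layer 1 (tri R 0 1 0) 0 \<bullet> layer 0 (tri G 2 1 0) 0 = layer 0 (tri G 1 1 1) 0"
    using RGB.layer_cong[OF rgb_base[OF rgb_rel.phase_unit], of 0 0] by (simp add: RGB.layer_words)
  then have "layer 0 (tri G 0 1 0) 0 \<bullet> layer 1 (tri R 0 1 0) 0 \<bullet> layer 0 (tri G 2 1 0) 0 =
      layer 0 (tri G 0 1 0) 0 \<bullet> layer 0 (tri G 1 1 1) 0" by simp
  then show "layer 0 (tri R 0 1 0) 0 = layer 0 (tri G 0 1 1) 0"
    by (simp add: exchange rgb_words)
qed simp_all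

lemma G_unit_eq_B: "tri G 0 1 0 \<simeq> tri B 0 1 1"
  using rgb_rotate[OF R_unit_eq_G] by (simp add: rot_tri)

lemma B_unit_eq_R: "tri B 0 1 0 \<simeq> tri R 0 1 1"
  using rgb_rotate[OF G_unit_eq_B] by (simp add: rot_tri)

lemma copy_R_unit: "tri R 0 1 1 \<Zsemi> tri G 1 2 0 \<simeq> tri R 0 1 1 \<otimes> tri R 0 1 1"
  by (rule RGB.equivI)
    (use RGB.layer_cong[OF rgb_base[OF rgb_rel.copy], of 0 0] in
      \<open>simp_all add: RGB.layer_words RGB.layer_cong[OF B_unit_eq_R]\<close>)

lemma tri_eq_dag:
  assumes "tri x m n \<alpha> \<simeq> tri y m n \<beta>" shows "tri x n m (- \<alpha>) \<simeq> tri y n m (- \<beta>)"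
  using eqv.trans[OF eqv.symm[OF dag_tri] eqv.trans[OF rgb_dag[OF assms] dag_tri]] .

text \<open>
  The bending law says that the green cup, bent by a red cap, is a red phase gate; bending it back
  with a red cup leaves the green cup alone.
\<close>

lemma cup_GR: "tri G 0 2 0 \<simeq> tri R 0 2 2"
proof (rule RGB.equivI)
  have "layer 2 (tri G 0 2 0) 0 \<bullet> layer 1 (tri R 2 0 0) 1 = layer 1 (tri R 1 1 2) 0"
    using RGB.layer_cong[OF rgb_base[OF rgb_rel.bend_GR], of 1 0] by (simp add: RGB.layer_words)
  then have "layer 0 (tri R 0 2 0) 0 \<bullet> layer 2 (tri G 0 2 0) 0 \<bullet> layer 1 (tri R 2 0 0) 1 =
      layer 0 (tri R 0 2 0) 0 \<bullet> layer 1 (tri R 1 1 2) 0" by simp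
  then show "layer 0 (tri G 0 2 0) 0 = layer 0 (tri R 0 2 2) 0"
    by (simp add: exchange rgb_words)
qed simp_all

lemma cap_GR: "tri G 2 0 0 \<simeq> tri R 2 0 2"
  using tri_eq_dag[OF cup_GR] by simp

lemma absorb_G_unit: "tri G 0 1 0 \<Zsemi> tri R 1 2 1 \<simeq> tri G 0 1 0 \<otimes> tri G 0 1 0"
  by (rule RGB.equivI)
    (use RGB.layer_cong[OF rgb_dag[OF rgb_base[OF rgb_rel.cocopy]], of 0 0] in
      \<open>simp_all add: RGB.layer_words layer_dag_tri\<close>)

text \<open>
  Writing the red multiplication as the comultiplication with one leg bent by a cap turns copying
  of the green unit into deletion.
\<close>

lemma G_unit_R_mult: "(tri G 0 1 0 \<otimes> wire) \<Zsemi> tri R 2 1 3 \<simeq> tri G 1 0 0 \<Zsemi> tri G 0 1 0"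
proof (rule RGB.equivI)
  have "layer 0 (tri R 2 1 3) 0 = layer 0 (tri R 1 2 1) 1 \<bullet> layer 1 (tri R 2 0 2) 0"
    by (simp add: rgb_words)
  then have "layer 0 (tri G 0 1 0) 1 \<bullet> layer 0 (tri R 2 1 3) 0 =
      (layer 0 (tri G 0 1 0) 1 \<bullet> layer 0 (tri R 1 2 1) 1) \<bullet> layer 1 (tri G 2 0 0) 0"
    by (simp add: RGB.comp_assoc RGB.layer_cong[OF cap_GR])
  also have "layer 0 (tri G 0 1 0) 1 \<bullet> layer 0 (tri R 1 2 1) 1 =
      layer 0 (tri G 0 1 0) 1 \<bullet> layer 1 (tri G 0 1 0) 1"
    using RGB.layer_cong[OF absorb_G_unit, of 0 1] by (simp add: RGB.layer_words)
  finally show "layer 0 ((tri G 0 1 0 \<otimes> wire) \<Zsemi> tri R 2 1 3) 0 =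
      layer 0 (tri G 1 0 0 \<Zsemi> tri G 0 1 0) 0"
    by (simp add: exchange rgb_words)
qed simp_all

lemma bialgebra_layers: "layer 0 (tri G 1 2 0) 1 \<bullet> layer 2 (tri G 1 2 0) 0 \<bullet> layer 1 crossing 1 \<bullet>
    layer 0 (tri R 2 1 3) 2 \<bullet> layer 1 (tri R 2 1 3) 0 = layer 0 (tri R 2 1 3) 0 \<bullet> layer 0 (tri G 1 2 0) 0"
  using RGB.layer_cong[OF rgb_base[OF rgb_rel.bialgebra], of 0 0] by (simp add: RGB.layer_words)

text \<open>
  Close one input of the bialgebra law with the green unit and one output with the red counit.  On
  the square side, a green cup remains and a cap which is also green by \<open>cap_GR\<close>, and they
  straighten to a wire; on the other side the closed legs disconnect the diagram.  Phases of red nodes are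
  shifted by outputs minus inputs, as in the translation of the dichromatic red.
\<close>

lemma hopf: "tri G 1 2 0 \<Zsemi> tri R 2 1 3 \<simeq> tri G 1 0 0 \<Zsemi> tri R 0 1 1"
proof (rule RGB.equivI)
  let ?u = "layer 0 (tri G 0 1 0) 1" and ?e = "layer 0 (tri R 1 0 3) 1"
  have "?u \<bullet> (layer 0 (tri R 2 1 3) 0 \<bullet> layer 0 (tri G 1 2 0) 0) \<bullet> ?e =
      layer 0 (tri G 1 0 0 \<Zsemi> tri R 0 1 1) 0"
  proof -
    have "?u \<bullet> (layer 0 (tri R 2 1 3) 0 \<bullet> layer 0 (tri G 1 2 0) 0) \<bullet> ?e =
      (?u \<bullet> layer 0 (tri R 2 1 3) 0) \<bullet> layer 0 (tri G 1 2 0) 0 \<bullet> ?e" by (simp add: RGB.comp_assoc)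
    also have "?u \<bullet> layer 0 (tri R 2 1 3) 0 = layer 0 (tri G 1 0 0) 0 \<bullet> layer 0 (tri G 0 1 0) 0"
      using RGB.layer_cong[OF G_unit_R_mult, of 0 0] by (simp add: RGB.layer_words)
    also have "(layer 0 (tri G 1 0 0) 0 \<bullet> layer 0 (tri G 0 1 0) 0) \<bullet> layer 0 (tri G 1 2 0) 0 \<bullet> ?e =
       layer 0 (tri G 1 0 0) 0 \<bullet> layer 0 (tri G 0 2 0) 0 \<bullet> ?e"
      by (simp add: rgb_words)
    finally show ?thesis by (simp add: RGB.layer_cong[OF cup_GR] rgb_words)
  qed
  moreover have "?u \<bullet> (layer 0 (tri G 1 2 0) 1 \<bullet> layer 2 (tri G 1 2 0) 0 \<bullet> layer 1 crossing 1 \<bullet>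
    layer 0 (tri R 2 1 3) 2 \<bullet> layer 1 (tri R 2 1 3) 0) \<bullet> ?e = layer 0 (tri G 1 2 0 \<Zsemi> tri R 2 1 3) 0"
  proof -
    \<comment> \<open>the counit passes to the first of the two red nodes and makes it a cap\<close>
    have 1: "layer 1 (tri R 2 1 3) 0 \<bullet> ?e = layer 0 (tri R 1 0 3) 2 \<bullet> layer 0 (tri R 2 1 3) 0"
      by (subst RGB.layer_exchange) simp_all
    have 2: "layer 0 (tri R 2 1 3) 2 \<bullet> layer 0 (tri R 1 0 3) 2 \<bullet> Z = layer 0 (tri G 2 0 0) 2 \<bullet> Z" for Z
      by (simp add: RGB.layer_cong[OF cap_GR] rgb_words)
    \<comment> \<open>the unit makes the first green node a cup, which moves to the right of the second\<close>
    have 3: "?u \<bullet> layer 0 (tri G 1 2 0) 1 \<bullet> layer 2 (tri G 1 2 0) 0 \<bullet> Z =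
      layer 0 (tri G 1 2 0) 0 \<bullet> layer 0 (tri G 0 2 0) 2 \<bullet> Z" for Z
      by (simp add: RGB.comp_assoc[symmetric] tri.fuse_inner) (subst RGB.layer_exchange, simp_all add: rgb_words)
    \<comment> \<open>the crossing is pulled off the cup onto the cap, where it disappears, and the snake straightens\<close>
    have 4: "layer 0 (tri G 0 2 0) 2 \<bullet> layer 1 crossing 1 \<bullet> Z = layer 1 (tri G 0 2 0) 1 \<bullet> layer 0 crossing 2 \<bullet> Z" for Z
      using RGB.cup_slide[of "tri G 0 2 0" 0 1] by (simp add: RGB.comp_assoc[symmetric] tri_diags)
    have 5: "layer 0 crossing 2 \<bullet> layer 0 (tri G 2 0 0) 2 \<bullet> Z = layer 0 (tri G 2 0 0) 2 \<bullet> Z" for Z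
      by (simp add: RGB.comp_assoc[symmetric] tri.crossing_sp)
    have 6: "layer 1 (tri G 0 2 0) 1 \<bullet> layer 0 (tri G 2 0 0) 2 \<bullet> Z = RGB.idc 2 \<bullet> Z" for Z
      by (simp add: rgb_words)
    show ?thesis
      by (simp add: RGB.comp_assoc 1 2 3 4 5 6) (simp add: rgb_words)
  qed
  ultimately show "layer 0 (tri G 1 2 0 \<Zsemi> tri R 2 1 3) 0 = layer 0 (tri G 1 0 0 \<Zsemi> tri R 0 1 1) 0"
    by (simp only: bialgebra_layers)
qed simp_all

lemma hopf_dag: "tri R 1 2 1 \<Zsemi> tri G 2 1 0 \<simeq> tri R 1 0 3 \<Zsemi> tri G 0 1 0"
  by (rule RGB.equivI)
    (use RGB.layer_cong[OF rgb_dag[OF hopf], of 0 0] in \<open>simp_all add: RGB.layer_words layer_dag_tri\<close>)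

lemma R_phase_shift: "tri R m n (\<theta> + of_nat n - of_nat m) \<simeq>
    tensor_power (tri R 1 1 3) m \<Zsemi> tri R m n \<theta> \<Zsemi> tensor_power (tri R 1 1 1) n"
  using tri.sp_leg_phases[of R 3 m n \<theta> 1, THEN eqv.symm]
  by (simp add: of_nat_times_3 algebra_simps)

text \<open>
  Since \<open>c = H r\<^sup>3\<close>, the colour change by \<open>c\<close> is the one by \<open>H\<close> after shifting the red phase.
\<close>

lemma G_eq_conjugate_R: "tri G m n \<theta> \<simeq>
  tensor_power euler_had m \<Zsemi> tri R m n (\<theta> + of_nat n - of_nat m) \<Zsemi> tensor_power euler_had n"
proof -
  have h: "euler_had \<in> diags node_ar 1 1" by (simp add: diags_def)
  have "tri G m n \<theta> \<simeq> tensor_power cyc m \<Zsemi> tri R m n \<theta> \<Zsemi> tensor_power cyc_bar n"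
    by (rule rgb_base[OF rgb_rel.change_R])
  also have "\<dots> \<simeq> tensor_power euler_had m \<Zsemi> (tensor_power (tri R 1 1 3) m \<Zsemi> tri R m n \<theta> \<Zsemi>
      tensor_power (tri R 1 1 1) n) \<Zsemi> tensor_power euler_had n"
    by (rule eqv.symm[OF RGB.conjugate_conjugate[OF h tri_diags tri_diags h tri_diags
          euler_had_R3 R1_euler_had]])
  also have "\<dots> \<simeq> tensor_power euler_had m \<Zsemi> tri R m n (\<theta> + of_nat n - of_nat m) \<Zsemi>
      tensor_power euler_had n"
    by (rule RGB.equiv_in_context[OF eqv.symm[OF R_phase_shift]]) simp
  finally show ?thesis .
qed

text \<open>
  Both green gates are \<open>H\<close> up to red phases on either side.  The red phases fuse into the outer
  nodes, the two \<open>H\<close> gates turn the second red node green, and the Hopf law cuts the double edge.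
\<close>

lemma G_phases_disconnect:
  "tri R 1 2 1 \<Zsemi> (tri G 1 1 1 \<otimes> tri G 1 1 1) \<Zsemi> tri R 2 1 3 \<simeq> tri R 1 0 1 \<Zsemi> tri R 0 1 3"
proof (rule RGB.equivI)
  define H where "H = euler_had"
  have H [simp]: "well_formed node_ar H" "src node_ar H = 1" "tgt node_ar H = 1" by (simp_all add: H_def)
  have HH: "layer k H q \<bullet> layer k H q = RGB.idc (k + 1 + q)" for k q
    unfolding H_def RGB.layer_Seq[of k euler_had euler_had, symmetric] layer_had_had ..
  \<comment> \<open>the Euler decomposition, solved for the green gate\<close>
  have g: "tri G 1 1 1 \<simeq> tri R 1 1 3 \<Zsemi> H \<Zsemi> tri R 1 1 3"
  proof (rule RGB.equivI)
    have "layer 0 (tri R 1 1 3 \<Zsemi> H \<Zsemi> tri R 1 1 3) 0 =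
      P R 3 \<bullet> (P R 1 \<bullet> P G 1 \<bullet> P R 1) \<bullet> P R 3"
      unfolding H_def by (subst (1) RGB.layer_Seq, subst (1) RGB.layer_Seq) (simp add: layer_euler_had RGB.comp_assoc)
    then show "layer 0 (tri G 1 1 1) 0 = layer 0 (tri R 1 1 3 \<Zsemi> H \<Zsemi> tri R 1 1 3) 0"
      by (simp add: P_rules)
  qed simp_all
  \<comment> \<open>two \<open>H\<close> gates move from the inputs of the red node to its output and turn it green\<close>
  have m: "layer 0 H 1 \<bullet> layer 1 H 0 \<bullet> layer 0 (tri R 2 1 3) 0 \<bullet> Z = layer 0 (tri G 2 1 0) 0 \<bullet> layer 0 H 0 \<bullet> Z" for Z
  proof -
    have "layer 0 (tri G 2 1 0) 0 = layer 0 H 1 \<bullet> layer 1 H 0 \<bullet> layer 0 (tri R 2 1 3) 0 \<bullet> layer 0 H 0"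
      using RGB.layer_cong[OF G_eq_conjugate_R[of 2 1 0], of 0 0]
      unfolding H_def[symmetric] by (simp add: RGB.layer_words)
    then have "layer 0 (tri G 2 1 0) 0 \<bullet> layer 0 H 0 = layer 0 H 1 \<bullet> layer 1 H 0 \<bullet> layer 0 (tri R 2 1 3) 0"
      by (simp add: RGB.comp_assoc HH rgb_words)
    then show ?thesis by (simp only: RGB.comp_assoc[symmetric])
  qed
  have u: "layer 0 (tri G 0 1 0) 0 \<bullet> layer 0 H 0 \<bullet> Z = layer 0 (tri R 0 1 1) 0 \<bullet> Z" for Z
  proof -
    have "layer 0 (tri G 0 1 0) 0 = layer 0 (tri R 0 1 1) 0 \<bullet> layer 0 H 0"
      using RGB.layer_cong[OF G_eq_conjugate_R[of 0 1 0], of 0 0]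
      unfolding H_def[symmetric] by (simp add: RGB.layer_words)
    then have "layer 0 (tri G 0 1 0) 0 \<bullet> layer 0 H 0 = layer 0 (tri R 0 1 1) 0"
      by (simp add: RGB.comp_assoc HH rgb_words)
    then show ?thesis by (simp only: RGB.comp_assoc[symmetric])
  qed
  have hopf: "layer 0 (tri R 1 2 1) 0 \<bullet> layer 0 (tri G 2 1 0) 0 \<bullet> Z =
      layer 0 (tri R 1 0 3) 0 \<bullet> layer 0 (tri G 0 1 0) 0 \<bullet> Z" for Z
    using RGB.comp_context[OF RGB.layer_cong[OF hopf_dag, of 0 0], of Z] by (simp add: RGB.layer_words)
  have "layer 0 (tri R 1 2 1 \<Zsemi> (tri G 1 1 1 \<otimes> tri G 1 1 1) \<Zsemi> tri R 2 1 3) 0 =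
    layer 0 (tri R 1 2 1) 0 \<bullet> layer 0 (tri R 1 1 3) 1 \<bullet> layer 0 H 1 \<bullet> layer 0 (tri R 1 1 3) 1 \<bullet>
     layer 1 (tri R 1 1 3) 0 \<bullet> layer 1 H 0 \<bullet> layer 1 (tri R 1 1 3) 0 \<bullet> layer 0 (tri R 2 1 3) 0"
    by (simp add: RGB.layer_Seq RGB.layer_Par(1) RGB.layer_cong[OF g] RGB.comp_assoc)
  also have "\<dots> = layer 0 (tri R 1 2 1) 0 \<bullet> layer 0 (tri R 1 1 3) 1 \<bullet> layer 1 (tri R 1 1 3) 0 \<bullet> layer 0 H 1 \<bullet>
     layer 1 H 0 \<bullet> layer 0 (tri R 1 1 3) 1 \<bullet> layer 1 (tri R 1 1 3) 0 \<bullet> layer 0 (tri R 2 1 3) 0"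
    by (simp add: exchange)
  also have "\<dots> = layer 0 (tri R 1 1 2) 0 \<bullet> layer 0 (tri R 1 2 1) 0 \<bullet> (layer 0 H 1 \<bullet> layer 1 H 0 \<bullet>
     layer 0 (tri R 2 1 3) 0 \<bullet> layer 0 (tri R 1 1 2) 0)"
    by (simp add: rgb_words)
  also have "\<dots> = layer 0 (tri R 1 1 2) 0 \<bullet> layer 0 (tri R 1 0 3) 0 \<bullet> layer 0 (tri R 0 1 1) 0 \<bullet> layer 0 (tri R 1 1 2) 0"
    by (simp only: m hopf u)
  finally show "layer 0 (tri R 1 2 1 \<Zsemi> (tri G 1 1 1 \<otimes> tri G 1 1 1) \<Zsemi> tri R 2 1 3) 0 =
    layer 0 (tri R 1 0 1 \<Zsemi> tri R 0 1 3) 0"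
    by (simp add: rgb_words)
qed simp_all

text \<open>
  The red state of phase 3 corresponds to the dichromatic red state of phase 2.  It is the red
  product of two red units, which are green states of phase 1.  After the bialgebra law, the two
  green nodes are cups carrying one phase gate each; sliding one of the red nodes along its cups
  turns it into a red node with two outputs, joined to the other red node by the two green gates.
\<close>

lemma copy_R_unit_3: "tri R 0 1 3 \<Zsemi> tri G 1 2 0 \<simeq> tri R 0 1 3 \<otimes> tri R 0 1 3"
proof (rule RGB.equivI)
  let ?g = "\<lambda>k q. layer k (tri G 1 1 1) q" and ?m = "\<lambda>k q. layer k (tri R 2 1 3) q"
    and ?u = "\<lambda>k q. layer k (tri G 0 2 0) q" and ?X = "\<lambda>k q. layer k crossing q"
  have unit: "layer 0 (tri R 0 1 3) 0 = layer 0 (tri G 0 1 1) 0 \<bullet> layer 1 (tri G 0 1 1) 0 \<bullet> ?m 0 0"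
    unfolding RGB.layer_cong[OF eqv.symm[OF R_unit_eq_G]] by (simp add: rgb_words)
  have "layer 0 (tri R 0 1 3 \<Zsemi> tri G 1 2 0) 0 = layer 0 (tri G 0 1 1) 0 \<bullet> layer 1 (tri G 0 1 1) 0 \<bullet>
      layer 0 (tri G 1 2 0) 1 \<bullet> layer 2 (tri G 1 2 0) 0 \<bullet> ?X 1 1 \<bullet> ?m 0 2 \<bullet> ?m 1 0"
    unfolding bialgebra_layers by (simp add: RGB.layer_Seq unit RGB.comp_assoc)
  also have "\<dots> = layer 0 (tri G 0 1 1) 0 \<bullet> (layer 0 (tri G 1 2 0) 0 \<bullet> layer 2 (tri G 0 1 1) 0) \<bullet>
      layer 2 (tri G 1 2 0) 0 \<bullet> ?X 1 1 \<bullet> ?m 0 2 \<bullet> ?m 1 0"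
    by (subst RGB.layer_exchange) (simp_all add: RGB.comp_assoc)
  also have "\<dots> = ?u 0 0 \<bullet> ?g 1 0 \<bullet> ?u 2 0 \<bullet> ?g 3 0 \<bullet> ?X 1 1 \<bullet> ?m 0 2 \<bullet> ?m 1 0"
    by (simp add: rgb_words)
  also have "\<dots> = ?u 0 0 \<bullet> ?u 2 0 \<bullet> ?g 1 2 \<bullet> ?g 3 0 \<bullet> ?X 1 1 \<bullet> ?m 0 2 \<bullet> ?m 1 0"
    by (simp add: RGB.layer_exchange_comp[of 1 "tri G 1 1 1" 2])
  also have "\<dots> = ?u 0 0 \<bullet> ?u 2 0 \<bullet> (?g 1 2 \<bullet> ?X 1 1) \<bullet> ?g 3 0 \<bullet> ?m 0 2 \<bullet> ?m 1 0"
    by (simp add: RGB.comp_assoc RGB.layer_exchange_comp[of 1 crossing 3])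
  \<comment> \<open>both green gates are moved past the crossing, next to the last red node\<close>
  also have "?g 1 2 \<bullet> ?X 1 1 = ?X 1 1 \<bullet> ?g 2 1"
    using RGB.crossing_natural[of "tri G 1 1 1" 1 1] by (simp add: diags_def)
  also have "?u 0 0 \<bullet> ?u 2 0 \<bullet> (?X 1 1 \<bullet> ?g 2 1) \<bullet> ?g 3 0 \<bullet> ?m 0 2 \<bullet> ?m 1 0 =
      ?u 0 0 \<bullet> (?u 2 0 \<bullet> ?X 1 1) \<bullet> ?g 2 1 \<bullet> ?g 3 0 \<bullet> ?m 0 2 \<bullet> ?m 1 0"
    by (simp only: RGB.comp_assoc)
  \<comment> \<open>the crossing is pulled off the second cup onto its other leg and then past the first red node\<close>
  also have "?u 2 0 \<bullet> ?X 1 1 = ?u 1 1 \<bullet> ?X 2 0"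
    using RGB.cup_slide[of "tri G 0 2 0" 1 0] by (simp add: diags_def)
  also have "?u 0 0 \<bullet> (?u 1 1 \<bullet> ?X 2 0) \<bullet> ?g 2 1 \<bullet> ?g 3 0 \<bullet> ?m 0 2 \<bullet> ?m 1 0 =
      ?u 0 0 \<bullet> ?u 1 1 \<bullet> ?m 0 2 \<bullet> ?X 1 0 \<bullet> ?g 1 1 \<bullet> ?g 2 0 \<bullet> ?m 1 0"
  proof -
    have "?m 0 2 \<bullet> ?X 1 0 \<bullet> ?g 1 1 \<bullet> ?g 2 0 \<bullet> Z = ?X 2 0 \<bullet> ?g 2 1 \<bullet> ?g 3 0 \<bullet> ?m 0 2 \<bullet> Z" for Z
      by (simp add: exchange)
    then show ?thesis by (simp only: RGB.comp_assoc)
  qed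
  \<comment> \<open>the two cups are red as well and fuse with the first red node into one with three outputs\<close>
  also have "\<dots> = (layer 0 (tri R 0 3 3) 0 \<bullet> ?X 1 0) \<bullet> ?g 1 1 \<bullet> ?g 2 0 \<bullet> ?m 1 0"
    unfolding RGB.layer_cong[OF cup_GR] by (simp add: rgb_words)
  also have "layer 0 (tri R 0 3 3) 0 \<bullet> ?X 1 0 = layer 0 (tri R 0 2 2) 0 \<bullet> layer 1 (tri R 1 2 1) 0"
  proof -
    have "layer 0 (tri R 0 3 3) 0 = layer 0 (tri R 0 2 2) 0 \<bullet> layer 1 (tri R 1 2 1) 0"
      by (simp add: rgb_words)
    then show ?thesis by (simp add: RGB.comp_assoc tri.sp_crossing)
  qed
  also have "(layer 0 (tri R 0 2 2) 0 \<bullet> layer 1 (tri R 1 2 1) 0) \<bullet> ?g 1 1 \<bullet> ?g 2 0 \<bullet> ?m 1 0 =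
      layer 0 (tri R 0 2 2) 0 \<bullet> layer 1 (tri R 1 0 1 \<Zsemi> tri R 0 1 3) 0"
    using RGB.layer_cong[OF G_phases_disconnect, of 1 0] by (simp add: RGB.layer_Seq RGB.layer_Par(1) RGB.comp_assoc)
  finally show "layer 0 (tri R 0 1 3 \<Zsemi> tri G 1 2 0) 0 = layer 0 (tri R 0 1 3 \<otimes> tri R 0 1 3) 0"
    by (simp add: rgb_words)
qed simp_all

text \<open>
  Adding the phase 2 is red multiplication by the state just treated, so the bialgebra law reduces
  the copying of the gate to the copying of the state.
\<close>

lemma pi_copy_R: "tri R 1 1 2 \<Zsemi> tri G 1 2 0 \<simeq> tri G 1 2 0 \<Zsemi> (tri R 1 1 2 \<otimes> tri R 1 1 2)"
proof (rule RGB.equivI)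
  let ?s = "\<lambda>k q. layer k (tri R 0 1 3) q" and ?m = "\<lambda>k q. layer k (tri R 2 1 3) q"
    and ?d = "\<lambda>k q. layer k (tri G 1 2 0) q" and ?X = "\<lambda>k q. layer k crossing q"
  have s: "?s (k + 1) q \<bullet> ?X k q \<bullet> Z = ?s k (1 + q) \<bullet> Z" for k q Z
    using RGB.comp_context[OF RGB.state_slide[of "tri R 0 1 3" k q], of Z] by (simp add: diags_def RGB.comp_assoc)
  have copy: "?s 2 0 \<bullet> ?d 2 0 \<bullet> Z = ?s 2 0 \<bullet> ?s 3 0 \<bullet> Z" for Z
    using RGB.comp_context[OF RGB.layer_cong[OF copy_R_unit_3, of 2 0], of Z] by (simp add: RGB.layer_words)
  have "layer 0 (tri R 1 1 2 \<Zsemi> tri G 1 2 0) 0 = ?s 1 0 \<bullet> ?d 0 1 \<bullet> ?d 2 0 \<bullet> ?X 1 1 \<bullet> ?m 0 2 \<bullet> ?m 1 0"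
    unfolding bialgebra_layers by (simp add: rgb_words)
  also have "\<dots> = ?d 0 0 \<bullet> ?s 2 0 \<bullet> ?d 2 0 \<bullet> ?X 1 1 \<bullet> ?m 0 2 \<bullet> ?m 1 0"
    by (simp add: RGB.layer_exchange_comp[of 0 "tri G 1 2 0" 2])
  also have "\<dots> = ?d 0 0 \<bullet> ?s 2 0 \<bullet> ?s 3 0 \<bullet> ?X 1 1 \<bullet> ?m 0 2 \<bullet> ?m 1 0"
    by (simp only: copy)
  \<comment> \<open>the crossing involves only the first copy of the state, which it brings to the first red node\<close>
  also have "?s 3 0 \<bullet> ?X 1 1 \<bullet> ?m 0 2 \<bullet> ?m 1 0 = ?X 1 0 \<bullet> ?s 3 0 \<bullet> ?m 0 2 \<bullet> ?m 1 0"
    by (simp add: RGB.layer_exchange_comp[of 1 crossing 3])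
  also have "?d 0 0 \<bullet> ?s 2 0 \<bullet> ?X 1 0 \<bullet> ?s 3 0 \<bullet> ?m 0 2 \<bullet> ?m 1 0 = ?d 0 0 \<bullet> ?s 1 1 \<bullet> ?s 3 0 \<bullet> ?m 0 2 \<bullet> ?m 1 0"
    using s[of 1 0] by simp
  also have "\<dots> = ?d 0 0 \<bullet> ?s 1 1 \<bullet> ?m 0 1 \<bullet> ?s 2 0 \<bullet> ?m 1 0"
    by (simp add: RGB.layer_exchange_comp[of 0 "tri R 2 1 3" 2])
  finally show "layer 0 (tri R 1 1 2 \<Zsemi> tri G 1 2 0) 0 = layer 0 (tri G 1 2 0 \<Zsemi> (tri R 1 1 2 \<otimes> tri R 1 1 2)) 0"
    by (simp add: rgb_words)
qed simp_all

section \<open>Consequences of the Euler decomposition in \<open>RG\<^sup>+\<close>\<close>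

abbreviation rgp_eq (infix "\<cong>" 50) where "a \<cong> b \<equiv> eqv rg_ar rg_plus_rel a b"

abbreviation "swp \<equiv> map_diag rg_swap"

interpretation RGP: presentation rg_ar rg_plus_rel .

abbreviation rg_comp (infixr "\<diamondop>" 60) where "X \<diamondop> Y \<equiv> RGP.class_comp X Y"

abbreviation rg_layer where "rg_layer \<equiv> RGP.layer"

lemma rg_dag_ar: "rg_ar (rg_dag g) = prod.swap (rg_ar g)" "rg_ar (rg_swap g) = rg_ar g"
  by (cases g; simp add: node_ar_dag node_ar_map)+

lemma src_tgt_rg_dag [simp]:
  "src rg_ar (dag rg_dag d) = tgt rg_ar d" "tgt rg_ar (dag rg_dag d) = src rg_ar d"
  by (induction d) (auto simp: rg_dag_ar)

lemma well_formed_rg_dag [simp]: "well_formed rg_ar (dag rg_dag d) = well_formed rg_ar d"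
  by (induction d) auto

lemma rg_base: "rg_rel a b \<Longrightarrow> a \<cong> b"
  using rg_rel_diags[of a b] by (auto intro: eqv.base rg_plus_rel.rg)

lemma swap_spider_rule: "spider_rule Node x a b \<Longrightarrow> spider_rule Node (swap_colour x) (swp a) (swp b)"
  by (rule map_spider_rule[where \<iota> = Node and f = swap_colour]) simp_all

lemma swap_node: "swp (spider Node x m n \<theta>) = spider Node (swap_colour x) m n \<theta>"
  by (rule map_spider(3)[where \<iota> = Node and f = swap_colour]) simp_all

lemma swp_swp: "swp (swp d) = d"
proof -
  have "swap_colour (swap_colour x) = x" for x by (cases x) simp_all
  then have "rg_swap (rg_swap g) = g" for g by (cases g) (simp_all add: node.map_comp o_def node.map_ident)
  then show ?thesis by (simp add: diag.map_comp o_def diag.map_ident)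
qed

lemma rg_spiders: "spider_rule Node x a b \<Longrightarrow> rg_rel a b"
proof (cases x)
  case Red
  assume "spider_rule Node x a b"
  from swap_spider_rule[OF this] Red have "rg_rel (swp a) (swp b)" by (simp add: rg_rel.spiders)
  then have "rg_rel (swp (swp a)) (swp (swp b))" by (rule rg_rel.swap)
  then show ?thesis by (simp only: swp_swp)
qed (simp add: rg_rel.spiders)

interpretation nd: spiders rg_ar rg_plus_rel Node x for x
  by (rule RGP.spidersI[where \<delta> = rg_dag]) (auto intro: rg_base rg_spiders rg_rel.dagger)

lemma dag_nd: "dag rg_dag (spider Node x m n \<theta>) \<cong> spider Node x n m (- \<theta>)"
  by (rule RGP.dag_spider) simp_all

lemmas layer_dag_nd = RGP.layer_cong[OF dag_nd]

lemmas layer_wire_nd = RGP.layer_cong[OF nd.sp_1_1_0]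

lemmas rg_words = RGP.layer_words nd.fuse_rules nd.fuse_rules_comp layer_wire_nd

lemmas rg_exchange = RGP.layer_exchange RGP.layer_exchange_comp

abbreviation "N x \<theta> \<equiv> rg_layer 0 (spider Node x 1 1 \<theta>) 0"

abbreviation "h \<equiv> rg_layer 0 had 0"

lemma N_comp: "N x \<alpha> \<diamondop> N x \<beta> = N x (\<alpha> + \<beta>)" "N x \<alpha> \<diamondop> N x \<beta> \<diamondop> Z = N x (\<alpha> + \<beta>) \<diamondop> Z"
  by (simp_all add: rg_words)

lemma N_id: "N x \<alpha> \<diamondop> RGP.idc 1 = N x \<alpha>" "RGP.idc 1 \<diamondop> N x \<alpha> = N x \<alpha>"
  "N x \<alpha> \<diamondop> RGP.idc 1 \<diamondop> Z = N x \<alpha> \<diamondop> Z" "RGP.idc 1 \<diamondop> N x \<alpha> \<diamondop> Z = N x \<alpha> \<diamondop> Z"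
  by (simp_all add: rg_words)

lemma N_0: "N x 0 = RGP.idc 1" by (simp add: rg_words)

lemmas N_rules = N_comp N_0 N_id RGP.comp_assoc

lemma h_id: "h \<diamondop> RGP.idc 1 = h" "RGP.idc 1 \<diamondop> h = h"
  "h \<diamondop> RGP.idc 1 \<diamondop> Z = h \<diamondop> Z" "RGP.idc 1 \<diamondop> h \<diamondop> Z = h \<diamondop> Z"
  by (simp_all add: rg_words)

lemma h_h: "h \<diamondop> h = RGP.idc 1" "h \<diamondop> h \<diamondop> Z = RGP.idc 1 \<diamondop> Z"
proof -
  show "h \<diamondop> h = RGP.idc 1"
    using RGP.layer_cong[OF rg_base[OF rg_rel.had_involution], of 0 0] by (simp add: RGP.layer_words)
  then show "h \<diamondop> h \<diamondop> Z = RGP.idc 1 \<diamondop> Z" by (simp only: RGP.comp_assoc[symmetric])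
qed

lemma h_euler: "h = N Green 1 \<diamondop> N Red 1 \<diamondop> N Green 1"
proof -
  have "had \<cong> gr 1 1 1 \<Zsemi> rd 1 1 1 \<Zsemi> gr 1 1 1"
    by (rule eqv.base[where m = 1 and n = 1]) (simp_all add: diags_def rg_plus_rel.euler)
  from RGP.layer_cong[OF this, of 0 0] show ?thesis by (simp add: RGP.layer_words)
qed

lemma N_Green: "N Green \<theta> = h \<diamondop> N Red \<theta> \<diamondop> h"
  using RGP.layer_cong[OF rg_base[OF rg_rel.colour_change[of 1 1 \<theta>]], of 0 0] by (simp add: RGP.layer_words)

text \<open>
  The Euler decomposition is imposed in one form only.  Conjugating it by \<open>H\<close> exchanges the
  colours, and inverting it negates the phases; so the relations of \<open>RG\<^sup>+\<close> are still closed under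
  colour exchange and \<open>\<dagger>\<close>.
\<close>

lemma h_euler_swapped: "h = N Red 1 \<diamondop> N Green 1 \<diamondop> N Red 1"
proof -
  have "N Red 1 = h \<diamondop> N Green 1 \<diamondop> h" by (simp add: N_Green RGP.comp_assoc h_h h_id) (simp add: N_rules)
  then have "N Red 1 \<diamondop> N Green 1 \<diamondop> N Red 1 = h \<diamondop> N Green 1 \<diamondop> (h \<diamondop> N Green 1 \<diamondop> h) \<diamondop> N Green 1 \<diamondop> h"
    by (simp only: RGP.comp_assoc)
  also have "h \<diamondop> N Green 1 \<diamondop> h = N Red 1" by (simp add: N_Green RGP.comp_assoc h_h h_id) (simp add: N_rules)
  also have "h \<diamondop> N Green 1 \<diamondop> N Red 1 \<diamondop> N Green 1 \<diamondop> h = h \<diamondop> (N Green 1 \<diamondop> N Red 1 \<diamondop> N Green 1) \<diamondop> h"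
    by (simp only: RGP.comp_assoc)
  finally show ?thesis by (simp add: h_euler[symmetric] h_h h_id)
qed

lemma h_euler_dag: "h = N Green 3 \<diamondop> N Red 3 \<diamondop> N Green 3" "h = N Red 3 \<diamondop> N Green 3 \<diamondop> N Red 3"
proof -
  have "h \<diamondop> (N Green 3 \<diamondop> N Red 3 \<diamondop> N Green 3) = RGP.idc 1"
    by (subst h_euler) (simp add: N_rules)
  then have "h \<diamondop> h \<diamondop> (N Green 3 \<diamondop> N Red 3 \<diamondop> N Green 3) = h \<diamondop> RGP.idc 1" by simp
  then show "h = N Green 3 \<diamondop> N Red 3 \<diamondop> N Green 3" by (simp add: h_h h_id N_id)
  have "h \<diamondop> (N Red 3 \<diamondop> N Green 3 \<diamondop> N Red 3) = RGP.idc 1"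
    by (subst h_euler_swapped) (simp add: N_rules)
  then have "h \<diamondop> h \<diamondop> (N Red 3 \<diamondop> N Green 3 \<diamondop> N Red 3) = h \<diamondop> RGP.idc 1" by simp
  then show "h = N Red 3 \<diamondop> N Green 3 \<diamondop> N Red 3" by (simp add: h_h h_id N_id)
qed

lemma rgp_dag:
  assumes "a \<cong> b" shows "dag rg_dag a \<cong> dag rg_dag b"
proof (rule RGP.dag_equiv[OF _ _ assms])
  fix a b assume "rg_plus_rel a b"
  then show "dag rg_dag a \<cong> dag rg_dag b"
  proof cases
    case euler
    show ?thesis unfolding euler
      by (rule RGP.equivI) (simp_all add: RGP.layer_Seq layer_dag_nd h_euler_dag(1)[symmetric] RGP.comp_assoc)
  qed (simp add: rg_base rg_rel.dagger)
qed (simp add: rg_dag_ar)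

lemma rgp_swap:
  assumes "a \<cong> b" shows "swp a \<cong> swp b"
  unfolding extend_Box_map[symmetric]
proof (rule RGP.extend_equiv[OF _ _ assms])
  fix a b assume "rg_plus_rel a b"
  then show "extend (\<lambda>g. Box (rg_swap g)) a \<cong> extend (\<lambda>g. Box (rg_swap g)) b"
    unfolding extend_Box_map
  proof cases
    case euler
    show "swp a \<cong> swp b" unfolding euler
      by (rule RGP.equivI) (simp_all add: RGP.layer_Seq swap_node h_euler_swapped[symmetric] RGP.comp_assoc)
  qed (simp add: rg_base rg_rel.swap)
qed (simp add: diags_def rg_dag_ar)

lemma nd_eq_dag:
  assumes "spider Node x m n \<alpha> \<cong> spider Node y m n \<beta>" shows "spider Node x n m (- \<alpha>) \<cong> spider Node y n m (- \<beta>)"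
  using eqv.trans[OF eqv.symm[OF dag_nd] eqv.trans[OF rgp_dag[OF assms] dag_nd]] .

text \<open>
  Attach the phase to one output of the green copy: the red state splits off as a scalar, which is
  deleted.
\<close>

lemma rd_unit_absorbs: "rd 0 1 0 \<Zsemi> gr 1 1 \<theta> \<cong> rd 0 1 0"
proof (rule RGP.equivI)
  have c: "rg_layer 0 (rd 0 1 0) 0 \<diamondop> rg_layer 0 (gr 1 2 0) 0 = rg_layer 0 (rd 0 1 0) 0 \<diamondop> rg_layer 1 (rd 0 1 0) 0"
    using RGP.layer_cong[OF rg_base[OF rg_rel.copy], of 0 0] by (simp add: RGP.layer_words)
  have s: "rg_layer 1 (rd 0 1 0) 0 \<diamondop> rg_layer 1 (gr 1 0 \<theta>) 0 = RGP.idc 1"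
    using RGP.layer_scalar[of "rd 0 1 0 \<Zsemi> gr 1 0 \<theta>" 1 0] by (simp add: diags_def RGP.layer_Seq)
  have "rg_layer 0 (gr 1 1 \<theta>) 0 = rg_layer 0 (gr 1 2 0) 0 \<diamondop> rg_layer 1 (gr 1 0 \<theta>) 0"
    by (simp add: rg_words)
  then have "rg_layer 0 (rd 0 1 0 \<Zsemi> gr 1 1 \<theta>) 0 =
      (rg_layer 0 (rd 0 1 0) 0 \<diamondop> rg_layer 0 (gr 1 2 0) 0) \<diamondop> rg_layer 1 (gr 1 0 \<theta>) 0"
    by (simp add: RGP.layer_Seq RGP.comp_assoc)
  then show "rg_layer 0 (rd 0 1 0 \<Zsemi> gr 1 1 \<theta>) 0 = rg_layer 0 (rd 0 1 0) 0"
    by (simp add: c RGP.comp_assoc s) (simp add: rg_words)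
qed simp_all

lemma rd_counit_absorbs: "gr 1 1 \<theta> \<Zsemi> rd 1 0 0 \<cong> rd 1 0 0"
  by (rule RGP.equivI)
    (use RGP.layer_cong[OF rgp_dag[OF rd_unit_absorbs[of "- \<theta>"]], of 0 0] in
      \<open>simp_all add: RGP.layer_words layer_dag_nd\<close>)

lemma gr_unit_absorbs: "gr 0 1 0 \<Zsemi> rd 1 1 \<theta> \<cong> gr 0 1 0"
  using rgp_swap[OF rd_unit_absorbs] by (simp add: swap_node)

lemma cup_gr_rd: "gr 0 2 0 \<cong> rd 0 2 0"
  by (rule rg_base[OF rg_rel.cup])

lemma cap_gr_rd: "gr 2 0 0 \<cong> rd 2 0 0"
  using nd_eq_dag[OF cup_gr_rd] by simp

text \<open>
  The red unit is the green unit followed by \<open>H = rgr\<close>, whose first factor is absorbed.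
\<close>

lemma rd_unit_eq_gr: "rd 0 1 3 \<cong> gr 0 1 1"
proof (rule RGP.equivI)
  have a: "rg_layer 0 (gr 0 1 0) 0 \<diamondop> N Red \<theta> \<diamondop> Z = rg_layer 0 (gr 0 1 0) 0 \<diamondop> Z" for \<theta> Z
    using RGP.comp_context[OF RGP.layer_cong[OF gr_unit_absorbs[of \<theta>], of 0 0], of Z] by (simp add: RGP.layer_Seq RGP.comp_assoc)
  have b: "rg_layer 0 (gr 0 1 0) 0 \<diamondop> h = rg_layer 0 (rd 0 1 0) 0"
  proof -
    have "rg_layer 0 (gr 0 1 0) 0 = rg_layer 0 (rd 0 1 0) 0 \<diamondop> h"
      using RGP.layer_cong[OF rg_base[OF rg_rel.colour_change[of 0 1 0]], of 0 0] by (simp add: RGP.layer_words)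
    then show ?thesis by (simp add: RGP.comp_assoc h_h) (simp add: rg_words)
  qed
  have "rg_layer 0 (rd 0 1 3) 0 = (rg_layer 0 (gr 0 1 0) 0 \<diamondop> h) \<diamondop> N Red 3" by (simp add: b) (simp add: rg_words)
  also have "\<dots> = rg_layer 0 (gr 0 1 0) 0 \<diamondop> N Green 1"
    by (subst h_euler_swapped) (simp add: N_rules a)
  finally show "rg_layer 0 (rd 0 1 3) 0 = rg_layer 0 (gr 0 1 1) 0" by (simp add: rg_words)
qed simp_all

lemma N_Red_2: "N Red 2 \<diamondop> N Green \<theta> = N Green (- \<theta>) \<diamondop> N Red 2"
  using RGP.layer_cong[OF rgp_swap[OF rg_base[OF rg_rel.pi_commute[of \<theta>]]], of 0 0]
  by (simp add: RGP.layer_Seq swap_node)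

section \<open>The translation \<open>S\<close>\<close>

text \<open>
  Under \<open>S\<close> each trichromatic spider is a dichromatic red spider with \<open>in_gate\<close> on its inputs and
  \<open>out_gate\<close> on its outputs.
\<close>

primrec in_gate :: "rgb_colour \<Rightarrow> rg_gen diag" where
  "in_gate R = rd 1 1 1" | "in_gate G = had" | "in_gate B = gr 1 1 3"

primrec out_gate :: "rgb_colour \<Rightarrow> rg_gen diag" where
  "out_gate R = rd 1 1 3" | "out_gate G = had" | "out_gate B = gr 1 1 1"

lemma gate_shape [simp]:
  "well_formed rg_ar (in_gate x)" "src rg_ar (in_gate x) = 1" "tgt rg_ar (in_gate x) = 1"
  "well_formed rg_ar (out_gate x)" "src rg_ar (out_gate x) = 1" "tgt rg_ar (out_gate x) = 1"
  by (cases x; simp)+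

lemma gate_diags: "in_gate x \<in> diags rg_ar 1 1" "out_gate x \<in> diags rg_ar 1 1"
  by (simp_all add: diags_def)

lemma gate_inverse: "in_gate x \<Zsemi> out_gate x \<cong> wire" "out_gate x \<Zsemi> in_gate x \<cong> wire"
  by (rule RGP.equivI; cases x; simp add: RGP.layer_Seq h_h N_rules RGP.layer_Ids)+

lemma S_gen_diags: "S_gen v \<in> diags rg_ar (fst (node_ar v)) (snd (node_ar v))"
proof (cases v)
  case (Unit x) then show ?thesis by (cases x) (simp_all add: diags_def)
next
  case (Counit x) then show ?thesis by (cases x) (simp_all add: diags_def)
next
  case (Mult x) then show ?thesis by (cases x) (simp_all add: diags_def)
next
  case (Comult x) then show ?thesis by (cases x) (simp_all add: diags_def)
next
  case (Phase x \<theta>) then show ?thesis by (cases x) (simp_all add: diags_def)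
qed

lemma extend_S_shape [simp]:
  "src rg_ar (extend S_gen d) = src node_ar d" "tgt rg_ar (extend S_gen d) = tgt node_ar d"
  "well_formed rg_ar (extend S_gen d) = well_formed node_ar d"
  using S_gen_diags by (induction d) (auto simp: diags_def)

lemma gr_eq_conjugate: "gr m n \<theta> \<cong> tensor_power (in_gate G) m \<Zsemi> rd m n \<theta> \<Zsemi> tensor_power (out_gate G) n"
  using rg_base[OF rg_rel.colour_change[of m n \<theta>]] by simp

lemma rd_eq_conjugate:
  "rd m n (\<theta> + of_nat m - of_nat n) \<cong> tensor_power (in_gate R) m \<Zsemi> rd m n \<theta> \<Zsemi> tensor_power (out_gate R) n"
  using nd.sp_leg_phases[of Red 1 m n \<theta> 3, THEN eqv.symm] by (simp add: of_nat_times_3 algebra_simps)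

text \<open>
  The blue unit and counit are translated without gates, which agrees with the general form because
  the red unit and counit absorb green phases.
\<close>

lemma S_gen_conjugate:
  assumes "set_node v = {x}"
  shows "S_gen v \<cong> tensor_power (in_gate x) (fst (node_ar v)) \<Zsemi>
    rd (fst (node_ar v)) (snd (node_ar v)) (node_phase v) \<Zsemi> tensor_power (out_gate x) (snd (node_ar v))"
proof (cases x)
  case R
  have "S_gen v = rd (fst (node_ar v)) (snd (node_ar v))
      (node_phase v + of_nat (fst (node_ar v)) - of_nat (snd (node_ar v)))"
    using assms R by (cases v) simp_all
  then show ?thesis unfolding R by (simp only: rd_eq_conjugate)
next
  case G
  have "S_gen v = gr (fst (node_ar v)) (snd (node_ar v)) (node_phase v)"
    using assms G by (cases v) simp_all
  then show ?thesis unfolding G by (simp only: gr_eq_conjugate)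
next
  case B
  show ?thesis
  proof (rule RGP.equivI)
    show "rg_layer 0 (S_gen v) 0 = rg_layer 0 (tensor_power (in_gate x) (fst (node_ar v)) \<Zsemi>
      rd (fst (node_ar v)) (snd (node_ar v)) (node_phase v) \<Zsemi> tensor_power (out_gate x) (snd (node_ar v))) 0"
      using assms B RGP.layer_cong[OF rd_unit_absorbs[of 1], of 0 0] RGP.layer_cong[OF rd_counit_absorbs[of 3], of 0 0]
      by (cases v) (simp_all add: RGP.layer_words)
  qed (use S_gen_diags[of v] in \<open>simp_all add: diags_def\<close>)
qed

lemma S_tri: "extend S_gen (tri x m n \<theta>) \<cong>
    tensor_power (in_gate x) m \<Zsemi> rd m n \<theta> \<Zsemi> tensor_power (out_gate x) n"
  by (rule nd.extend_spider_conjugate[where ar' = node_ar and \<rho> = "\<lambda>v. Node (map_node (\<lambda>_. Red) v)",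
        OF gate_diags gate_inverse])
    (simp_all add: node_ar_map S_gen_conjugate)

lemma S_tri_G: "extend S_gen (tri G m n \<theta>) \<cong> gr m n \<theta>"
  by (rule eqv.trans[OF S_tri eqv.symm[OF gr_eq_conjugate]])

lemma S_tri_R: "extend S_gen (tri R m n \<theta>) \<cong> rd m n (\<theta> + of_nat m - of_nat n)"
  by (rule eqv.trans[OF S_tri eqv.symm[OF rd_eq_conjugate]])

lemmas layer_S_GR = RGP.layer_cong[OF S_tri_G] RGP.layer_cong[OF S_tri_R]

lemma layer_S_cyc: "rg_layer 0 (extend S_gen cyc) 0 = N Red 1 \<diamondop> N Green 1"
  by (simp add: cyc_def RGP.layer_Seq layer_S_GR RGP.layer_cong[OF S_tri[of B]]) (simp add: rg_words)

text \<open>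
  The image of \<open>c\<close> carries the gates of each colour to those of the next, which is what makes the
  rotation of colours a conjugation.
\<close>

lemma rotate_gates:
  "extend S_gen cyc \<Zsemi> in_gate x \<cong> in_gate (rotate_colour x)"
  "out_gate x \<Zsemi> extend S_gen cyc_bar \<cong> out_gate (rotate_colour x)"
  "extend S_gen cyc_bar \<Zsemi> in_gate B \<cong> in_gate G" "out_gate B \<Zsemi> extend S_gen cyc \<cong> out_gate G"
  and S_cyc_inverse: "extend S_gen cyc \<Zsemi> extend S_gen cyc_bar \<cong> wire"
    "extend S_gen cyc_bar \<Zsemi> extend S_gen cyc \<cong> wire"
proof -
  note c = layer_S_cyc
  have c': "rg_layer 0 (extend S_gen cyc_bar) 0 = N Green 3 \<diamondop> N Red 3"
  proof -
    have "rg_layer 0 (extend S_gen cyc_bar) 0 = (N Red 1 \<diamondop> N Green 1 \<diamondop> N Red 1) \<diamondop> N Green 1"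
      by (simp add: cyc_bar_def RGP.layer_Seq c RGP.comp_assoc)
    also have "\<dots> = N Green 3 \<diamondop> N Red 3"
      unfolding h_euler_swapped[symmetric] h_euler_dag(1) by (simp add: N_rules)
    finally show ?thesis .
  qed
  have h1: "N Red 1 \<diamondop> N Green 1 \<diamondop> N Red 1 = h" "N Green 1 \<diamondop> N Red 1 \<diamondop> N Green 1 = h"
    "N Red 3 \<diamondop> N Green 3 \<diamondop> N Red 3 = h" "N Green 3 \<diamondop> N Red 3 \<diamondop> N Green 3 = h"
    using h_euler h_euler_swapped h_euler_dag by simp_all
  have g: "N Red 1 \<diamondop> N Green 1 \<diamondop> h = N Green 3" "h \<diamondop> N Green 3 \<diamondop> N Red 3 = N Green 1"
    by (subst h_euler_dag(1), simp add: N_rules) (subst h_euler, simp add: N_rules)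
  show "extend S_gen cyc \<Zsemi> in_gate x \<cong> in_gate (rotate_colour x)"
    "out_gate x \<Zsemi> extend S_gen cyc_bar \<cong> out_gate (rotate_colour x)"
    "extend S_gen cyc_bar \<Zsemi> in_gate B \<cong> in_gate G" "out_gate B \<Zsemi> extend S_gen cyc \<cong> out_gate G"
    by (rule RGP.equivI; (cases x)?; simp add: RGP.layer_Seq c c' N_rules h1 g)+
  show "extend S_gen cyc \<Zsemi> extend S_gen cyc_bar \<cong> wire"
    "extend S_gen cyc_bar \<Zsemi> extend S_gen cyc \<cong> wire"
    by (rule RGP.equivI; simp add: RGP.layer_Seq c c' N_rules RGP.layer_Ids)+
qed

lemma S_cyc_diags: "extend S_gen cyc \<in> diags rg_ar 1 1" "extend S_gen cyc_bar \<in> diags rg_ar 1 1"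
  by (simp_all add: diags_def)

lemma conjugate_S_tri:
  assumes "a \<in> diags rg_ar 1 1" "d \<in> diags rg_ar 1 1"
    and "a \<Zsemi> in_gate x \<cong> in_gate y" "out_gate x \<Zsemi> d \<cong> out_gate y"
  shows "tensor_power a m \<Zsemi> extend S_gen (tri x m n \<theta>) \<Zsemi> tensor_power d n \<cong> extend S_gen (tri y m n \<theta>)"
proof -
  have "tensor_power a m \<Zsemi> extend S_gen (tri x m n \<theta>) \<Zsemi> tensor_power d n \<cong>
    tensor_power a m \<Zsemi> (tensor_power (in_gate x) m \<Zsemi> rd m n \<theta> \<Zsemi> tensor_power (out_gate x) n) \<Zsemi> tensor_power d n"
    by (rule RGP.equiv_in_context[OF S_tri]) (use assms(1,2) in \<open>simp add: diags_def\<close>)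
  also have "\<dots> \<cong> tensor_power (in_gate y) m \<Zsemi> rd m n \<theta> \<Zsemi> tensor_power (out_gate y) n"
    by (rule RGP.conjugate_conjugate[OF assms(1) gate_diags assms(2) _ assms(3,4)]) (simp add: diags_def)
  also have "\<dots> \<cong> extend S_gen (tri y m n \<theta>)" by (rule eqv.symm[OF S_tri])
  finally show ?thesis .
qed

lemma S_rotate:
  assumes "d \<in> diags node_ar m n"
  shows "extend S_gen (rot d) \<cong>
    tensor_power (extend S_gen cyc) m \<Zsemi> extend S_gen d \<Zsemi> tensor_power (extend S_gen cyc_bar) n"
  unfolding extend_map
proof (rule RGP.extend_conjugate[OF S_cyc_diags S_cyc_inverse S_gen_diags _ assms])
  fix v :: rgb_gen
  let ?m = "fst (node_ar v)" and ?n = "snd (node_ar v)"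
  obtain x where x: "set_node v = {x}" by (cases v) auto
  have x': "set_node (map_node rotate_colour v) = {rotate_colour x}" using x by (simp add: node.set_map)
  have ph: "node_phase (map_node rotate_colour v) = node_phase v" by (cases v) simp_all
  have "S_gen (map_node rotate_colour v) \<cong> tensor_power (in_gate (rotate_colour x)) ?m \<Zsemi>
      rd ?m ?n (node_phase v) \<Zsemi> tensor_power (out_gate (rotate_colour x)) ?n"
    using S_gen_conjugate[OF x'] by (simp add: node_ar_map ph)
  also have "\<dots> \<cong> tensor_power (extend S_gen cyc) ?m \<Zsemi> (tensor_power (in_gate x) ?m \<Zsemi>
      rd ?m ?n (node_phase v) \<Zsemi> tensor_power (out_gate x) ?n) \<Zsemi> tensor_power (extend S_gen cyc_bar) ?n"
    by (rule eqv.symm[OF RGP.conjugate_conjugate[OF S_cyc_diags(1) gate_diags S_cyc_diags(2) _ rotate_gates(1,2)]])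
      (simp add: diags_def)
  also have "\<dots> \<cong> tensor_power (extend S_gen cyc) ?m \<Zsemi> S_gen v \<Zsemi> tensor_power (extend S_gen cyc_bar) ?n"
    by (rule RGP.equiv_in_context[OF eqv.symm[OF S_gen_conjugate[OF x]]]) simp
  finally show "S_gen (map_node rotate_colour v) \<cong>
    tensor_power (extend S_gen cyc) ?m \<Zsemi> S_gen v \<Zsemi> tensor_power (extend S_gen cyc_bar) ?n" .
qed

lemma dag_S_gen: "dag rg_dag (S_gen v) \<cong> S_gen (node_dag v)"
proof (rule RGP.equivI)
  show "rg_layer 0 (dag rg_dag (S_gen v)) 0 = rg_layer 0 (S_gen (node_dag v)) 0"
  proof (cases v)
    case (Unit x) then show ?thesis by (cases x) (simp_all add: RGP.layer_words layer_dag_nd)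
  next
    case (Counit x) then show ?thesis by (cases x) (simp_all add: RGP.layer_words layer_dag_nd)
  next
    case (Mult x) then show ?thesis by (cases x) (simp_all add: RGP.layer_words layer_dag_nd)
  next
    case (Comult x) then show ?thesis by (cases x) (simp_all add: RGP.layer_words layer_dag_nd)
  next
    case (Phase x \<theta>) then show ?thesis by (cases x) (simp_all add: RGP.layer_words layer_dag_nd)
  qed
qed (use S_gen_diags in \<open>simp_all add: diags_def\<close>)

text \<open>
  Relative to the green cup, the cups of red and blue carry these half turns; the bending laws then
  compose the half turn of the cap with that of the cup.
\<close>

primrec twist :: "rgb_colour \<Rightarrow> rg_gen diag" where
  "twist R = rd 1 1 2" | "twist G = gr 1 1 0" | "twist B = gr 1 1 2"

lemma twist_shape [simp]:
  "well_formed rg_ar (twist x)" "src rg_ar (twist x) = 1" "tgt rg_ar (twist x) = 1"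
  by (cases x; simp)+

lemma S_cup: "rg_layer k (extend S_gen (tri x 0 2 0)) q =
    rg_layer k (gr 0 2 0) q \<diamondop> rg_layer (k + 1) (twist x) q"
proof -
  have "extend S_gen (tri x 0 2 0) \<cong> gr 0 2 0 \<Zsemi> (wire \<otimes> twist x)"
  proof (rule RGP.equivI)
    show "rg_layer 0 (extend S_gen (tri x 0 2 0)) 0 = rg_layer 0 (gr 0 2 0 \<Zsemi> (wire \<otimes> twist x)) 0"
    proof (cases x)
      case R
      then show ?thesis
        by (simp add: RGP.layer_cong[OF S_tri_R] RGP.layer_words RGP.layer_cong[OF cup_gr_rd]) (simp add: rg_words)
    next
      case G
      then show ?thesis by (simp add: RGP.layer_cong[OF S_tri_G]) (simp add: rg_words)
    next
      case B
      then show ?thesis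
        by (simp add: RGP.layer_cong[OF S_tri] RGP.layer_words RGP.layer_cong[OF eqv.symm[OF cup_gr_rd]]) (simp add: rg_words)
    qed
  qed simp_all
  from RGP.layer_cong[OF this, of k q] show ?thesis by (simp add: RGP.layer_Seq RGP.layer_shift)
qed

lemma S_cap: "rg_layer k (extend S_gen (tri x 2 0 0)) q =
    rg_layer k (twist x) (1 + q) \<diamondop> rg_layer k (gr 2 0 0) q"
proof -
  have "extend S_gen (tri x 2 0 0) \<cong> (twist x \<otimes> wire) \<Zsemi> gr 2 0 0"
  proof (rule RGP.equivI)
    show "rg_layer 0 (extend S_gen (tri x 2 0 0)) 0 = rg_layer 0 ((twist x \<otimes> wire) \<Zsemi> gr 2 0 0) 0"
    proof (cases x)
      case R
      then show ?thesis
        by (simp add: RGP.layer_cong[OF S_tri_R] RGP.layer_words RGP.layer_cong[OF cap_gr_rd]) (simp add: rg_words)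
    next
      case G
      then show ?thesis by (simp add: RGP.layer_cong[OF S_tri_G]) (simp add: rg_words)
    next
      case B
      then show ?thesis
        by (simp add: RGP.layer_cong[OF S_tri] RGP.layer_words RGP.layer_cong[OF eqv.symm[OF cap_gr_rd]]) (simp add: rg_words)
    qed
  qed simp_all
  from RGP.layer_cong[OF this, of k q] show ?thesis by (simp add: RGP.layer_Seq RGP.layer_pad)
qed

lemma S_bend: "rg_layer 0 (extend S_gen ((wire \<otimes> tri x 0 2 0) \<Zsemi> (tri y 2 0 0 \<otimes> wire))) 0 =
    rg_layer 0 (twist y) 0 \<diamondop> rg_layer 0 (twist x) 0"
proof -
  have "rg_layer 0 (extend S_gen ((wire \<otimes> tri x 0 2 0) \<Zsemi> (tri y 2 0 0 \<otimes> wire))) 0 =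
    rg_layer 1 (gr 0 2 0) 0 \<diamondop> rg_layer 2 (twist x) 0 \<diamondop> rg_layer 0 (twist y) 2 \<diamondop> rg_layer 0 (gr 2 0 0) 1"
    by (simp add: RGP.layer_Seq RGP.layer_shift RGP.layer_pad S_cup S_cap RGP.comp_assoc)
  also have "rg_layer 2 (twist x) 0 \<diamondop> rg_layer 0 (twist y) 2 \<diamondop> rg_layer 0 (gr 2 0 0) 1 =
    rg_layer 0 (twist y) 2 \<diamondop> rg_layer 0 (gr 2 0 0) 1 \<diamondop> rg_layer 0 (twist x) 0"
    by (simp add: rg_exchange)
  also have "rg_layer 1 (gr 0 2 0) 0 \<diamondop> rg_layer 0 (twist y) 2 \<diamondop> rg_layer 0 (gr 2 0 0) 1 \<diamondop> rg_layer 0 (twist x) 0 =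
    rg_layer 0 (twist y) 0 \<diamondop> rg_layer 1 (gr 0 2 0) 0 \<diamondop> rg_layer 0 (gr 2 0 0) 1 \<diamondop> rg_layer 0 (twist x) 0"
    by (simp add: rg_exchange)
  finally show ?thesis by (simp add: rg_words)
qed

theorem S_respects: "rgb_rel a b \<Longrightarrow> extend S_gen a \<cong> extend S_gen b"
proof (induction rule: rgb_rel.induct)
  case (spiders a b)
  show ?case
  proof (rule nd.extend_spider_rule[where ar' = node_ar and \<rho> = "\<lambda>v. Node (map_node (\<lambda>_. Green) v)",
        OF _ _ _ _ spiders])
    fix v :: rgb_gen assume "set_node v = {G}"
    then show "S_gen v = gr (fst (node_ar v)) (snd (node_ar v)) (node_phase v)"
      by (cases v) simp_all
  qed (simp_all add: node_ar_map)
next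
  case copy
  have "rg_layer k (extend S_gen (tri B 0 1 0)) q = rg_layer k (rd 0 1 0) q" for k q
    using RGP.layer_cong[OF S_tri[of B 0 1 0], of k q] RGP.layer_cong[OF rd_unit_absorbs[of 1], of k q]
    by (simp add: RGP.layer_words)
  then show ?case
    using RGP.layer_cong[OF rg_base[OF rg_rel.copy], of 0 0]
    by (intro RGP.equivI) (simp_all add: RGP.layer_words layer_S_GR)
next
  case cocopy
  show ?case
    using RGP.layer_cong[OF rgp_dag[OF rgp_swap[OF rg_base[OF rg_rel.copy]]], of 0 0]
    by (intro RGP.equivI) (simp_all add: RGP.layer_words layer_S_GR swap_node layer_dag_nd)
next
  case bialgebra
  show ?case
    using RGP.layer_cong[OF rg_base[OF rg_rel.bialgebra], of 0 0]
    by (intro RGP.equivI) (simp_all add: RGP.layer_words layer_S_GR)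
next
  case phase_unit
  show ?case
    by (rule RGP.equivI)
      (simp_all add: RGP.layer_words layer_S_GR RGP.layer_cong[OF rd_unit_eq_gr] nd.fuse_rules)
next
  case cyc_RG
  show ?case by (rule RGP.equivI) (simp_all add: RGP.layer_Seq layer_S_GR layer_S_cyc)
next
  case cyc_BR
  have "N Green 3 \<diamondop> (N Red 1 \<diamondop> N Green 1 \<diamondop> N Red 1) = N Red 1 \<diamondop> N Green 1"
    unfolding h_euler_swapped[symmetric] by (subst h_euler) (simp add: N_rules)
  then show ?case
    by (intro RGP.equivI) (simp_all add: RGP.layer_Seq layer_S_cyc layer_S_GR RGP.layer_cong[OF S_tri[of B]] RGP.layer_words)
next
  case (change_B m n \<theta>)
  show ?case
    using conjugate_S_tri[OF S_cyc_diags(2,1) rotate_gates(3,4)] by (simp add: extend_tensor_power)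
next
  case (change_R m n \<theta>)
  show ?case
    using conjugate_S_tri[OF S_cyc_diags rotate_gates(1,2)[of R], THEN eqv.symm] by (simp add: extend_tensor_power)
next
  case bend_GR
  show ?case by (rule RGP.equivI; (simp only: S_bend)?) (simp_all add: layer_S_GR N_rules)
next
  case bend_RG
  show ?case by (rule RGP.equivI; (simp only: S_bend)?) (simp_all add: layer_S_GR N_rules)
next
  case bend_BG
  show ?case by (rule RGP.equivI; (simp only: S_bend)?) (simp_all add: layer_S_GR N_rules)
next
  case bend_GB
  show ?case by (rule RGP.equivI; (simp only: S_bend)?) (simp_all add: layer_S_GR N_rules)
next
  case bend_RB
  show ?case by (rule RGP.equivI; (simp only: S_bend)?)
    (simp_all add: RGP.layer_cong[OF S_tri] RGP.layer_words N_Red_2 N_rules)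
next
  case bend_BR
  show ?case by (rule RGP.equivI; (simp only: S_bend)?)
    (simp_all add: RGP.layer_cong[OF S_tri] RGP.layer_words N_Red_2 N_rules)
next
  case (dagger a b)
  obtain m n where ab: "a \<in> diags node_ar m n" "b \<in> diags node_ar m n"
    using rgb_rel_diags[OF dagger(1)] by blast
  note d = RGP.dag_extend[where ar' = node_ar and \<delta>' = node_dag, OF rg_dag_ar(1) S_gen_diags dag_S_gen]
  show ?case by (rule eqv.trans[OF eqv.symm[OF d[OF ab(1)]] eqv.trans[OF rgp_dag[OF dagger(2)] d[OF ab(2)]]])
next
  case (rotate a b)
  obtain m n where ab: "a \<in> diags node_ar m n" "b \<in> diags node_ar m n"
    using rgb_rel_diags[OF rotate(1)] by blast
  have "tensor_power (extend S_gen cyc) m \<Zsemi> extend S_gen a \<Zsemi> tensor_power (extend S_gen cyc_bar) n \<cong>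
    tensor_power (extend S_gen cyc) m \<Zsemi> extend S_gen b \<Zsemi> tensor_power (extend S_gen cyc_bar) n"
    by (rule RGP.equiv_in_context[OF rotate(2)]) (use ab in \<open>simp add: diags_def\<close>)
  from eqv.trans[OF S_rotate[OF ab(1)] eqv.trans[OF this eqv.symm[OF S_rotate[OF ab(2)]]]] show ?case .
qed

section \<open>The translation \<open>T\<close>\<close>

text \<open>
  Under \<open>T\<close> both dichromatic spiders are conjugates of trichromatic red ones, green by \<open>c\<close> and red by
  a red phase gate.
\<close>

primrec t_in :: "rg_colour \<Rightarrow> rgb_gen diag" where
  "t_in Green = cyc" | "t_in Red = tri R 1 1 3"

primrec t_out :: "rg_colour \<Rightarrow> rgb_gen diag" where
  "t_out Green = cyc_bar" | "t_out Red = tri R 1 1 1"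

lemma t_shape [simp]:
  "well_formed node_ar (t_in x)" "src node_ar (t_in x) = 1" "tgt node_ar (t_in x) = 1"
  "well_formed node_ar (t_out x)" "src node_ar (t_out x) = 1" "tgt node_ar (t_out x) = 1"
  by (cases x; simp)+

lemma t_diags: "t_in x \<in> diags node_ar 1 1" "t_out x \<in> diags node_ar 1 1"
  by (simp_all add: diags_def)

lemma t_inverse: "t_in x \<Zsemi> t_out x \<simeq> wire" "t_out x \<Zsemi> t_in x \<simeq> wire"
proof -
  have "tri R 1 1 3 \<Zsemi> tri R 1 1 1 \<simeq> wire" "tri R 1 1 1 \<Zsemi> tri R 1 1 3 \<simeq> wire"
    by (rule RGB.equivI; simp add: RGB.layer_Seq P_rules RGB.layer_Ids)+
  then show "t_in x \<Zsemi> t_out x \<simeq> wire" "t_out x \<Zsemi> t_in x \<simeq> wire"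
    using cyc_inverse by (cases x; simp)+
qed

lemma tri_eq_conjugate: "tri R m n (\<theta> + of_nat n - of_nat m) \<simeq>
    tensor_power (t_in Red) m \<Zsemi> tri R m n \<theta> \<Zsemi> tensor_power (t_out Red) n"
  "tri G m n \<theta> \<simeq> tensor_power (t_in Green) m \<Zsemi> tri R m n \<theta> \<Zsemi> tensor_power (t_out Green) n"
  using R_phase_shift[of m n \<theta>] rgb_base[OF rgb_rel.change_R[of m n \<theta>]] by simp_all

lemma T_gen_diags: "T_gen g \<in> diags node_ar (fst (rg_ar g)) (snd (rg_ar g))"
  by (cases g rule: T_gen.cases) (simp_all add: diags_def)

lemma extend_T_shape [simp]:
  "src node_ar (extend T_gen d) = src rg_ar d" "tgt node_ar (extend T_gen d) = tgt rg_ar d"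
  "well_formed node_ar (extend T_gen d) = well_formed rg_ar d"
  using T_gen_diags by (induction d) (auto simp: diags_def)

lemma T_gen_conjugate:
  assumes "set_node v = {x}"
  shows "T_gen (Node v) \<simeq> tensor_power (t_in x) (fst (node_ar v)) \<Zsemi>
    tri R (fst (node_ar v)) (snd (node_ar v)) (node_phase v) \<Zsemi> tensor_power (t_out x) (snd (node_ar v))"
proof (cases x)
  case Red
  have "T_gen (Node v) = tri R (fst (node_ar v)) (snd (node_ar v))
      (node_phase v + of_nat (snd (node_ar v)) - of_nat (fst (node_ar v)))"
    using assms Red by (cases v) simp_all
  then show ?thesis unfolding Red by (simp only: tri_eq_conjugate)
next
  case Green
  have "T_gen (Node v) = tri G (fst (node_ar v)) (snd (node_ar v)) (node_phase v)"
    using assms Green by (cases v) simp_all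
  then show ?thesis unfolding Green by (simp only: tri_eq_conjugate)
qed

lemma T_spider: "extend T_gen (spider Node x m n \<theta>) \<simeq>
    tensor_power (t_in x) m \<Zsemi> tri R m n \<theta> \<Zsemi> tensor_power (t_out x) n"
proof (rule tri.extend_spider_conjugate[where ar' = rg_ar
      and \<rho> = "case_rg_gen (map_node (\<lambda>_. R)) (Phase R 0)", OF t_diags t_inverse])
  show "node_ar (case_rg_gen (map_node (\<lambda>_. R)) (Phase R 0) g) = rg_ar g" for g
    by (cases g) (simp_all add: node_ar_map)
qed (simp_all add: T_gen_conjugate)

lemma T_gr: "extend T_gen (gr m n \<theta>) \<simeq> tri G m n \<theta>"
  by (rule eqv.trans[OF T_spider eqv.symm[OF tri_eq_conjugate(2)]])

lemma T_rd: "extend T_gen (rd m n \<theta>) \<simeq> tri R m n (\<theta> + of_nat n - of_nat m)"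
  by (rule eqv.trans[OF T_spider eqv.symm[OF tri_eq_conjugate(1)]])

lemmas layer_T = RGB.layer_cong[OF T_gr] RGB.layer_cong[OF T_rd]

text \<open>
  \<open>H\<close> carries the gates of each dichromatic colour to those of the other, so that exchanging the
  colours is conjugation by \<open>H\<close>.
\<close>

lemma swap_gates: "euler_had \<Zsemi> t_in x \<simeq> t_in (swap_colour x)" "t_out x \<Zsemi> euler_had \<simeq> t_out (swap_colour x)"
proof -
  have hc: "euler_had \<Zsemi> cyc \<simeq> tri R 1 1 3"
  proof (rule RGB.equivI)
    have "layer 0 (euler_had \<Zsemi> cyc) 0 = layer 0 (euler_had \<Zsemi> euler_had) 0 \<bullet> P R 3"
      using RGB.layer_cong[OF euler_had_R3, of 0 0] by (simp add: RGB.layer_Seq[of _ euler_had] RGB.comp_assoc)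
    then show "layer 0 (euler_had \<Zsemi> cyc) 0 = layer 0 (tri R 1 1 3) 0"
      by (simp only: layer_had_had) (simp add: P_rules)
  qed simp_all
  have ch: "cyc_bar \<Zsemi> euler_had \<simeq> tri R 1 1 1"
  proof (rule RGB.equivI)
    have "layer 0 (cyc_bar \<Zsemi> euler_had) 0 = P R 1 \<bullet> layer 0 (euler_had \<Zsemi> euler_had) 0"
      using RGB.layer_cong[OF R1_euler_had, of 0 0, symmetric]
      by (simp add: RGB.layer_Seq[of _ _ euler_had] RGB.comp_assoc)
    then show "layer 0 (cyc_bar \<Zsemi> euler_had) 0 = layer 0 (tri R 1 1 1) 0"
      by (simp only: layer_had_had) (simp add: P_rules)
  qed simp_all
  show "euler_had \<Zsemi> t_in x \<simeq> t_in (swap_colour x)" "t_out x \<Zsemi> euler_had \<simeq> t_out (swap_colour x)"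
    using hc ch euler_had_R3 R1_euler_had by (cases x; simp)+
qed

lemma T_swap:
  assumes "d \<in> diags rg_ar m n"
  shows "extend T_gen (swp d) \<simeq> tensor_power euler_had m \<Zsemi> extend T_gen d \<Zsemi> tensor_power euler_had n"
  unfolding extend_map
proof (rule RGB.extend_conjugate[OF _ _ euler_had_involution euler_had_involution T_gen_diags _ assms])
  show h: "euler_had \<in> diags node_ar 1 1" by (simp add: diags_def)
  then show "euler_had \<in> diags node_ar 1 1" .
  fix g
  let ?m = "fst (rg_ar g)" and ?n = "snd (rg_ar g)"
  show "T_gen (rg_swap g) \<simeq> tensor_power euler_had ?m \<Zsemi> T_gen g \<Zsemi> tensor_power euler_had ?n"
  proof (cases g)
    case Had
    \<comment> \<open>a local name, so that the gate is not expanded into its three layers\<close>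
    define H where "H = euler_had"
    have H [simp]: "well_formed node_ar H" "src node_ar H = 1" "tgt node_ar H = 1" by (simp_all add: H_def)
    have "layer 0 H 0 \<bullet> layer 0 H 0 = RGB.idc 1"
      unfolding H_def using layer_had_had[of 0 0] by (simp only: RGB.layer_Seq[of _ euler_had euler_had]) simp
    then have "H \<simeq> tensor_power H 1 \<Zsemi> H \<Zsemi> tensor_power H 1"
      by (intro RGB.equivI) (simp_all add: RGB.layer_words)
    then show ?thesis unfolding Had H_def by simp
  next
    case (Node v)
    obtain x where x: "set_node v = {x}" by (cases v) auto
    have x': "set_node (map_node swap_colour v) = {swap_colour x}" using x by (simp add: node.set_map)
    have ph: "node_phase (map_node swap_colour v) = node_phase v" by (cases v) simp_all
    have "T_gen (rg_swap g) \<simeq> tensor_power (t_in (swap_colour x)) ?m \<Zsemi>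
        tri R ?m ?n (node_phase v) \<Zsemi> tensor_power (t_out (swap_colour x)) ?n"
      using T_gen_conjugate[OF x'] by (simp add: node_ar_map ph Node)
    also have "\<dots> \<simeq> tensor_power euler_had ?m \<Zsemi> (tensor_power (t_in x) ?m \<Zsemi>
        tri R ?m ?n (node_phase v) \<Zsemi> tensor_power (t_out x) ?n) \<Zsemi> tensor_power euler_had ?n"
      by (rule eqv.symm[OF RGB.conjugate_conjugate[OF h t_diags h _ swap_gates]]) (rule tri_diags)
    also have "\<dots> \<simeq> tensor_power euler_had ?m \<Zsemi> T_gen g \<Zsemi> tensor_power euler_had ?n"
      by (rule RGB.equiv_in_context) (use eqv.symm[OF T_gen_conjugate[OF x]] in \<open>simp_all add: Node\<close>)
    finally show ?thesis .
  qed
qed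

lemma dag_T_gen: "dag node_dag (T_gen g) \<simeq> T_gen (rg_dag g)"
proof (cases "g = Had")
  case True
  \<comment> \<open>reversing the word and negating its phases gives the inverse, and \<open>H\<close> is an involution\<close>
  define K where "K = P G 3 \<bullet> P R 3 \<bullet> P G 3"
  have "layer 0 euler_had 0 \<bullet> K = RGB.idc 1"
    by (simp add: K_def RGB.layer_Seq P_rules)
  then have "layer 0 (euler_had \<Zsemi> euler_had) 0 \<bullet> K = layer 0 euler_had 0 \<bullet> RGB.idc 1"
    by (simp only: RGB.layer_Seq[of _ euler_had euler_had] RGB.comp_assoc)
  then have "K = layer 0 euler_had 0"
    by (simp only: layer_had_had) (simp add: K_def RGB.layer_Seq P_rules)
  then show ?thesis unfolding True K_def
    by (intro RGB.equivI) (simp_all add: RGB.layer_Seq layer_dag_tri RGB.comp_assoc)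
next
  case False
  then have "layer 0 (dag node_dag (T_gen g)) 0 = layer 0 (T_gen (rg_dag g)) 0"
    by (cases g rule: T_gen.cases) (simp_all add: layer_dag_tri)
  then show ?thesis using T_gen_diags by (intro RGB.equivI) (simp_all add: diags_def)
qed

lemma T_respects_rg: "rg_rel a b \<Longrightarrow> extend T_gen a \<simeq> extend T_gen b"
proof (induction rule: rg_rel.induct)
  case (spiders a b)
  show ?case
  proof (rule tri.extend_spider_rule[where ar' = rg_ar
        and \<rho> = "case_rg_gen (map_node (\<lambda>_. G)) (Phase G 0)", OF _ _ _ _ spiders])
    show "node_ar (case_rg_gen (map_node (\<lambda>_. G)) (Phase G 0) g) = rg_ar g" for g
      by (cases g) (simp_all add: node_ar_map)
    fix v :: "rg_colour node" assume "set_node v = {Green}"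
    then show "T_gen (Node v) = tri G (fst (node_ar v)) (snd (node_ar v)) (node_phase v)"
      by (cases v) simp_all
  qed simp_all
next
  case bialgebra
  show ?case
    by (rule RGB.equivI) (use bialgebra_layers in \<open>simp_all add: RGB.layer_words layer_T\<close>)
next
  case copy
  show ?case
    by (rule RGB.equivI) (use RGB.layer_cong[OF copy_R_unit, of 0 0] in \<open>simp_all add: RGB.layer_words layer_T\<close>)
next
  case cup
  show ?case
    by (rule RGB.equivI) (simp_all add: layer_T RGB.layer_cong[OF cup_GR])
next
  case pi_copy
  show ?case
    by (rule RGB.equivI) (use RGB.layer_cong[OF pi_copy_R, of 0 0] in \<open>simp_all add: RGB.layer_words layer_T\<close>)
next
  case (pi_commute \<theta>)
  show ?case
    by (rule RGB.equivI) (simp_all add: RGB.layer_Seq layer_T G2_R)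
next
  case had_involution
  show ?case using euler_had_involution by simp
next
  case (colour_change m n \<theta>)
  have "tensor_power euler_had m \<Zsemi> tri R m n (\<theta> + of_nat n - of_nat m) \<Zsemi> tensor_power euler_had n \<simeq>
    tensor_power euler_had m \<Zsemi> extend T_gen (rd m n \<theta>) \<Zsemi> tensor_power euler_had n"
    by (rule RGB.equiv_in_context[OF eqv.symm[OF T_rd]]) simp
  from eqv.trans[OF T_gr eqv.trans[OF G_eq_conjugate_R this]] show ?case
    by (simp add: extend_tensor_power)
next
  case (dagger a b)
  obtain m n where ab: "a \<in> diags rg_ar m n" "b \<in> diags rg_ar m n"
    using rg_rel_diags[OF dagger(1)] by blast
  note d = RGB.dag_extend[where ar' = rg_ar and \<delta>' = rg_dag, OF node_ar_dag T_gen_diags dag_T_gen]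
  show ?case by (rule eqv.trans[OF eqv.symm[OF d[OF ab(1)]] eqv.trans[OF rgb_dag[OF dagger(2)] d[OF ab(2)]]])
next
  case (swap a b)
  obtain m n where ab: "a \<in> diags rg_ar m n" "b \<in> diags rg_ar m n"
    using rg_rel_diags[OF swap(1)] by blast
  have "tensor_power euler_had m \<Zsemi> extend T_gen a \<Zsemi> tensor_power euler_had n \<simeq>
    tensor_power euler_had m \<Zsemi> extend T_gen b \<Zsemi> tensor_power euler_had n"
    by (rule RGB.equiv_in_context[OF swap(2)]) (use ab in \<open>simp add: diags_def\<close>)
  from eqv.trans[OF T_swap[OF ab(1)] eqv.trans[OF this eqv.symm[OF T_swap[OF ab(2)]]]] show ?case .
qed

theorem T_respects: "rg_plus_rel a b \<Longrightarrow> extend T_gen a \<simeq> extend T_gen b"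
proof (induction rule: rg_plus_rel.induct)
  case euler
  show ?case by (rule RGB.equivI) (simp_all add: RGB.layer_Seq layer_T)
qed (rule T_respects_rg)

lemma T_equiv: "a \<cong> b \<Longrightarrow> extend T_gen a \<simeq> extend T_gen b"
  by (rule RGB.extend_equiv[OF T_gen_diags T_respects])

section \<open>The isomorphism\<close>

lemma S_T_gen: "extend S_gen (T_gen g) \<cong> Box g"
proof (cases g)
  case Had
  have "had \<cong> gr 1 1 1 \<Zsemi> rd 1 1 1 \<Zsemi> gr 1 1 1"
    by (rule eqv.base[where m = 1 and n = 1]) (simp_all add: diags_def rg_plus_rel.euler)
  from RGP.layer_cong[OF this, of 0 0] show ?thesis unfolding Had
    by (intro RGP.equivI) (simp_all add: RGP.layer_Seq layer_S_GR)
next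
  case (Node v)
  obtain x where x: "set_node v = {x}" by (cases v) auto
  have b: "Box g \<cong> spider Node x (fst (node_ar v)) (snd (node_ar v)) (node_phase v)"
    unfolding Node by (rule nd.node_eq_spider[OF x])
  have "extend S_gen (T_gen g) \<cong> spider Node x (fst (node_ar v)) (snd (node_ar v)) (node_phase v)"
  proof (cases x)
    case Green
    then show ?thesis using x S_tri_G unfolding Node by (cases v) simp_all
  next
    case Red
    have t: "T_gen g = tri R (fst (node_ar v)) (snd (node_ar v))
        (node_phase v + of_nat (snd (node_ar v)) - of_nat (fst (node_ar v)))"
      using x Red Node by (cases v) simp_all
    show ?thesis unfolding t Red
      using S_tri_R[of "fst (node_ar v)" "snd (node_ar v)" "node_phase v + of_nat (snd (node_ar v)) - of_nat (fst (node_ar v))"]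
      by simp
  qed
  from eqv.trans[OF this eqv.symm[OF b]] show ?thesis .
qed

text \<open>
  The colour change between blue and green, with the colours rotated once; \<open>c\<close> is invariant under
  the rotation.
\<close>

lemma tri_B_eq_conjugate: "tri B m n \<theta> \<simeq> tensor_power cyc_bar m \<Zsemi> tri R m n \<theta> \<Zsemi> tensor_power cyc n"
proof -
  have c: "rot cyc \<simeq> cyc"
    unfolding cyc_def using rgb_base[OF rgb_rel.cyc_BR] by (simp add: rot_tri cyc_def eqv.symm)
  have c': "rot cyc_bar \<simeq> cyc_bar"
    by (rule RGB.equivI) (use RGB.layer_cong[OF c, of 0 0] RGB.equiv_typed[OF c] in \<open>simp_all add: cyc_bar_def RGB.layer_Seq\<close>)
  have "tensor_power (rot cyc_bar) m \<Zsemi> tri R m n \<theta> \<Zsemi> tensor_power (rot cyc) n \<simeq> tri B m n \<theta>"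
    using rgb_rotate[OF rgb_base[OF rgb_rel.change_B[of m n \<theta>]]] extend_tensor_power[of "\<lambda>v. Box (map_node rotate_colour v)"]
    by (simp add: rot_tri extend_Box_map)
  moreover have "tensor_power (rot cyc_bar) m \<Zsemi> tri R m n \<theta> \<Zsemi> tensor_power (rot cyc) n \<simeq>
    tensor_power cyc_bar m \<Zsemi> tri R m n \<theta> \<Zsemi> tensor_power cyc n"
    by (rule RGB.cls_eq_iff[THEN iffD1])
      (use RGB.equiv_typed[OF c] RGB.equiv_typed[OF c'] in
        \<open>simp_all add: RGB.cls_Seq RGB.tensor_power_cong[OF c] RGB.tensor_power_cong[OF c']\<close>)
  ultimately show ?thesis by (rule eqv.trans[OF eqv.symm])
qed

text \<open>
  In the composite, the gates of \<open>S\<close> and those of \<open>T\<close> on dichromatic red multiply to the gates of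
  the colour change from trichromatic red to the colour of \<open>v\<close>.
\<close>

lemma T_S_gen: "extend T_gen (S_gen v) \<simeq> Box v"
proof -
  obtain x where x: "set_node v = {x}" by (cases v) auto
  let ?m = "fst (node_ar v)" and ?n = "snd (node_ar v)" and ?\<theta> = "node_phase v"
  let ?u = "extend T_gen (in_gate x)" and ?w = "extend T_gen (out_gate x)"
  have uw: "?u \<in> diags node_ar 1 1" "?w \<in> diags node_ar 1 1" by (simp_all add: diags_def)
  have "extend T_gen (S_gen v) \<simeq> tensor_power ?u ?m \<Zsemi> extend T_gen (rd ?m ?n ?\<theta>) \<Zsemi> tensor_power ?w ?n"
    using T_equiv[OF S_gen_conjugate[OF x]] by (simp add: extend_tensor_power)
  also have "\<dots> \<simeq> tensor_power ?u ?m \<Zsemi> (tensor_power (t_in Red) ?m \<Zsemi> tri R ?m ?n ?\<theta> \<Zsemi>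
      tensor_power (t_out Red) ?n) \<Zsemi> tensor_power ?w ?n"
    by (rule RGB.equiv_in_context[OF T_spider]) simp
  also have "\<dots> \<simeq> tri x ?m ?n ?\<theta>"
  proof (cases x)
    case R
    have "?u \<Zsemi> t_in Red \<simeq> wire" "t_out Red \<Zsemi> ?w \<simeq> wire"
      unfolding R by (rule RGB.equivI; simp add: RGB.layer_Seq layer_T P_rules RGB.layer_Ids)+
    note conj = RGB.conjugate_conjugate[OF uw(1) t_diags uw(2) tri_diags this]
    have "tensor_power wire ?m \<Zsemi> tri R ?m ?n ?\<theta> \<Zsemi> tensor_power wire ?n \<simeq> tri R ?m ?n ?\<theta>"
      using tri.sp_leg_phases[of R 0 ?m ?n ?\<theta> 0] RGB.tensor_power_cong[OF tri.sp_1_1_0]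
      by (intro RGB.cls_eq_iff[THEN iffD1]) (simp_all add: RGB.cls_Seq[symmetric] RGB.cls_eq_iff, simp_all add: RGB.cls_Seq RGB.cls_eq_iff[symmetric])
    from eqv.trans[OF conj this] show ?thesis unfolding R .
  next
    case G
    have "?u \<Zsemi> t_in Red \<simeq> t_in Green" "t_out Red \<Zsemi> ?w \<simeq> t_out Green"
      unfolding G using euler_had_R3 R1_euler_had by simp_all
    from eqv.trans[OF RGB.conjugate_conjugate[OF uw(1) t_diags uw(2) tri_diags this]
        eqv.symm[OF tri_eq_conjugate(2)]] show ?thesis unfolding G .
  next
    case B
    have "?u \<Zsemi> t_in Red \<simeq> cyc_bar" "t_out Red \<Zsemi> ?w \<simeq> cyc"
      unfolding B by (rule RGB.equivI; simp add: RGB.layer_Seq layer_T layer_cyc layer_cyc_bar)+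
    from eqv.trans[OF RGB.conjugate_conjugate[OF uw(1) t_diags uw(2) tri_diags this]
        eqv.symm[OF tri_B_eq_conjugate]] show ?thesis unfolding B .
  qed
  also have "\<dots> \<simeq> Box v" by (rule eqv.symm[OF tri.node_eq_spider[OF x]])
  finally show ?thesis .
qed

theorem theorem6p3:
  shows "smc_functor RG RGB T \<and>
    smc_functor RG RG_plus Quot \<and>
    smc_functor RG_plus RGB T_hat \<and>
    (\<forall>m n. \<forall>f\<in>mor RG m n. T_hat (Quot f) = T f) \<and>
    smc_functor RGB RG_plus S \<and>
    (\<forall>m n. \<forall>f\<in>mor RG_plus m n. S (T_hat f) = f) \<and>
    (\<forall>m n. \<forall>f\<in>mor RGB m n. T_hat (S f) = f) \<and>
    isomorphic_smc RGB RG_plus"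
proof -
  have box: "Box g \<in> diags rg_ar (fst (rg_ar g)) (snd (rg_ar g))" for g by (simp add: diags_def)
  have box_rel: "rg_rel a b \<Longrightarrow> extend Box a \<cong> extend Box b" for a b
    unfolding extend_Box_id by (rule rg_base)
  have T: "smc_functor RG RGB T"
    unfolding RG_def RGB_def T_def by (rule induced_smc_functor(1)[OF T_gen_diags T_respects_rg])
  have Q: "smc_functor RG RG_plus Quot"
    unfolding RG_def RG_plus_def Quot_def by (rule induced_smc_functor(1)[OF box box_rel])
  have T_hat: "smc_functor RG_plus RGB T_hat"
    unfolding RG_plus_def RGB_def T_hat_def by (rule induced_smc_functor(1)[OF T_gen_diags T_respects])
  have S: "smc_functor RGB RG_plus S"
    unfolding RG_plus_def RGB_def S_def by (rule induced_smc_functor(1)[OF S_gen_diags S_respects])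
  note T_cls = induced_smc_functor(2)[where rel' = rg_rel, OF T_gen_diags T_respects_rg, folded T_def]
    and Q_cls = induced_smc_functor(2)[OF box box_rel, folded Quot_def, unfolded extend_Box_id]
    and T_hat_cls = induced_smc_functor(2)[where rel' = rg_plus_rel, OF T_gen_diags T_respects, folded T_hat_def]
    and S_cls = induced_smc_functor(2)[OF S_gen_diags S_respects, folded S_def]
  have TQ: "T_hat (Quot f) = T f" if "f \<in> mor RG m n" for f m n
    using that unfolding RG_def presented_simps by (auto simp: diags_def Q_cls T_hat_cls T_cls)
  have ST: "S (T_hat f) = f" if "f \<in> mor RG_plus m n" for f m n
  proof -
    from that obtain a where a: "a \<in> diags rg_ar m n" "f = cls rg_ar rg_plus_rel a"
      unfolding RG_plus_def presented_simps by blast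
    have "extend S_gen (extend T_gen a) \<cong> a"
      using RGP.extend_cong[OF box S_T_gen a(1)] by (simp add: extend_extend extend_Box_id)
    from cls_eqI[OF this] a show ?thesis by (simp add: diags_def T_hat_cls S_cls)
  qed
  have TS: "T_hat (S f) = f" if "f \<in> mor RGB m n" for f m n
  proof -
    from that obtain a where a: "a \<in> diags node_ar m n" "f = cls node_ar rgb_rel a"
      unfolding RGB_def presented_simps by blast
    have "Box v \<in> diags node_ar (fst (node_ar v)) (snd (node_ar v))" for v by (simp add: diags_def)
    from RGB.extend_cong[OF this T_S_gen a(1)] have "extend T_gen (extend S_gen a) \<simeq> a"
      by (simp add: extend_extend extend_Box_id)
    from cls_eqI[OF this] a show ?thesis by (simp add: diags_def T_hat_cls S_cls)
  qed
  have "inverse_functors RGB RG_plus S T_hat"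
    unfolding inverse_functors_def using S T_hat ST TS by blast
  then show ?thesis
    using T Q T_hat S TQ ST TS unfolding isomorphic_smc_def by blast
qed

end
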